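(* Let $X=(X_1,X_2)$ be a random vector in $\mathbb{R}^2$ with $\mathbb{E}[X_i]=0$ and $\mathbb{E}[X_iX_j]=\delta_{ij}$ for $i,j\in\{1,2\}$, and let $S(n)=X(1)+\dots+X(n)$, where $X(1),X(2),\dots$ are independent copies of $X$. Assume that there is a two-dimensional lattice $R\subset\mathbb{R}^2$ with $\mathbb{P}(S(n)\in R\text{ for all }n)=1$. Let $\alpha\in(0,\pi]$ and assume that, for every $x\in R\cap K_\alpha$, almost surely $x+S(\tau_x)\in\partial K_\alpha$. Then for every positive integer $k<\frac{\pi}{2\alpha}$, the function $x\mapsto\mathbb{E}[\tau_x^k]$, $x\in K_\alpha\cap R$, is a polynomial of degree $2k$. In particular (the case $k=1<\frac{\pi}{2\alpha}$), $$\mathbb{E}[\tau_x]=x_2(x_1\tan\alpha-x_2),\qquad x\in K_\alpha\cap R.$$ All higher moments can be computed recursively.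
   Context: For $\alpha\in(0,\pi]$, $K_\alpha:=\{(r\cos\varphi,r\sin\varphi):r>0,\ 0<\varphi<\alpha\}$ is the open wedge of opening $\alpha$ with vertex at the origin, and $\partial K_\alpha$ is its boundary. For $x=(x_1,x_2)\in K_\alpha$, $\tau_x:=\inf\{n\ge1:x+S(n)\notin K_\alpha\}$ is the exit time of the walk started at $x$.
   Formalization: The claims about E[τ_x^k] additionally assume E|X|^{2k} < ∞ for the k in question (automatic for k = 1); with only second moments the claim fails, e.g. for k = 2, where large jumps into the wedge can make E[τ_x^2] infinite. *)

theory Defs
  imports "HOL-Probability.Probability"
begin

definition wedge :: "real \<Rightarrow> (real \<times> real) set" where
  "wedge \<alpha> = {(r * cos \<phi>, r * sin \<phi>) | r \<phi>. r > 0 \<and> 0 < \<phi> \<and> \<phi> < \<alpha>}"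

definition planar_lattice :: "(real \<times> real) set \<Rightarrow> bool" where
  "planar_lattice R \<longleftrightarrow>
     (\<exists>u v. u \<noteq> v \<and> independent {u, v} \<and>
        R = {of_int m *\<^sub>R u + of_int n *\<^sub>R v | m n :: int. True})"

definition walk :: "(nat \<Rightarrow> 'w \<Rightarrow> real \<times> real) \<Rightarrow> nat \<Rightarrow> 'w \<Rightarrow> real \<times> real" where
  "walk Y n \<omega> = (\<Sum>i=1..n. Y i \<omega>)"

text \<open>The exit time is \<open>enat\<close>-valued, so that it is infinite if the walk never leaves \<open>K\<close>.\<close>

definition exit_time ::
  "(real \<times> real) set \<Rightarrow> (nat \<Rightarrow> 'w \<Rightarrow> real \<times> real) \<Rightarrow> real \<times> real \<Rightarrow> 'w \<Rightarrow> enat" where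
  "exit_time K Y x \<omega> = Inf {enat n | n. n \<ge> 1 \<and> x + walk Y n \<omega> \<notin> K}"

text \<open>Moments are taken in the extended nonnegative reals; in particular, an equation
  \<open>exit_moment M K Y k x = ennreal c\<close> asserts that the moment is finite. Since the exit time is at
  least 1, the moment is at least 1, so such an equation also forces \<open>c \<ge> 1\<close> and the
  truncation of negative reals by \<open>ennreal\<close> plays no role.\<close>

definition exit_moment ::
  "'w measure \<Rightarrow> (real \<times> real) set \<Rightarrow> (nat \<Rightarrow> 'w \<Rightarrow> real \<times> real) \<Rightarrow> nat \<Rightarrow> real \<times> real \<Rightarrow> ennreal"
  where
  "exit_moment M K Y k x = (\<integral>\<^sup>+ \<omega>. ennreal_of_enat (exit_time K Y x \<omega>) ^ k \<partial>M)"

text \<open>A polynomial in two variables \<open>x\<^sub>1\<close>, \<open>x\<^sub>2\<close> is a polynomial in \<open>x\<^sub>2\<close> whose coefficients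
  are polynomials in \<open>x\<^sub>1\<close>: the coefficient of \<open>x\<^sub>1 ^ i * x\<^sub>2 ^ j\<close> in \<open>p\<close> is
  \<open>coeff (coeff p j) i\<close>. As for \<open>degree\<close>, the zero polynomial has total degree 0.\<close>

definition poly2 :: "real poly poly \<Rightarrow> real \<times> real \<Rightarrow> real" where
  "poly2 p x = poly (poly p [:snd x:]) (fst x)"

definition total_degree :: "real poly poly \<Rightarrow> nat" where
  "total_degree p = Max (insert 0 {i + j | i j. coeff (coeff p j) i \<noteq> 0})"

definition represents_moment ::
  "'w measure \<Rightarrow> (real \<times> real) set \<Rightarrow> (nat \<Rightarrow> 'w \<Rightarrow> real \<times> real) \<Rightarrow> (real \<times> real) set \<Rightarrow> nat \<Rightarrow>
     real poly poly \<Rightarrow> bool" where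
  "represents_moment M K Y R k p \<longleftrightarrow> (\<forall>x \<in> R \<inter> K. exit_moment M K Y k x = ennreal (poly2 p x))"

text \<open>The boundary value problem for the \<open>k\<close>-th moment, given polynomials \<open>p 0\<close>, ..., \<open>p (k - 1)\<close>
  for the lower ones. The equation is the first-step decomposition
  \<open>\<tau>\<^sub>x = 1 + \<tau>\<^sub>y\<close> with \<open>y = x + X\<close>, expanded by the binomial theorem; it is linear in the
  finitely many coefficients of \<open>q\<close>.\<close>

definition solves_moment_problem ::
  "'w measure \<Rightarrow> ('w \<Rightarrow> real \<times> real) \<Rightarrow> (real \<times> real) set \<Rightarrow> (real \<times> real) set \<Rightarrow> nat \<Rightarrow>
     (nat \<Rightarrow> real poly poly) \<Rightarrow> real poly poly \<Rightarrow> bool" where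
  "solves_moment_problem M X K R k p q \<longleftrightarrow>
     total_degree q \<le> 2 * k \<and>
     (\<forall>y \<in> frontier K. poly2 q y = 0) \<and>
     (\<forall>x \<in> R \<inter> K. poly2 q x =
        (\<integral>\<omega>. poly2 q (x + X \<omega>) \<partial>M) +
        (\<Sum>j<k. real (k choose j) * (\<integral>\<omega>. poly2 (p j) (x + X \<omega>) \<partial>M)))"

end

theory Submission
  imports Defs
begin

text \<open>
  Write \<open>K\<close> for the wedge, \<open>\<mu>\<close> for the law of a step and \<open>P f y = \<integral>z. f (y + z) \<partial>\<mu>\<close> for the one-step
  average. Since \<open>\<mu>\<close> is centred, \<open>P f - f\<close> is a polynomial of degree at most \<open>d - 2\<close> whenever \<open>f\<close> is one
  of degree \<open>d\<close>. The first-step decomposition suggests that the \<open>k\<close>-th moment of the exit time is a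
  polynomial \<open>u\<^sub>k\<close> that vanishes on the two boundary rays and satisfies \<open>u\<^sub>k - P u\<^sub>k = G\<^sub>k\<close>, where
  \<open>G\<^sub>k = (\<Sum>j<k. (k choose j) * P u\<^sub>j)\<close>.

  Such a polynomial is identified with the moment by optional stopping. Let \<open>M\<^sub>n\<close> be the walk started at
  \<open>x\<close> and frozen when it leaves \<open>K\<close>. As it leaves \<open>K\<close> only through the rays, where \<open>u\<^sub>k\<close> is zero, the sum
  of \<open>E[G\<^sub>k(M\<^sub>i); M\<^sub>i \<in> K]\<close> over \<open>i < n\<close> is \<open>u\<^sub>k x - E[u\<^sub>k(M\<^sub>n); M\<^sub>n \<in> K]\<close>, and the last term tends to 0
  (\<open>optional_stopping\<close>). On the other hand, expressing the exit moments by the survival probabilities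
  and using the Markov property shows that the infinite sum is the \<open>k\<close>-th moment itself
  (\<open>is_moment_funI\<close>).

  The vanishing of the last term is where \<open>k < \<pi> / (2 * \<alpha>)\<close> enters. The harmonic polynomial
  \<open>r ^ (2k) * cos (2k\<phi> - k\<alpha>)\<close> is then at least \<open>cos (k\<alpha>) * r ^ (2k)\<close> on the closed wedge, and subtracting
  a small multiple of \<open>r ^ (2k)\<close> gives it a strictly negative drift of order \<open>r ^ (2k - 2)\<close>, which absorbs
  the error terms coming from the third and higher moments of the step. The resulting superharmonic
  polynomial (\<open>lyapunov_function\<close>) bounds \<open>E[|M\<^sub>n| ^ (2k)]\<close> uniformly in \<open>n\<close>. Doob's inequality
  upgrades this to an integrable bound on the maximum, and dominated convergence does the rest.

  Optional stopping with \<open>G = 0\<close> also says that a polynomial of degree at most \<open>2k\<close> that vanishes on the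
  boundary and is harmonic for the walk is zero. So the linear map that sends a polynomial \<open>g\<close> of degree
  at most \<open>2k - 2\<close> to \<open>(l * g) - P (l * g)\<close>, with \<open>l\<close> the product of the equations of the two rays, is
  injective. It maps a finite-dimensional space to itself, hence it is onto, which yields
  \<open>u\<^sub>k\<close> (\<open>poisson_equation_solvable\<close>). The degree of \<open>u\<^sub>k\<close> is exactly \<open>2k\<close> because a smaller degree would,
  through the recursion, force a smaller degree on \<open>u\<^sub>k\<^sub>-\<^sub>1\<close> as well, down to \<open>u\<^sub>1\<close>, which has drift \<open>-1\<close>
  and so is not affine. Finally, a polynomial is determined by its values on the lattice points of a wedge,
  which turns all statements about lattice points into statements about polynomials.
\<close>

section \<open>Polynomial functions of two variables\<close>

text \<open>
  Functions rather than formal polynomials: averages over a random step are then plain integrals, and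
  every property closed under sums needs to be checked for monomials only. The index is an upper bound
  for the total degree.
\<close>

inductive poly_fun :: "nat \<Rightarrow> (real \<times> real \<Rightarrow> real) \<Rightarrow> bool" where
  monomial: "i + j \<le> d \<Longrightarrow> poly_fun d (\<lambda>y. c * fst y ^ i * snd y ^ j)"
| add: "poly_fun d f \<Longrightarrow> poly_fun d g \<Longrightarrow> poly_fun d (\<lambda>y. f y + g y)"

lemma poly_fun_const: "poly_fun d (\<lambda>y. c)"
  using poly_fun.monomial[of 0 0 d c] by simp

lemma poly_fun_fst: "1 \<le> d \<Longrightarrow> poly_fun d fst"
  using poly_fun.monomial[of 1 0 d 1] by (simp add: eta_contract_eq)

lemma poly_fun_snd: "1 \<le> d \<Longrightarrow> poly_fun d snd"
  using poly_fun.monomial[of 0 1 d 1] by (simp add: eta_contract_eq)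

lemma poly_fun_mono: "poly_fun d f \<Longrightarrow> d \<le> e \<Longrightarrow> poly_fun e f"
  by (induction rule: poly_fun.induct) (auto intro: poly_fun.intros)

lemma poly_fun_monomial_mult:
  assumes "poly_fun e g" "i + j \<le> d"
  shows "poly_fun (d + e) (\<lambda>y. c * fst y ^ i * snd y ^ j * g y)"
  using assms(1)
proof (induction rule: poly_fun.induct)
  case (monomial i' j' e c')
  have "poly_fun (d + e) (\<lambda>y. (c * c') * fst y ^ (i + i') * snd y ^ (j + j'))"
    using monomial assms(2) by (intro poly_fun.monomial) auto
  then show ?case by (simp add: power_add mult_ac)
next
  case (add e f g)
  then show ?case by (auto simp: distrib_left intro: poly_fun.add)
qed

lemma poly_fun_mult:
  assumes "poly_fun d f" "poly_fun e g"
  shows "poly_fun (d + e) (\<lambda>y. f y * g y)"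
  using assms
  by (induction rule: poly_fun.induct)
     (auto simp: distrib_right intro: poly_fun.add poly_fun_monomial_mult)

lemma poly_fun_cmult: "poly_fun d f \<Longrightarrow> poly_fun d (\<lambda>y. c * f y)"
  using poly_fun_mult[OF poly_fun_const[of 0 c], of d f] by simp

lemma poly_fun_diff:
  assumes "poly_fun d f" "poly_fun d g" shows "poly_fun d (\<lambda>y. f y - g y)"
  using poly_fun.add[OF assms(1) poly_fun_cmult[OF assms(2), of "-1"]] by simp

lemma poly_fun_sum:
  assumes "\<And>a. a \<in> A \<Longrightarrow> poly_fun d (f a)"
  shows "poly_fun d (\<lambda>y. \<Sum>a\<in>A. f a y)"
  using assms by (induction A rule: infinite_finite_induct)
    (auto intro: poly_fun_const poly_fun.add)

lemma poly_fun_power: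
  assumes "poly_fun d f" shows "poly_fun (n * d) (\<lambda>y. f y ^ n)"
  by (induction n) (auto intro: poly_fun_const poly_fun_mult assms)

lemma continuous_on_poly_fun: "poly_fun d f \<Longrightarrow> continuous_on UNIV f"
  by (induction rule: poly_fun.induct) (auto intro!: continuous_intros)

lemma borel_measurable_poly_fun: "poly_fun d f \<Longrightarrow> f \<in> borel_measurable borel"
  by (intro borel_measurable_continuous_onI continuous_on_poly_fun)

lemma power_le_one_plus_power:
  fixes r :: real
  assumes "0 \<le> r" "e \<le> d" shows "r ^ e \<le> 1 + r ^ d"
proof (cases "r \<le> 1")
  case True
  then have "r ^ e \<le> 1" using assms by (intro power_le_one) auto
  moreover have "0 \<le> r ^ d" using assms by simp
  ultimately show ?thesis by linarith
next
  case False
  then have "r ^ e \<le> r ^ d" using assms by (intro power_increasing) auto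
  then show ?thesis by simp
qed

lemma poly_fun_growth:
  assumes "poly_fun d f"
  shows "\<exists>C\<ge>0. \<forall>y. \<bar>f y\<bar> \<le> C * (1 + norm y ^ d)"
  using assms
proof (induction rule: poly_fun.induct)
  case (monomial i j d c)
  have "\<bar>c * fst y ^ i * snd y ^ j\<bar> \<le> \<bar>c\<bar> * (1 + norm y ^ d)" for y :: "real \<times> real"
  proof -
    have "\<bar>fst y\<bar> \<le> norm y" "\<bar>snd y\<bar> \<le> norm y"
      using norm_fst_le[of "fst y" "snd y"] norm_snd_le[of "snd y" "fst y"] by auto
    then have "\<bar>fst y\<bar> ^ i * \<bar>snd y\<bar> ^ j \<le> norm y ^ i * norm y ^ j"
      by (intro mult_mono power_mono) auto
    also have "\<dots> = norm y ^ (i + j)" by (simp add: power_add)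
    also have "\<dots> \<le> 1 + norm y ^ d" using monomial by (intro power_le_one_plus_power) auto
    finally show ?thesis by (simp add: abs_mult power_abs mult.assoc mult_left_mono)
  qed
  then show ?case by (intro exI[of _ "\<bar>c\<bar>"]) auto
next
  case (add d f g)
  then obtain C D where "C \<ge> 0" "D \<ge> 0" "\<forall>y. \<bar>f y\<bar> \<le> C * (1 + norm y ^ d)"
    "\<forall>y. \<bar>g y\<bar> \<le> D * (1 + norm y ^ d)" by blast
  then show ?case
    by (intro exI[of _ "C + D"]) (auto simp: distrib_right intro!: order_trans[OF abs_triangle_ineq] add_mono)
qed

text \<open>
  Restricting to lines reduces questions about zeros on a lattice to one-variable polynomials with
  infinitely many integer roots.
\<close>

lemma poly_fun_line:
  assumes "poly_fun d f"
  shows "\<exists>q :: real poly. \<forall>t. f (x + t *\<^sub>R v) = poly q t"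
  using assms
proof (induction rule: poly_fun.induct)
  case (monomial i j d c)
  show ?case
    by (intro exI[of _ "smult c ([:fst x, fst v:] ^ i * [:snd x, snd v:] ^ j)"])
       (simp add: mult_ac)
next
  case (add d f g)
  then obtain p q where "\<forall>t. f (x + t *\<^sub>R v) = poly p t" "\<forall>t. g (x + t *\<^sub>R v) = poly q t" by blast
  then show ?case by (intro exI[of _ "p + q"]) simp
qed

lemma poly_vanishes_if_eventually_zero_nat:
  fixes q :: "real poly"
  assumes "\<And>n::nat. n \<ge> N \<Longrightarrow> poly q (real n) = 0"
  shows "q = 0"
proof (rule ccontr)
  assume "q \<noteq> 0"
  then have "finite {x. poly q x = 0}" by (rule poly_roots_finite)
  moreover have "real ` {N..} \<subseteq> {x. poly q x = 0}" using assms by auto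
  ultimately have "finite (real ` {N..})" by (rule rev_finite_subset)
  then have "finite {N..}" by (subst (asm) finite_image_iff) auto
  then show False by (simp add: infinite_Ici)
qed

definition degree_le :: "nat \<Rightarrow> real poly poly \<Rightarrow> bool" where
  "degree_le d p \<longleftrightarrow> (\<forall>i j. coeff (coeff p j) i \<noteq> 0 \<longrightarrow> i + j \<le> d)"

lemma finite_support: "finite {i + j | i j. coeff (coeff p j) i \<noteq> 0}"
proof -
  have "{(i, j). coeff (coeff p j) i \<noteq> 0} \<subseteq> (\<Union>j\<le>degree p. (\<lambda>i. (i, j)) ` {..degree (coeff p j)})"
  proof (clarify)
    fix i j assume "coeff (coeff p j) i \<noteq> 0"
    then have "j \<le> degree p" "i \<le> degree (coeff p j)"
      by (auto intro: le_degree simp flip: leading_coeff_0_iff) 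
    then show "(i, j) \<in> (\<Union>j\<le>degree p. (\<lambda>i. (i, j)) ` {..degree (coeff p j)})" by auto
  qed
  then have "finite {(i, j). coeff (coeff p j) i \<noteq> 0}" by (rule finite_subset) auto
  moreover have "{i + j | i j. coeff (coeff p j) i \<noteq> 0} = (\<lambda>(i, j). i + j) ` {(i, j). coeff (coeff p j) i \<noteq> 0}"
    by auto
  ultimately show ?thesis by simp
qed

lemma total_degree_le_iff: "total_degree p \<le> d \<longleftrightarrow> degree_le d p"
  unfolding total_degree_def degree_le_def using finite_support[of p]
  by (subst Max_le_iff) auto

lemma poly2_add: "poly2 (p + q) y = poly2 p y + poly2 q y"
  by (simp add: poly2_def)

lemma poly2_diff: "poly2 (p - q) y = poly2 p y - poly2 q y"
  by (simp add: poly2_def)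

lemma poly_eq_sum_atMost:
  fixes p :: "'a :: comm_ring_1 poly"
  assumes "degree p \<le> n"
  shows "poly p x = (\<Sum>i\<le>n. coeff p i * x ^ i)"
  unfolding poly_altdef using assms
  by (intro sum.mono_neutral_left) (auto simp: coeff_eq_0)

lemma poly2_eq_sum:
  assumes "degree_le d p"
  shows "poly2 p y = (\<Sum>j\<le>d. \<Sum>i\<le>d. coeff (coeff p j) i * fst y ^ i * snd y ^ j)"
proof -
  have 1: "degree (coeff p j) \<le> d" for j
    using assms unfolding degree_le_def by (intro degree_le) (metis add_leE leD)
  have 2: "degree p \<le> d"
  proof (rule degree_le, safe)
    fix j assume "d < j"
    then have "coeff (coeff p j) i = 0" for i using assms unfolding degree_le_def by (metis add_leE leD)
    then show "coeff p j = 0" by (simp add: poly_eq_iff)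
  qed
  have "poly2 p y = poly (\<Sum>j\<le>d. coeff p j * [:snd y:] ^ j) (fst y)"
    unfolding poly2_def using 2 by (simp add: poly_eq_sum_atMost)
  also have "\<dots> = (\<Sum>j\<le>d. poly (coeff p j) (fst y) * snd y ^ j)"
    by (simp add: poly_sum)
  also have "\<dots> = (\<Sum>j\<le>d. (\<Sum>i\<le>d. coeff (coeff p j) i * fst y ^ i) * snd y ^ j)"
    using 1 by (intro sum.cong refl arg_cong2[where f="(*)"] poly_eq_sum_atMost) auto
  finally show ?thesis by (simp add: sum_distrib_right)
qed

lemma poly_fun_poly2:
  assumes "degree_le d p" shows "poly_fun d (poly2 p)"
proof -
  have "poly_fun d (\<lambda>y. coeff (coeff p j) i * fst y ^ i * snd y ^ j)" for i j
    using assms poly_fun.monomial[of i j d "coeff (coeff p j) i"] poly_fun_const[of d 0]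
    by (cases "coeff (coeff p j) i = 0") (auto simp: degree_le_def)
  then have "poly_fun d (\<lambda>y. \<Sum>j\<le>d. \<Sum>i\<le>d. coeff (coeff p j) i * fst y ^ i * snd y ^ j)"
    by (intro poly_fun_sum)
  then show ?thesis using poly2_eq_sum[OF assms] by presburger
qed

lemma poly_fun_imp_poly2:
  assumes "poly_fun d f"
  shows "\<exists>p. degree_le d p \<and> poly2 p = f"
  using assms
proof (induction rule: poly_fun.induct)
  case (monomial i j d c)
  show ?case
    by (rule exI[of _ "monom (monom c i) j"])
       (use monomial in \<open>auto simp: degree_le_def poly2_def poly_monom fun_eq_iff split: if_splits\<close>)
next
  case (add d f g)
  then obtain p q where pq: "degree_le d p" "poly2 p = f" "degree_le d q" "poly2 q = g" by blast
  have "degree_le d (p + q)"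
    using pq(1,3) unfolding degree_le_def by (metis add.right_neutral coeff_add)
  then show ?case using pq by (intro exI[of _ "p + q"]) (auto simp: poly2_add fun_eq_iff)
qed

lemma poly2_vanishes:
  assumes "\<And>y. poly2 p y = 0"
  shows "p = 0"
proof (rule ccontr)
  assume "p \<noteq> 0"
  then have fin: "finite {x. poly p x = 0}" by (rule poly_roots_finite)
  have "poly p [:t:] = 0" for t
    using assms[of "(_, t)"] by (intro poly_all_0_iff_0[THEN iffD1]) (auto simp: poly2_def)
  then have "range (\<lambda>t::real. [:t:]) \<subseteq> {x. poly p x = 0}" by auto
  then have "finite (range (\<lambda>t::real. [:t:]))" using fin by (rule finite_subset)
  then have "finite (UNIV :: real set)" by (subst (asm) finite_image_iff) (auto intro: injI)
  then show False using infinite_UNIV_char_0 by blast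
qed

section \<open>Wedges and planar lattices\<close>

text \<open>
  A linear form that vanishes on the ray of angle \<open>\<alpha>\<close> and is positive to its right; together with the
  second coordinate it cuts out an acute wedge by two linear inequalities.
\<close>

definition ray_gap :: "real \<Rightarrow> real \<times> real \<Rightarrow> real" where
  "ray_gap \<alpha> y = fst y * sin \<alpha> - snd y * cos \<alpha>"

lemma ray_gap_add: "ray_gap \<alpha> (x + y) = ray_gap \<alpha> x + ray_gap \<alpha> y"
  by (simp add: ray_gap_def algebra_simps)

lemma ray_gap_scaleR: "ray_gap \<alpha> (c *\<^sub>R x) = c * ray_gap \<alpha> x"
  by (simp add: ray_gap_def algebra_simps)

lemma wedge_eq:
  assumes "0 < \<alpha>" "\<alpha> < pi / 2"
  shows "wedge \<alpha> = {y. 0 < snd y \<and> 0 < ray_gap \<alpha> y}"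
proof (intro equalityI subsetI)
  fix y assume "y \<in> wedge \<alpha>"
  then obtain r \<phi> where y: "y = (r * cos \<phi>, r * sin \<phi>)" "r > 0" "0 < \<phi>" "\<phi> < \<alpha>"
    unfolding wedge_def by auto
  have "ray_gap \<alpha> y = r * sin (\<alpha> - \<phi>)"
    by (simp add: y ray_gap_def sin_diff algebra_simps)
  moreover have "sin (\<alpha> - \<phi>) > 0" "sin \<phi> > 0" using y assms by (auto intro!: sin_gt_zero)
  ultimately show "y \<in> {y. 0 < snd y \<and> 0 < ray_gap \<alpha> y}" using y by simp
next
  fix y assume "y \<in> {y. 0 < snd y \<and> 0 < ray_gap \<alpha> y}"
  then have y: "0 < snd y" "snd y * cos \<alpha> < fst y * sin \<alpha>" by (auto simp: ray_gap_def)
  have ca: "cos \<alpha> > 0" "sin \<alpha> > 0" using assms by (auto intro: cos_gt_zero sin_gt_zero)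
  then have "0 < fst y * sin \<alpha>" using y by (meson less_trans mult_pos_pos)
  then have x: "0 < fst y" using ca by (simp add: zero_less_mult_iff)
  define \<phi> where "\<phi> = arctan (snd y / fst y)"
  have "0 < \<phi>" unfolding \<phi>_def using x y by simp
  have "snd y / fst y < tan \<alpha>" using x y ca by (simp add: tan_def field_simps)
  then have "\<phi> < arctan (tan \<alpha>)" unfolding \<phi>_def by (rule arctan_monotone)
  also have "\<dots> = \<alpha>" using assms by (intro arctan_tan) auto
  finally have "\<phi> < \<alpha>" .
  have cp: "cos \<phi> > 0" using \<open>0 < \<phi>\<close> \<open>\<phi> < \<alpha>\<close> assms by (intro cos_gt_zero) auto
  have "sin \<phi> = (snd y / fst y) * cos \<phi>"
    using tan_arctan[of "snd y / fst y"] cp unfolding \<phi>_def[symmetric] tan_def by (simp add: field_simps)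
  then have "y = ((fst y / cos \<phi>) * cos \<phi>, (fst y / cos \<phi>) * sin \<phi>)"
    using cp x by (simp add: prod_eq_iff field_simps)
  moreover have "fst y / cos \<phi> > 0" using x cp by simp
  ultimately show "y \<in> wedge \<alpha>" unfolding wedge_def using \<open>0 < \<phi>\<close> \<open>\<phi> < \<alpha>\<close> by blast
qed

lemma open_wedge:
  assumes "0 < \<alpha>" "\<alpha> < pi / 2" shows "open (wedge \<alpha>)"
  unfolding wedge_eq[OF assms] ray_gap_def by (intro open_Collect_conj open_Collect_less continuous_intros)

lemma frontier_wedgeD:
  assumes "0 < \<alpha>" "\<alpha> < pi / 2" "y \<in> frontier (wedge \<alpha>)"
  shows "snd y * ray_gap \<alpha> y = 0"
proof -
  have "closed {y. 0 \<le> snd y \<and> 0 \<le> ray_gap \<alpha> y}"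
    unfolding ray_gap_def by (intro closed_Collect_conj closed_Collect_le continuous_intros)
  then have "closure (wedge \<alpha>) \<subseteq> {y. 0 \<le> snd y \<and> 0 \<le> ray_gap \<alpha> y}"
    using wedge_eq[OF assms(1,2)] by (intro closure_minimal) auto
  then have "0 \<le> snd y" "0 \<le> ray_gap \<alpha> y" using assms(3) by (auto simp: frontier_def)
  moreover have "y \<notin> wedge \<alpha>"
    using assms(3) open_wedge[OF assms(1,2)] by (simp add: frontier_def interior_open)
  ultimately show ?thesis unfolding wedge_eq[OF assms(1,2)] by auto
qed

lemma planar_latticeE:
  assumes "planar_lattice R"
  obtains u v where "u \<noteq> v" "independent {u, v}"
    "R = {of_int m *\<^sub>R u + of_int n *\<^sub>R v | m n :: int. True}"
  using assms unfolding planar_lattice_def by (elim exE conjE)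

lemma planar_lattice_add:
  assumes "planar_lattice R" "x \<in> R" "y \<in> R" shows "x + y \<in> R"
proof -
  obtain u v where R: "R = {of_int m *\<^sub>R u + of_int n *\<^sub>R v | m n :: int. True}"
    using assms(1) by (elim planar_latticeE)
  obtain a b c d :: int where "x = of_int a *\<^sub>R u + of_int b *\<^sub>R v" "y = of_int c *\<^sub>R u + of_int d *\<^sub>R v"
    using assms(2,3) R by auto
  then have "x + y = of_int (a + c) *\<^sub>R u + of_int (b + d) *\<^sub>R v"
    by (simp add: scaleR_add_left)
  then show ?thesis unfolding R by blast
qed

lemma planar_lattice_scaleR_nat:
  assumes "planar_lattice R" "x \<in> R" shows "real n *\<^sub>R x \<in> R"
proof -
  obtain u v where R: "R = {of_int m *\<^sub>R u + of_int n *\<^sub>R v | m n :: int. True}"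
    using assms(1) by (elim planar_latticeE)
  obtain a b :: int where "x = of_int a *\<^sub>R u + of_int b *\<^sub>R v"
    using assms(2) R by auto
  then have "real n *\<^sub>R x = of_int (int n * a) *\<^sub>R u + of_int (int n * b) *\<^sub>R v"
    by (simp add: scaleR_add_right)
  then show ?thesis unfolding R by blast
qed

lemma countable_planar_lattice:
  assumes "planar_lattice R" shows "countable R"
proof -
  obtain u v where R: "R = {of_int m *\<^sub>R u + of_int n *\<^sub>R v | m n :: int. True}"
    using assms(1) by (elim planar_latticeE)
  have "R \<subseteq> (\<lambda>(m, n). of_int m *\<^sub>R u + of_int n *\<^sub>R v) ` (UNIV :: (int \<times> int) set)"
    unfolding R by force
  then show ?thesis by (rule countable_subset) simp
qed

lemma span_independent_pair:
  fixes u v :: "real \<times> real"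
  assumes "u \<noteq> v" "independent {u, v}"
  shows "\<exists>s t. y = s *\<^sub>R u + t *\<^sub>R v"
proof -
  have "card {u, v} = DIM(real \<times> real)" using assms(1) by simp
  then have "UNIV \<subseteq> span {u, v}"
    using assms(2) by (intro card_ge_dim_independent) auto
  then have "y \<in> span {u, v}" by auto
  then show ?thesis by (auto simp: span_insert span_singleton algebra_simps)
qed

lemma eventually_affine_pos:
  fixes a b :: real
  assumes "0 < b" shows "\<exists>N::nat. \<forall>n\<ge>N. 0 < a + real n * b"
proof -
  obtain N :: nat where "- a / b < real N" using reals_Archimedean2 by blast
  then have "- a < real N * b" using assms by (simp add: field_simps)
  moreover have "real N * b \<le> real n * b" if "n \<ge> N" for n using that assms by simp
  ultimately show ?thesis by (intro exI[of _ N]) (smt (verit))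
qed

text \<open>
  Along a direction inside the wedge both linear forms grow without bound, whatever the starting point.
\<close>

lemma wedge_absorbs_translates:
  assumes "0 < \<alpha>" "\<alpha> < pi / 2" "e \<in> wedge \<alpha>"
  shows "\<exists>N::nat. \<forall>n\<ge>N. x + real n *\<^sub>R e \<in> wedge \<alpha>"
proof -
  have "0 < snd e" "0 < ray_gap \<alpha> e" using assms(3) wedge_eq[OF assms(1,2)] by auto
  then obtain N N' :: nat where "\<forall>n\<ge>N. 0 < snd x + real n * snd e"
    "\<forall>n\<ge>N'. 0 < ray_gap \<alpha> x + real n * ray_gap \<alpha> e"
    using eventually_affine_pos by metis
  then show ?thesis unfolding wedge_eq[OF assms(1,2)]
    by (intro exI[of _ "max N N'"]) (auto simp: ray_gap_add ray_gap_scaleR)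
qed

text \<open>
  Far along a ray inside the wedge, rounding the lattice coordinates of a point moves it by a bounded
  amount, which no longer matters for the signs of the two linear forms.
\<close>

lemma lattice_meets_wedge:
  assumes "planar_lattice R" "0 < \<alpha>" "\<alpha> < pi / 2"
  shows "\<exists>e. e \<in> R \<inter> wedge \<alpha>"
proof -
  obtain u v where uv: "u \<noteq> v" "independent {u, v}"
    and R: "R = {of_int m *\<^sub>R u + of_int n *\<^sub>R v | m n :: int. True}"
    using assms(1) by (elim planar_latticeE)
  \<comment> \<open>a point on the axis of the wedge\<close>
  define y where "y = (cos (\<alpha> / 2), sin (\<alpha> / 2))"
  have y: "y \<in> wedge \<alpha>" unfolding wedge_def mem_Collect_eq
    by (rule exI[of _ 1], rule exI[of _ "\<alpha> / 2"]) (use assms in \<open>auto simp: y_def\<close>)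
  then have gy: "0 < snd y" "0 < ray_gap \<alpha> y" using wedge_eq[OF assms(2,3)] by auto
  obtain s t where st: "y = s *\<^sub>R u + t *\<^sub>R v" using span_independent_pair[OF uv] by blast
  let ?e = "\<lambda>n::nat. of_int \<lfloor>real n * s\<rfloor> *\<^sub>R u + of_int \<lfloor>real n * t\<rfloor> *\<^sub>R v"
  have e: "?e n = real n *\<^sub>R y - (frac (real n * s) *\<^sub>R u + frac (real n * t) *\<^sub>R v)" for n
    by (simp add: st frac_def algebra_simps)
  have fr: "frac a * b \<le> \<bar>b\<bar>" for a b :: real
  proof -
    have "frac a * b \<le> frac a * \<bar>b\<bar>" by (intro mult_left_mono) auto
    also have "\<dots> \<le> 1 * \<bar>b\<bar>" by (intro mult_right_mono) (auto simp: less_imp_le frac_lt_1)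
    finally show ?thesis by simp
  qed
  obtain N where N: "\<forall>n\<ge>N. 0 < - (\<bar>snd u\<bar> + \<bar>snd v\<bar>) + real n * snd y"
    using eventually_affine_pos[OF gy(1)] by blast
  obtain N' where N': "\<forall>n\<ge>N'. 0 < - (\<bar>ray_gap \<alpha> u\<bar> + \<bar>ray_gap \<alpha> v\<bar>) + real n * ray_gap \<alpha> y"
    using eventually_affine_pos[OF gy(2)] by blast
  define n where "n = max N N'"
  have "snd (?e n) = real n * snd y - (frac (real n * s) * snd u + frac (real n * t) * snd v)"
    unfolding e by simp
  moreover have "ray_gap \<alpha> (?e n) =
      real n * ray_gap \<alpha> y - (frac (real n * s) * ray_gap \<alpha> u + frac (real n * t) * ray_gap \<alpha> v)"
    unfolding e ray_gap_def by (simp add: algebra_simps)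
  moreover have "0 < - (\<bar>snd u\<bar> + \<bar>snd v\<bar>) + real n * snd y"
    "0 < - (\<bar>ray_gap \<alpha> u\<bar> + \<bar>ray_gap \<alpha> v\<bar>) + real n * ray_gap \<alpha> y"
    using N N' by (auto simp: n_def)
  ultimately have "0 < snd (?e n)" "0 < ray_gap \<alpha> (?e n)"
    using fr[of "real n * s" "snd u"] fr[of "real n * t" "snd v"]
      fr[of "real n * s" "ray_gap \<alpha> u"] fr[of "real n * t" "ray_gap \<alpha> v"] by linarith+
  then have "?e n \<in> R \<inter> wedge \<alpha>" unfolding wedge_eq[OF assms(2,3)] R by blast
  then show ?thesis by blast
qed

text \<open>
  Fix a lattice direction \<open>e\<close> inside the wedge. Every lattice line in direction \<open>e\<close> eventually stays in the
  wedge, so the polynomial has infinitely many zeros on it and vanishes on the whole real line. These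
  parallel lines meet any line in a second lattice direction in infinitely many points, hence the
  polynomial vanishes on the plane.
\<close>

lemma poly_fun_vanishes_if_zero_on_lattice_wedge:
  assumes R: "planar_lattice R" and \<alpha>: "0 < \<alpha>" "\<alpha> < pi / 2"
    and f: "poly_fun d f" "\<And>x. x \<in> R \<inter> wedge \<alpha> \<Longrightarrow> f x = 0"
  shows "f y = 0"
proof -
  obtain u v where uv: "u \<noteq> v" "independent {u, v}"
    and Req: "R = {of_int m *\<^sub>R u + of_int n *\<^sub>R v | m n :: int. True}"
    using R by (elim planar_latticeE)
  obtain e where e: "e \<in> R" "e \<in> wedge \<alpha>" using lattice_meets_wedge[OF R \<alpha>] by blast
  then obtain a b :: int where ab: "e = of_int a *\<^sub>R u + of_int b *\<^sub>R v" using Req by auto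
  \<comment> \<open>lines in direction \<open>e\<close> through lattice points\<close>
  have line: "f (x + t *\<^sub>R e) = 0" if "x \<in> R" for x t
  proof -
    obtain q where q: "\<And>t. f (x + t *\<^sub>R e) = poly q t" using poly_fun_line[OF f(1)] by blast
    obtain N where "\<And>n::nat. n \<ge> N \<Longrightarrow> x + real n *\<^sub>R e \<in> wedge \<alpha>"
      using wedge_absorbs_translates[OF \<alpha> e(2)] by blast
    then have "poly q (real n) = 0" if "n \<ge> N" for n
      using that f(2)[of "x + real n *\<^sub>R e"] \<open>x \<in> R\<close> e(1) R
      by (auto simp: q intro: planar_lattice_add planar_lattice_scaleR_nat)
    then have "q = 0" by (rule poly_vanishes_if_eventually_zero_nat)
    then show ?thesis by (simp add: q)
  qed
  \<comment> \<open>the points \<open>t *\<^sub>R e + n *\<^sub>R w\<close> lie on such lines, and there are infinitely many of them for fixed \<open>t\<close>\<close>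
  have plane: "f (s *\<^sub>R w + t *\<^sub>R e) = 0" if "w \<in> R" for s t w
  proof -
    obtain q where q: "\<And>s. f (t *\<^sub>R e + s *\<^sub>R w) = poly q s" using poly_fun_line[OF f(1)] by blast
    have "poly q (real n) = 0" for n
      using line[OF planar_lattice_scaleR_nat[OF R that], of n t] q[of n] by (simp add: add.commute)
    then have "q = 0" by (intro poly_vanishes_if_eventually_zero_nat[of 0]) auto
    then show ?thesis using q[of s] by (simp add: add.commute)
  qed
  have "\<exists>m n :: int. u = of_int m *\<^sub>R u + of_int n *\<^sub>R v"
    by (intro exI[of _ 1] exI[of _ 0]) simp
  then have uR: "u \<in> R" unfolding Req by blast
  have "\<exists>m n :: int. v = of_int m *\<^sub>R u + of_int n *\<^sub>R v"
    by (intro exI[of _ 0] exI[of _ 1]) simp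
  then have vR: "v \<in> R" unfolding Req by blast
  obtain s t where st: "y = s *\<^sub>R u + t *\<^sub>R v" using span_independent_pair[OF uv] by blast
  have "e \<noteq> 0" using e(2) wedge_eq[OF \<alpha>] by auto
  then consider "a \<noteq> 0" | "b \<noteq> 0" using ab by force
  then show ?thesis
  proof cases
    case 1
    have "y = (t - s * b / a) *\<^sub>R v + (s / a) *\<^sub>R e"
      using 1 by (simp add: st ab algebra_simps)
    then show ?thesis using plane[OF vR] by metis
  next
    case 2
    have "y = (s - t * a / b) *\<^sub>R u + (t / b) *\<^sub>R e"
      using 2 by (simp add: st ab algebra_simps)
    then show ?thesis using plane[OF uR] by metis
  qed
qed

section \<open>Averaging a polynomial over one step\<close>

lemma power_add_le_two_power:
  fixes a b :: real
  assumes "0 \<le> a" "0 \<le> b" shows "(a + b) ^ n \<le> 2 ^ n * (a ^ n + b ^ n)"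
proof -
  have "(a + b) ^ n \<le> (2 * max a b) ^ n" using assms by (intro power_mono) auto
  also have "\<dots> = 2 ^ n * max a b ^ n" by (simp add: power_mult_distrib)
  also have "max a b ^ n \<le> a ^ n + b ^ n" using assms by (auto simp: max_def)
  finally show ?thesis by simp
qed

locale isotropic_law = prob_space \<mu> for \<mu> :: "(real \<times> real) measure" +
  assumes sets_law [measurable_cong]: "sets \<mu> = sets borel"
    and integrable_norm_square: "integrable \<mu> (\<lambda>z. norm z ^ 2)"
    and mean_fst: "(\<integral>z. fst z \<partial>\<mu>) = 0" and mean_snd: "(\<integral>z. snd z \<partial>\<mu>) = 0"
    and var_fst: "(\<integral>z. fst z * fst z \<partial>\<mu>) = 1" and var_snd: "(\<integral>z. snd z * snd z \<partial>\<mu>) = 1"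
    and cov: "(\<integral>z. fst z * snd z \<partial>\<mu>) = 0"
begin

lemma space_law [simp]: "space \<mu> = UNIV"
  using sets_eq_imp_space_eq[OF sets_law] by simp

lemma integrable_norm_power:
  assumes "integrable \<mu> (\<lambda>z. norm z ^ d)" "e \<le> d"
  shows "integrable \<mu> (\<lambda>z. norm z ^ e)"
proof (rule Bochner_Integration.integrable_bound)
  show "integrable \<mu> (\<lambda>z. 1 + norm z ^ d)" using assms(1) by simp
  show "AE z in \<mu>. norm (norm z ^ e) \<le> norm (1 + norm z ^ d)"
  proof (rule AE_I2)
    fix z :: "real \<times> real"
    have "norm z ^ e \<le> 1 + norm z ^ d" using assms(2) by (intro power_le_one_plus_power) auto
    then show "norm (norm z ^ e) \<le> norm (1 + norm z ^ d)" by simp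
  qed
qed measurable

lemma integrable_dominated_by_power:
  assumes "integrable \<mu> (\<lambda>z. norm z ^ d)" "f \<in> borel_measurable borel"
    and "\<And>z. \<bar>f z\<bar> \<le> C * (1 + norm (y + z) ^ d)"
  shows "integrable \<mu> (f :: real \<times> real \<Rightarrow> real)"
proof (rule Bochner_Integration.integrable_bound)
  show "integrable \<mu> (\<lambda>z. \<bar>C\<bar> * (1 + 2 ^ d * (norm y ^ d + norm z ^ d)))" using assms(1) by simp
  show "AE z in \<mu>. norm (f z) \<le> norm (\<bar>C\<bar> * (1 + 2 ^ d * (norm y ^ d + norm z ^ d)))"
  proof (rule AE_I2)
    fix z :: "real \<times> real"
    have "norm (y + z) ^ d \<le> (norm y + norm z) ^ d" by (intro power_mono norm_triangle_ineq) auto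
    also have "\<dots> \<le> 2 ^ d * (norm y ^ d + norm z ^ d)" by (rule power_add_le_two_power) auto
    finally have *: "1 + norm (y + z) ^ d \<le> 1 + 2 ^ d * (norm y ^ d + norm z ^ d)" by simp
    have "\<bar>f z\<bar> \<le> C * (1 + norm (y + z) ^ d)" by (rule assms(3))
    also have "\<dots> \<le> \<bar>C\<bar> * (1 + norm (y + z) ^ d)" by (intro mult_right_mono) auto
    also have "\<dots> \<le> \<bar>C\<bar> * (1 + 2 ^ d * (norm y ^ d + norm z ^ d))" using * by (intro mult_left_mono) auto
    finally show "norm (f z) \<le> norm (\<bar>C\<bar> * (1 + 2 ^ d * (norm y ^ d + norm z ^ d)))" by simp
  qed
qed (use assms(2) sets_law in measurable)

lemma integrable_poly_fun_shift:
  assumes "integrable \<mu> (\<lambda>z. norm z ^ d)" "poly_fun d f"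
  shows "integrable \<mu> (\<lambda>z. f (y + z))"
proof -
  obtain C where C: "\<And>y. \<bar>f y\<bar> \<le> C * (1 + norm y ^ d)" using poly_fun_growth[OF assms(2)] by blast
  have [measurable]: "f \<in> borel_measurable borel" by (rule borel_measurable_poly_fun[OF assms(2)])
  show ?thesis by (rule integrable_dominated_by_power[OF assms(1) _ C]) measurable
qed

lemma integrable_poly_fun:
  assumes "integrable \<mu> (\<lambda>z. norm z ^ d)" "poly_fun d f"
  shows "integrable \<mu> f"
  using integrable_poly_fun_shift[OF assms, of 0] by simp

text \<open>
  Expanding a monomial at \<open>y + z\<close> binomially, the term without \<open>z\<close> is the monomial itself and the two terms
  linear in \<open>z\<close> have mean zero. All other terms have lost at least two powers of \<open>y\<close>.
\<close>

lemma poly_fun_increment: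
  assumes int: "integrable \<mu> (\<lambda>z. norm z ^ d)" and "poly_fun d f"
  shows "poly_fun (d - 2) (\<lambda>y. (\<integral>z. f (y + z) \<partial>\<mu>) - f y)"
  using assms(2) int
proof (induction rule: poly_fun.induct)
  case (monomial i j d c)
  define m where "m a b = (\<integral>z. fst z ^ a * snd z ^ b \<partial>\<mu>)" for a b :: nat
  have int': "integrable \<mu> (\<lambda>z. fst z ^ a * snd z ^ b)" if "a + b \<le> d" for a b
    using integrable_poly_fun[OF monomial(2) poly_fun.monomial[of a b d 1]] that by simp
  let ?t = "\<lambda>w a b y. c * real (i choose a) * real (j choose b) * w * fst y ^ (i - a) * snd y ^ (j - b)"
  have m0: "m 0 0 = 1" "m (Suc 0) 0 = 0" "m 0 (Suc 0) = 0"
    using prob_space mean_fst mean_snd by (simp_all add: m_def)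
  have "(\<integral>z. c * fst (y + z) ^ i * snd (y + z) ^ j \<partial>\<mu>) = (\<Sum>a\<le>i. \<Sum>b\<le>j. ?t (m a b) a b y)" for y
  proof -
    have "c * fst (y + z) ^ i * snd (y + z) ^ j =
        (\<Sum>a\<le>i. \<Sum>b\<le>j. ?t (fst z ^ a * snd z ^ b) a b y)" for z
    proof -
      have "fst (y + z) ^ i = (\<Sum>a\<le>i. real (i choose a) * fst z ^ a * fst y ^ (i - a))"
        "snd (y + z) ^ j = (\<Sum>b\<le>j. real (j choose b) * snd z ^ b * snd y ^ (j - b))"
        using binomial_ring[of "fst z" "fst y" i] binomial_ring[of "snd z" "snd y" j]
        by (simp_all add: add.commute)
      then show ?thesis
        by (simp add: sum_distrib_left sum_distrib_right sum_product mult_ac)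
    qed
    moreover have "(\<integral>z. (\<Sum>a\<le>i. \<Sum>b\<le>j. ?t (fst z ^ a * snd z ^ b) a b y) \<partial>\<mu>)
        = (\<Sum>a\<le>i. \<Sum>b\<le>j. (\<integral>z. ?t (fst z ^ a * snd z ^ b) a b y \<partial>\<mu>))"
      using monomial(1) int'
      by (subst Bochner_Integration.integral_sum; (intro Bochner_Integration.integrable_sum)?;
          (intro sum.cong refl Bochner_Integration.integral_sum)?) auto
    ultimately show ?thesis by (simp add: m_def)
  qed
  moreover have "c * fst y ^ i * snd y ^ j =
      (\<Sum>a\<le>i. \<Sum>b\<le>j. ?t (if a = 0 \<and> b = 0 then 1 else 0) a b y)" for y :: "real \<times> real"
  proof -
    have "(\<Sum>b\<le>j. ?t (if a = 0 \<and> b = 0 then 1 else 0) a b y) =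
        (if a = 0 then c * fst y ^ i * snd y ^ j else 0)" for a
    proof -
      have "(\<Sum>b\<le>j. ?t (if a = 0 \<and> b = 0 then 1 else 0) a b y) =
          (\<Sum>b\<le>j. if b = 0 then (if a = 0 then c * fst y ^ i * snd y ^ j else 0) else 0)"
        by (rule sum.cong) auto
      then show ?thesis by simp
    qed
    then show ?thesis by simp
  qed
  ultimately have "(\<lambda>y. (\<integral>z. c * fst (y + z) ^ i * snd (y + z) ^ j \<partial>\<mu>) - c * fst y ^ i * snd y ^ j) =
      (\<lambda>y. \<Sum>a\<le>i. \<Sum>b\<le>j. ?t (m a b - (if a = 0 \<and> b = 0 then 1 else 0)) a b y)"
    by (simp add: sum_subtractf[symmetric] algebra_simps)
  moreover have "poly_fun (d - 2) (\<lambda>y. ?t (m a b - (if a = 0 \<and> b = 0 then 1 else 0)) a b y)"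
    if ab: "a \<le> i" "b \<le> j" for a b
  proof (cases "a + b \<le> 1")
    case True
    then have "a = 0 \<and> b = 0 \<or> a = Suc 0 \<and> b = 0 \<or> a = 0 \<and> b = Suc 0" by auto
    then have "m a b - (if a = 0 \<and> b = 0 then 1 else 0) = 0" using m0 by auto
    then show ?thesis using poly_fun_const[of "d - 2" 0] by simp
  next
    case False
    then have "i - a + (j - b) \<le> d - 2" using ab monomial(1) by linarith
    then show ?thesis by (rule poly_fun.monomial)
  qed
  ultimately show ?case by (auto intro!: poly_fun_sum)
next
  case (add d f g)
  have "poly_fun (d - 2) (\<lambda>y. ((\<integral>z. f (y + z) \<partial>\<mu>) - f y) + ((\<integral>z. g (y + z) \<partial>\<mu>) - g y))"
    using add by (intro poly_fun.add) auto
  moreover have "(\<integral>z. f (y + z) + g (y + z) \<partial>\<mu>) = (\<integral>z. f (y + z) \<partial>\<mu>) + (\<integral>z. g (y + z) \<partial>\<mu>)" for y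
    using add by (intro Bochner_Integration.integral_add integrable_poly_fun_shift) auto
  ultimately show ?case by (simp add: algebra_simps)
qed

lemma poly_fun_expectation:
  assumes "integrable \<mu> (\<lambda>z. norm z ^ d)" and "poly_fun d f"
  shows "poly_fun d (\<lambda>y. \<integral>z. f (y + z) \<partial>\<mu>)"
  using poly_fun.add[OF poly_fun_mono[OF poly_fun_increment[OF assms], of d] assms(2)] by simp

end

section \<open>A superharmonic polynomial comparable to a power of the norm\<close>

text \<open>
  The tangent of the convex function \<open>x ^ k\<close> at \<open>a\<close>. It replaces Jensen's inequality below, because the
  linear term can be averaged exactly.
\<close>

lemma power_ge_tangent:
  fixes a x :: real
  assumes "0 \<le> a" "0 \<le> x"
  shows "a ^ k + real k * a ^ (k - 1) * (x - a) \<le> x ^ k"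
proof (induction k)
  case (Suc k)
  show ?case
  proof (cases k)
    case (Suc m)
    have "x ^ Suc k - (a ^ Suc k + real (Suc k) * a ^ k * (x - a))
        = x * (x ^ k - (a ^ k + real k * a ^ (k - 1) * (x - a))) + real k * a ^ (k - 1) * (x - a)\<^sup>2"
      by (simp add: Suc algebra_simps power2_eq_square)
    also have "\<dots> \<ge> 0" using Suc.IH assms by (intro add_nonneg_nonneg mult_nonneg_nonneg) auto
    finally show ?thesis by simp
  qed simp
qed simp

text \<open>
  In complex notation the conditions on the first two moments of a step \<open>\<zeta>\<close> read \<open>E \<zeta> = 0\<close> and \<open>E \<zeta>\<^sup>2 = 0\<close>,
  and the harmonic polynomials are the real parts of multiples of powers.
\<close>

definition to_complex :: "real \<times> real \<Rightarrow> complex" where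
  "to_complex y = Complex (fst y) (snd y)"

lemma to_complex_add: "to_complex (y + z) = to_complex y + to_complex z"
  by (simp add: to_complex_def complex_eq_iff)

lemma norm_to_complex: "norm (to_complex y) = norm y"
  by (cases y) (simp add: to_complex_def cmod_def norm_Pair)

lemma to_complex_eq: "to_complex y = complex_of_real (fst y) + \<i> * complex_of_real (snd y)"
  by (simp add: to_complex_def complex_eq_iff)

lemma borel_measurable_to_complex [measurable]: "to_complex \<in> borel_measurable borel"
  unfolding to_complex_eq[abs_def] by (intro borel_measurable_continuous_onI continuous_intros)

lemma norm_pair_square: "norm (y :: real \<times> real) ^ 2 = fst y ^ 2 + snd y ^ 2"
  by (cases y) (simp add: norm_Pair)

lemma poly_fun_Re_power: "poly_fun n (\<lambda>y. Re (w * to_complex y ^ n))"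
proof (induction n arbitrary: w)
  case 0
  then show ?case by (simp add: poly_fun_const)
next
  case (Suc n)
  have "poly_fun (1 + n) (\<lambda>y. fst y * Re (w * to_complex y ^ n) + snd y * Re ((w * \<i>) * to_complex y ^ n))"
    by (intro poly_fun.add poly_fun_mult poly_fun_fst poly_fun_snd Suc) auto
  also have "(\<lambda>y. fst y * Re (w * to_complex y ^ n) + snd y * Re ((w * \<i>) * to_complex y ^ n)) =
      (\<lambda>y. Re (w * to_complex y ^ Suc n))"
  proof
    fix y :: "real \<times> real"
    obtain a b where "w * to_complex y ^ n = Complex a b" by (cases "w * to_complex y ^ n")
    then have *: "w * to_complex y ^ Suc n = Complex a b * to_complex y"
      "(w * \<i>) * to_complex y ^ n = Complex a b * \<i>" by (simp_all add: mult_ac)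
    show "fst y * Re (w * to_complex y ^ n) + snd y * Re ((w * \<i>) * to_complex y ^ n) =
      Re (w * to_complex y ^ Suc n)"
      unfolding * \<open>w * to_complex y ^ n = Complex a b\<close> by (simp add: to_complex_def)
  qed
  finally show ?case by simp
qed

lemma poly_fun_norm_power: "poly_fun (2 * k) (\<lambda>y. norm y ^ (2 * k))"
proof -
  have "poly_fun 2 (\<lambda>y. fst y ^ 2 + snd y ^ 2)"
    using poly_fun.add[OF poly_fun.monomial[of 2 0 2 1] poly_fun.monomial[of 0 2 2 1]] by simp
  then have "poly_fun (k * 2) (\<lambda>y. (fst y ^ 2 + snd y ^ 2) ^ k)" by (rule poly_fun_power)
  then show ?thesis unfolding power_mult norm_pair_square by (simp add: mult.commute)
qed

lemma power_absorbed_by_higher_power: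
  fixes c C :: real
  assumes "a < b" "0 < c" "0 \<le> C"
  shows "\<exists>B\<ge>0. \<forall>r\<ge>0. C * r ^ a \<le> c * r ^ b + B"
proof -
  \<comment> \<open>beyond \<open>r0\<close> one more power of \<open>r\<close> outweighs \<open>C / c\<close>\<close>
  define r0 where "r0 = max 1 (C / c)"
  have "C * r ^ a \<le> c * r ^ b + C * r0 ^ a" if "r \<ge> 0" for r
  proof (cases "r \<le> r0")
    case True
    then have "C * r ^ a \<le> C * r0 ^ a" using that assms by (intro mult_left_mono power_mono) auto
    moreover have "0 \<le> c * r ^ b" using that assms by simp
    ultimately show ?thesis by linarith
  next
    case False
    then have "1 \<le> r" "C / c \<le> r" by (auto simp: r0_def)
    then have r: "1 \<le> r" "C \<le> c * r" using assms by (auto simp: pos_divide_le_eq mult.commute)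
    have "C * r ^ a \<le> (c * r) * r ^ a" using r by (intro mult_right_mono) auto
    also have "\<dots> = c * r ^ Suc a" by simp
    also have "\<dots> \<le> c * r ^ b" using r assms by (intro mult_left_mono power_increasing) auto
    moreover have "0 \<le> C * r0 ^ a" using assms by (simp add: r0_def)
    ultimately show ?thesis by linarith
  qed
  moreover have "0 \<le> C * r0 ^ a" using assms by (simp add: r0_def)
  ultimately show ?thesis by blast
qed

text \<open>
  Used to let a drift of order \<open>r ^ (2k - 2)\<close> swallow all error terms of smaller order, up to a constant.
\<close>

lemma sum_powers_absorbed_by_higher_power:
  fixes c :: real
  assumes "finite A" "\<And>j. j \<in> A \<Longrightarrow> e j < b" "0 < c" "\<And>j. j \<in> A \<Longrightarrow> 0 \<le> C j"
  shows "\<exists>B\<ge>0. \<forall>r\<ge>0. (\<Sum>j\<in>A. C j * r ^ e j) \<le> c * r ^ b + B"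
  using assms
proof (induction A arbitrary: c rule: finite_induct)
  case empty
  then show ?case by (intro exI[of _ 0]) auto
next
  case (insert a A)
  obtain B where B: "B \<ge> 0" "\<forall>r\<ge>0. (\<Sum>j\<in>A. C j * r ^ e j) \<le> c / 2 * r ^ b + B"
    using insert.IH[of "c / 2"] insert.prems by auto
  obtain B' where B': "B' \<ge> 0" "\<forall>r\<ge>0. C a * r ^ e a \<le> c / 2 * r ^ b + B'"
    using power_absorbed_by_higher_power[of "e a" b "c / 2" "C a"] insert.prems by auto
  show ?case
  proof (intro exI[of _ "B + B'"] conjI allI impI)
    fix r :: real assume "0 \<le> r"
    then have "C a * r ^ e a + (\<Sum>j\<in>A. C j * r ^ e j) \<le> (c / 2 * r ^ b + B') + (c / 2 * r ^ b + B)"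
      using B B' by (intro add_mono) auto
    then show "(\<Sum>j\<in>insert a A. C j * r ^ e j) \<le> c * r ^ b + (B + B')"
      using insert.hyps by (simp add: field_simps)
  qed (use B B' in auto)
qed

context isotropic_law
begin

lemma prob_UNIV [simp]: "prob UNIV = 1"
  using prob_space by simp

lemma integrable_fst: "integrable \<mu> fst" and integrable_snd: "integrable \<mu> snd"
  and integrable_fst2: "integrable \<mu> (\<lambda>z. fst z * fst z)" and integrable_snd2: "integrable \<mu> (\<lambda>z. snd z * snd z)"
  and integrable_fst_snd: "integrable \<mu> (\<lambda>z. fst z * snd z)"
  using integrable_poly_fun[OF integrable_norm_square, of "\<lambda>z. fst z * fst z"]
    integrable_poly_fun[OF integrable_norm_square, of "\<lambda>z. snd z * snd z"]
    integrable_poly_fun[OF integrable_norm_square, of "\<lambda>z. fst z * snd z"]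
    integrable_poly_fun[OF integrable_norm_square, of fst]
    integrable_poly_fun[OF integrable_norm_square, of snd]
    poly_fun_mult[OF poly_fun_fst[of 1] poly_fun_fst[of 1]] poly_fun_mult[OF poly_fun_snd[of 1] poly_fun_snd[of 1]]
    poly_fun_mult[OF poly_fun_fst[of 1] poly_fun_snd[of 1]] poly_fun_fst[of 2] poly_fun_snd[of 2]
  by (simp_all add: numeral_2_eq_2)

lemma expectation_inner: "integrable \<mu> (\<lambda>z. inner y z)" "(\<integral>z. inner y z \<partial>\<mu>) = 0"
  using integrable_fst integrable_snd mean_fst mean_snd by (auto simp: inner_prod_def)

lemma expectation_norm_square: "(\<integral>z. norm z ^ 2 \<partial>\<mu>) = 2"
  using integrable_fst2 integrable_snd2 var_fst var_snd
  by (simp add: norm_pair_square) (simp add: power2_eq_square)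

text \<open>
  The tangent inequality at \<open>norm y ^ 2\<close>, averaged: the mean of \<open>norm (y + z) ^ 2 - norm y ^ 2\<close> is 2, the
  trace of the covariance matrix.
\<close>

lemma expectation_norm_even_power_ge:
  assumes "integrable \<mu> (\<lambda>z. norm z ^ (2 * k))" "1 \<le> k"
  shows "norm y ^ (2 * k) + 2 * real k * norm y ^ (2 * k - 2) \<le> (\<integral>z. norm (y + z) ^ (2 * k) \<partial>\<mu>)"
proof -
  have "(norm y)\<^sup>2 ^ k + real k * (norm y)\<^sup>2 ^ (k - 1) * (2 * inner y z + norm z ^ 2) \<le> norm (y + z) ^ (2 * k)" for z
    using power_ge_tangent[of "(norm y)\<^sup>2" "(norm (y + z))\<^sup>2" k]
    by (simp add: power_mult) (simp add: power2_norm_eq_inner algebra_simps inner_commute)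
  then have "(\<integral>z. (norm y)\<^sup>2 ^ k + real k * (norm y)\<^sup>2 ^ (k - 1) * (2 * inner y z + norm z ^ 2) \<partial>\<mu>)
      \<le> (\<integral>z. norm (y + z) ^ (2 * k) \<partial>\<mu>)"
    using expectation_inner(1)[of y] integrable_norm_square
      integrable_poly_fun_shift[OF assms(1) poly_fun_norm_power]
    by (intro integral_mono) auto
  moreover have "(\<integral>z. (norm y)\<^sup>2 ^ k + real k * (norm y)\<^sup>2 ^ (k - 1) * (2 * inner y z + norm z ^ 2) \<partial>\<mu>) =
     (norm y)\<^sup>2 ^ k + real k * (norm y)\<^sup>2 ^ (k - 1) * 2"
    using expectation_inner[of y] integrable_norm_square expectation_norm_square by (simp add: prob_space)
  moreover have "(norm y)\<^sup>2 ^ (k - 1) = norm y ^ (2 * k - 2)"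
    by (simp add: diff_mult_distrib2 flip: power_mult)
  ultimately show ?thesis by (simp add: mult_ac flip: power_mult)
qed

text \<open>
  This makes powers of the norm of the walk a submartingale. It follows from the tangent inequality and
  from \<open>norm y \<le> E (norm (y + z))\<close>, where \<open>norm (y + z)\<close> is bounded below by its component along \<open>y\<close>.
\<close>

lemma expectation_norm_power_ge:
  assumes "integrable \<mu> (\<lambda>z. norm z ^ (2 * k))"
  shows "integrable \<mu> (\<lambda>z. norm (y + z) ^ k)" "norm y ^ k \<le> (\<integral>z. norm (y + z) ^ k \<partial>\<mu>)"
proof -
  have *: "integrable \<mu> (\<lambda>z. norm (y + z) ^ k)" if "integrable \<mu> (\<lambda>z. norm z ^ k)" for k
    by (rule integrable_dominated_by_power[OF that, of _ 1 y]) auto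
  then show int: "integrable \<mu> (\<lambda>z. norm (y + z) ^ k)" using integrable_norm_power[OF assms, of k] by auto
  have int1: "integrable \<mu> (\<lambda>z. norm (y + z))"
    using *[of 1] integrable_norm_power[OF integrable_norm_square, of 1] by simp
  show "norm y ^ k \<le> (\<integral>z. norm (y + z) ^ k \<partial>\<mu>)"
  proof (cases "y = 0 \<or> k = 0")
    case True
    then consider "k = 0" | "norm y ^ k = 0" by (cases k) auto
    then show ?thesis
    proof cases
      case 2
      have "0 \<le> (\<integral>z. norm (y + z) ^ k \<partial>\<mu>)" by (rule Bochner_Integration.integral_nonneg) simp
      then show ?thesis by (simp add: 2)
    qed simp
  next
    case False
    have "norm y + inner y z / norm y \<le> norm (y + z)" for z
    proof -
      have "norm y * norm y + inner y z = inner y (y + z)"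
        by (simp add: inner_add_right power2_norm_eq_inner[symmetric] power2_eq_square)
      also have "\<dots> \<le> norm y * norm (y + z)" by (rule norm_cauchy_schwarz)
      finally show ?thesis using False by (simp add: field_simps)
    qed
    then have "(\<integral>z. norm y + inner y z / norm y \<partial>\<mu>) \<le> (\<integral>z. norm (y + z) \<partial>\<mu>)"
      using expectation_inner(1)[of y] int1 by (intro integral_mono) auto
    then have 1: "norm y \<le> (\<integral>z. norm (y + z) \<partial>\<mu>)"
      using expectation_inner[of y] by (simp add: prob_space)
    have "norm y ^ k \<le> norm y ^ k + real k * norm y ^ (k - 1) * ((\<integral>z. norm (y + z) \<partial>\<mu>) - norm y)"
      using 1 by simp
    also have "\<dots> = (\<integral>z. norm y ^ k + real k * norm y ^ (k - 1) * (norm (y + z) - norm y) \<partial>\<mu>)"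
      using int1 by (simp add: prob_space)
    also have "\<dots> \<le> (\<integral>z. norm (y + z) ^ k \<partial>\<mu>)"
      using int int1 by (intro integral_mono power_ge_tangent) auto
    finally show ?thesis .
  qed
qed

text \<open>
  In the binomial expansion of \<open>(y + z) ^ n\<close> as complex numbers the terms of first and second order in
  \<open>z\<close> have mean zero, so the error is of order \<open>norm y ^ (n - 3)\<close>.
\<close>

lemma harmonic_increment_bound:
  assumes int: "integrable \<mu> (\<lambda>z. norm z ^ n)" and n: "2 \<le> n"
  shows "\<exists>C. (\<forall>j. 0 \<le> C j) \<and> (\<forall>y. (\<integral>z. Re (w * to_complex (y + z) ^ n) \<partial>\<mu>) \<le>
      Re (w * to_complex y ^ n) + (\<Sum>j=3..n. C j * norm y ^ (n - j)))"
proof -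
  define m where "m j = (\<integral>z. to_complex z ^ j \<partial>\<mu>)" for j
  define C where "C j = norm w * real (n choose j) * norm (m j)" for j
  have int': "integrable \<mu> (\<lambda>z. to_complex z ^ j)" if "j \<le> n" for j
    using integrable_norm_power[OF int that]
    by (rule Bochner_Integration.integrable_bound) (auto simp: norm_power norm_to_complex)
  have m0: "m 0 = 1" using prob_space by (simp add: m_def)
  have m1: "m 1 = 0"
    using integrable_fst integrable_snd mean_fst mean_snd
    by (simp add: m_def to_complex_eq)
  \<comment> \<open>the variances cancel in the real part, and the imaginary part is twice the covariance\<close>
  have "to_complex z ^ 2 = complex_of_real (fst z * fst z - snd z * snd z) + \<i> * complex_of_real (2 * (fst z * snd z))" for z
    by (simp add: to_complex_def complex_eq_iff power2_eq_square)
  then have m2: "m 2 = 0"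
    using integrable_fst2 integrable_snd2 integrable_fst_snd var_fst var_snd cov
    unfolding m_def
    by (simp del: of_real_diff of_real_mult)
  have "(\<integral>z. Re (w * to_complex (y + z) ^ n) \<partial>\<mu>) \<le>
      Re (w * to_complex y ^ n) + (\<Sum>j=3..n. C j * norm y ^ (n - j))" for y
  proof -
    let ?t = "\<lambda>j. w * (of_nat (n choose j) * m j * to_complex y ^ (n - j))"
    have exp: "w * to_complex (y + z) ^ n =
        (\<Sum>j\<le>n. w * (of_nat (n choose j) * to_complex z ^ j * to_complex y ^ (n - j)))" for z
      using binomial_ring[of "to_complex z" "to_complex y" n]
      by (simp add: to_complex_add add.commute sum_distrib_left)
    have int2: "integrable \<mu> (\<lambda>z. w * to_complex (y + z) ^ n)"
      unfolding exp using int' by (intro Bochner_Integration.integrable_sum) auto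
    have "(\<integral>z. Re (w * to_complex (y + z) ^ n) \<partial>\<mu>) = Re (\<integral>z. w * to_complex (y + z) ^ n \<partial>\<mu>)"
      using int2 by (rule integral_Re)
    also have "(\<integral>z. w * to_complex (y + z) ^ n \<partial>\<mu>) = (\<Sum>j\<le>n. ?t j)"
      unfolding exp using int' by (subst Bochner_Integration.integral_sum) (auto simp: m_def)
    also have "{..n} = {0, 1, 2} \<union> {3..n}" using n by auto
    also have "(\<Sum>j\<in>{0, 1, 2} \<union> {3..n}. ?t j) = w * to_complex y ^ n + (\<Sum>j=3..n. ?t j)"
      using m0 m1 m2 by (subst sum.union_disjoint) auto
    also have "Re \<dots> \<le> Re (w * to_complex y ^ n) + norm (\<Sum>j=3..n. ?t j)"
      unfolding plus_complex.sel by (intro add_left_mono complex_Re_le_cmod)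
    also have "norm (\<Sum>j=3..n. ?t j) \<le> (\<Sum>j=3..n. norm (?t j))" by (rule norm_sum)
    also have "\<dots> = (\<Sum>j=3..n. C j * norm y ^ (n - j))"
      by (simp add: C_def norm_mult norm_power norm_to_complex mult_ac)
    finally show ?thesis by simp
  qed
  then show ?thesis by (intro exI[of _ C]) (auto simp: C_def)
qed

end

text \<open>
  In polar coordinates, \<open>r ^ (2k) * cos (2k\<phi> - k\<alpha>) - cos (k\<alpha>) / 2 * r ^ (2k)\<close>. The first term is the
  harmonic polynomial that is symmetric about the axis of the wedge. On the closed wedge its cosine is at
  least \<open>cos (k\<alpha>)\<close>, so half of this can be given away to obtain a negative drift.
\<close>

definition cone_fun :: "real \<Rightarrow> nat \<Rightarrow> real \<times> real \<Rightarrow> real" where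
  "cone_fun \<alpha> k y = Re (cis (- (real k * \<alpha>)) * to_complex y ^ (2 * k))
     - cos (real k * \<alpha>) / 2 * norm y ^ (2 * k)"

lemma poly_fun_cone_fun: "poly_fun (2 * k) (cone_fun \<alpha> k)"
  unfolding cone_fun_def[abs_def]
  by (intro poly_fun_diff poly_fun_Re_power poly_fun_cmult poly_fun_norm_power)

lemma cone_fun_ge:
  assumes "real k * \<alpha> < pi / 2" "y \<in> closure (wedge \<alpha>)"
  shows "cos (real k * \<alpha>) / 2 * norm y ^ (2 * k) \<le> cone_fun \<alpha> k y"
proof -
  let ?S = "{y. cos (real k * \<alpha>) / 2 * norm y ^ (2 * k) \<le> cone_fun \<alpha> k y}"
  have "closed ?S"
    using continuous_on_poly_fun[OF poly_fun_cone_fun]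
    by (intro closed_Collect_le continuous_intros) auto
  moreover have "wedge \<alpha> \<subseteq> ?S"
  proof
    fix y assume "y \<in> wedge \<alpha>"
    then obtain r \<phi> where y: "y = (r * cos \<phi>, r * sin \<phi>)" "r > 0" "0 < \<phi>" "\<phi> < \<alpha>"
      unfolding wedge_def by auto
    have c: "to_complex y = complex_of_real r * cis \<phi>" by (simp add: y to_complex_def complex_eq_iff)
    have n: "norm y = r" using norm_to_complex[of y] y(2) by (simp add: c norm_mult)
    have "cis (- (real k * \<alpha>)) * to_complex y ^ (2 * k) =
        complex_of_real (r ^ (2 * k)) * cis (real k * (2 * \<phi> - \<alpha>))"
    proof -
      have "cis (- (real k * \<alpha>)) * cis \<phi> ^ (2 * k) = cis (real k * (2 * \<phi> - \<alpha>))"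
        unfolding Complex.DeMoivre cis_mult by (simp add: algebra_simps)
      then show ?thesis unfolding c power_mult_distrib of_real_power by (metis mult.left_commute)
    qed
    then have "Re (cis (- (real k * \<alpha>)) * to_complex y ^ (2 * k)) = r ^ (2 * k) * cos (real k * (2 * \<phi> - \<alpha>))"
      by (simp del: of_real_power)
    moreover have "cos (real k * \<alpha>) \<le> cos \<bar>real k * (2 * \<phi> - \<alpha>)\<bar>"
    proof (rule cos_monotone_0_pi_le)
      have "\<bar>2 * \<phi> - \<alpha>\<bar> \<le> \<alpha>" using y by auto
      then show "\<bar>real k * (2 * \<phi> - \<alpha>)\<bar> \<le> real k * \<alpha>" by (simp add: abs_mult mult_left_mono)
      show "real k * \<alpha> \<le> pi" using assms(1) pi_gt_zero by linarith
    qed simp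
    then have "r ^ (2 * k) * cos (real k * \<alpha>) \<le> r ^ (2 * k) * cos (real k * (2 * \<phi> - \<alpha>))"
      using y(2) by (intro mult_left_mono) auto
    ultimately show "y \<in> ?S" by (simp add: cone_fun_def n field_simps)
  qed
  ultimately have "closure (wedge \<alpha>) \<subseteq> ?S" by (intro closure_minimal)
  then show ?thesis using assms(2) by auto
qed

context isotropic_law
begin

text \<open>
  The drift contributed by the radial part, \<open>- k * cos (k\<alpha>) * r ^ (2k - 2)\<close>, dominates the error terms of
  the harmonic part for large \<open>r\<close>. For \<open>k = 1\<close> there are no error terms.
\<close>

lemma cone_fun_increment:
  assumes int: "integrable \<mu> (\<lambda>z. norm z ^ (2 * k))" and k: "1 \<le> k" and c: "0 < cos (real k * \<alpha>)"
  shows "\<exists>B\<ge>0. \<forall>y. (\<integral>z. cone_fun \<alpha> k (y + z) \<partial>\<mu>) \<le> cone_fun \<alpha> k y + B"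
    and "k = 1 \<Longrightarrow> (\<integral>z. cone_fun \<alpha> k (y + z) \<partial>\<mu>) \<le> cone_fun \<alpha> k y - cos \<alpha>"
proof -
  let ?w = "cis (- (real k * \<alpha>))"
  obtain C where C: "\<And>j. 0 \<le> C j" "\<And>y. (\<integral>z. Re (?w * to_complex (y + z) ^ (2 * k)) \<partial>\<mu>) \<le>
      Re (?w * to_complex y ^ (2 * k)) + (\<Sum>j=3..2*k. C j * norm y ^ (2 * k - j))"
    using harmonic_increment_bound[OF int, of ?w] k by auto
  have eq: "(\<integral>z. cone_fun \<alpha> k (y + z) \<partial>\<mu>) = (\<integral>z. Re (?w * to_complex (y + z) ^ (2 * k)) \<partial>\<mu>)
      - cos (real k * \<alpha>) / 2 * (\<integral>z. norm (y + z) ^ (2 * k) \<partial>\<mu>)" for y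
    unfolding cone_fun_def
    by (subst Bochner_Integration.integral_diff)
       (simp_all only: integrable_poly_fun_shift[OF int poly_fun_Re_power] integral_mult_right_zero
          integrable_mult_right integrable_poly_fun_shift[OF int poly_fun_norm_power])
  have ge: "cos (real k * \<alpha>) / 2 * (norm y ^ (2 * k) + 2 * real k * norm y ^ (2 * k - 2))
     \<le> cos (real k * \<alpha>) / 2 * (\<integral>z. norm (y + z) ^ (2 * k) \<partial>\<mu>)" for y
    using expectation_norm_even_power_ge[OF int k, of y] c by (intro mult_left_mono) auto
  have *: "(\<integral>z. cone_fun \<alpha> k (y + z) \<partial>\<mu>) \<le> cone_fun \<alpha> k y
      - cos (real k * \<alpha>) * real k * norm y ^ (2 * k - 2) + (\<Sum>j=3..2*k. C j * norm y ^ (2 * k - j))" for y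
  proof -
    have "cos (real k * \<alpha>) / 2 * (norm y ^ (2 * k) + 2 * real k * norm y ^ (2 * k - 2)) =
        cos (real k * \<alpha>) / 2 * norm y ^ (2 * k) + cos (real k * \<alpha>) * real k * norm y ^ (2 * k - 2)"
      by (simp add: field_simps)
    then show ?thesis
      using C(2)[of y] eq[of y] ge[of y] unfolding cone_fun_def[of _ _ y] by linarith
  qed
  show "(\<integral>z. cone_fun \<alpha> k (y + z) \<partial>\<mu>) \<le> cone_fun \<alpha> k y - cos \<alpha>" if "k = 1"
    using *[of y] that by simp
  have lt: "2 * k - j < 2 * k - 2" if "j \<in> {3..2*k}" for j using that unfolding atLeastAtMost_iff by linarith
  have pos: "0 < cos (real k * \<alpha>) * real k" using c k by simp
  have "\<exists>B\<ge>0. \<forall>r\<ge>0. (\<Sum>j=3..2*k. C j * r ^ (2 * k - j)) \<le> cos (real k * \<alpha>) * real k * r ^ (2 * k - 2) + B"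
    by (rule sum_powers_absorbed_by_higher_power[OF finite_atLeastAtMost]) (erule lt | rule pos C(1))+
  then obtain B where B: "B \<ge> 0"
    "\<And>r. r \<ge> 0 \<Longrightarrow> (\<Sum>j=3..2*k. C j * r ^ (2 * k - j)) \<le> cos (real k * \<alpha>) * real k * r ^ (2 * k - 2) + B"
    by blast
  show "\<exists>B\<ge>0. \<forall>y. (\<integral>z. cone_fun \<alpha> k (y + z) \<partial>\<mu>) \<le> cone_fun \<alpha> k y + B"
  proof (intro exI[of _ B] conjI allI B(1))
    show "(\<integral>z. cone_fun \<alpha> k (y + z) \<partial>\<mu>) \<le> cone_fun \<alpha> k y + B" for y
      using *[of y] B(2)[of "norm y"] by simp
  qed
qed

text \<open>
  The constant \<open>B\<close> left over in the drift of \<open>cone_fun \<alpha> k\<close> is compensated by a multiple of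
  \<open>cone_fun \<alpha> 1\<close>, whose drift is at most the negative constant \<open>- cos \<alpha>\<close>.
\<close>

lemma lyapunov_function:
  assumes int: "integrable \<mu> (\<lambda>z. norm z ^ (2 * k))" and k: "1 \<le> k" and \<alpha>: "0 < \<alpha>" "real k * \<alpha> < pi / 2"
  shows "\<exists>W c. 0 < c \<and> poly_fun (2 * k) W \<and> (\<forall>y\<in>closure (wedge \<alpha>). c * norm y ^ (2 * k) \<le> W y) \<and>
    (\<forall>y. (\<integral>z. W (y + z) \<partial>\<mu>) \<le> W y)"
proof -
  have "1 * \<alpha> \<le> real k * \<alpha>" using k \<alpha> by (intro mult_right_mono) auto
  then have \<alpha>2: "\<alpha> < pi / 2" using \<alpha>(2) by simp
  have c: "0 < cos (real k * \<alpha>)" "0 < cos \<alpha>" using \<alpha> \<alpha>2 k by (auto intro!: cos_gt_zero)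
  obtain B where B: "B \<ge> 0" "\<And>y. (\<integral>z. cone_fun \<alpha> k (y + z) \<partial>\<mu>) \<le> cone_fun \<alpha> k y + B"
    using cone_fun_increment(1)[OF int k c(1)] by blast
  \<comment> \<open>both summands are nonnegative on the closed wedge\<close>
  define W where "W y = cone_fun \<alpha> k y + B / cos \<alpha> * cone_fun \<alpha> 1 y" for y
  have p1: "poly_fun 2 (cone_fun \<alpha> 1)" using poly_fun_cone_fun[of 1 \<alpha>] by simp
  have pW: "poly_fun (2 * k) W" unfolding W_def
    using k poly_fun_mono[OF p1, of "2 * k"] by (intro poly_fun.add poly_fun_cmult poly_fun_cone_fun) auto
  have "cos (real k * \<alpha>) / 2 * norm y ^ (2 * k) \<le> W y" if "y \<in> closure (wedge \<alpha>)" for y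
  proof -
    have "0 \<le> cos \<alpha> / 2 * norm y ^ 2" using c(2) by simp
    also have "\<dots> \<le> cone_fun \<alpha> 1 y" using cone_fun_ge[of 1 \<alpha> y] \<alpha>2 that by simp
    finally have "0 \<le> B / cos \<alpha> * cone_fun \<alpha> 1 y" using B(1) c by simp
    then show ?thesis using cone_fun_ge[OF \<alpha>(2) that] unfolding W_def by linarith
  qed
  moreover have "(\<integral>z. W (y + z) \<partial>\<mu>) \<le> W y" for y
  proof -
    have "(\<integral>z. W (y + z) \<partial>\<mu>) = (\<integral>z. cone_fun \<alpha> k (y + z) \<partial>\<mu>) + B / cos \<alpha> * (\<integral>z. cone_fun \<alpha> 1 (y + z) \<partial>\<mu>)"
      unfolding W_def
      using integrable_poly_fun_shift[OF int poly_fun_cone_fun] integrable_poly_fun_shift[OF integrable_norm_square p1]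
      by (subst Bochner_Integration.integral_add) auto
    also have "\<dots> \<le> (cone_fun \<alpha> k y + B) + B / cos \<alpha> * (cone_fun \<alpha> 1 y - cos \<alpha>)"
      using B cone_fun_increment(2)[of 1 \<alpha> y] integrable_norm_square c
      by (intro add_mono mult_left_mono) auto
    also have "\<dots> = W y" using c by (simp add: W_def field_simps)
    finally show ?thesis .
  qed
  ultimately show ?thesis using pW c(1) by (intro exI[of _ W] exI[of _ "cos (real k * \<alpha>) / 2"]) auto
qed

end

section \<open>The stopped walk\<close>

lemma exit_time_enatD:
  assumes "exit_time K Y x \<omega> = enat t"
  shows "1 \<le> t" "x + walk Y t \<omega> \<notin> K" "\<And>m. 1 \<le> m \<Longrightarrow> m < t \<Longrightarrow> x + walk Y m \<omega> \<in> K"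
proof -
  let ?A = "{enat n | n. n \<ge> 1 \<and> x + walk Y n \<omega> \<notin> K}"
  have ne: "?A \<noteq> {}" using assms unfolding exit_time_def by (metis Inf_enat_def enat.distinct(2))
  then have "Inf ?A \<in> ?A" unfolding Inf_enat_def using LeastI[of "\<lambda>n. n \<in> ?A"] by auto
  then have "enat t \<in> ?A" using assms unfolding exit_time_def by simp
  then show "1 \<le> t" "x + walk Y t \<omega> \<notin> K" by auto
  show "x + walk Y m \<omega> \<in> K" if "1 \<le> m" "m < t" for m
  proof (rule ccontr)
    assume "x + walk Y m \<omega> \<notin> K"
    then have "enat m \<in> ?A" using that by auto
    then have "Inf ?A \<le> enat m" by (rule Inf_lower)
    then show False using assms that unfolding exit_time_def by simp
  qed
qed

text \<open>
  The walk frozen at its first position outside \<open>K\<close>. It is a Markov chain, and it lies in \<open>K\<close> exactly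
  as long as the exit time has not been reached.
\<close>

primrec stopped_path :: "'v :: plus set \<Rightarrow> 'v \<Rightarrow> (nat \<Rightarrow> 'v) \<Rightarrow> nat \<Rightarrow> 'v" where
  "stopped_path K x y 0 = x"
| "stopped_path K x y (Suc n) =
    (if stopped_path K x y n \<in> K then stopped_path K x y n + y (Suc n) else stopped_path K x y n)"

primrec peak_power :: "nat \<Rightarrow> (nat \<Rightarrow> 'v :: real_normed_vector) \<Rightarrow> nat \<Rightarrow> real" where
  "peak_power k y 0 = norm (y 0) ^ k"
| "peak_power k y (Suc n) = max (peak_power k y n) (norm (y (Suc n)) ^ k)"

lemma stopped_path_cong:
  assumes "\<And>i. i \<in> {1..n} \<Longrightarrow> y i = y' i"
  shows "stopped_path K x y n = stopped_path K x y' n"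
  using assms by (induction n) auto

lemma peak_power_cong:
  assumes "\<And>i. i \<le> n \<Longrightarrow> y i = y' i"
  shows "peak_power k y n = peak_power k y' n"
  using assms by (induction n) auto

lemma stopped_path_walk:
  assumes "x \<in> K" "exit_time K Y x \<omega> = enat t"
  shows "n < t \<Longrightarrow> stopped_path K x (\<lambda>i. Y i \<omega>) n = x + walk Y n \<omega> \<and> x + walk Y n \<omega> \<in> K"
    and "t \<le> n \<Longrightarrow> stopped_path K x (\<lambda>i. Y i \<omega>) n = x + walk Y t \<omega>"
proof -
  note D = exit_time_enatD[OF assms(2)]
  show *: "stopped_path K x (\<lambda>i. Y i \<omega>) n = x + walk Y n \<omega> \<and> x + walk Y n \<omega> \<in> K" if "n < t" for n
    using that
  proof (induction n)
    case 0
    then show ?case using assms(1) by (simp add: walk_def)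
  next
    case (Suc n)
    then have "stopped_path K x (\<lambda>i. Y i \<omega>) (Suc n) = x + walk Y (Suc n) \<omega>"
      by (simp add: walk_def add.assoc)
    then show ?case using D(3)[of "Suc n"] Suc.prems by simp
  qed
  show "stopped_path K x (\<lambda>i. Y i \<omega>) n = x + walk Y t \<omega>" if "t \<le> n"
    using that
  proof (induction n rule: dec_induct)
    case base
    obtain s where s: "t = Suc s" using D(1) by (cases t) auto
    then show ?case using *[of s] by (simp add: walk_def add.assoc)
  next
    case (step n)
    then show ?case using D(2) by simp
  qed
qed

text \<open>
  A deterministic form of Doob's maximal inequality. Let \<open>m\<close> be the running maximum of \<open>s\<close>. It increases only
  at times when it equals \<open>s\<close>, so summation by parts gives
  \<open>(\<Sum>i<n. m i * (s (i + 1) - s i)) \<le> m n * s n - (m n)\<^sup>2 / 2\<close>, and the right-hand side is at most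
  \<open>(s n)\<^sup>2 - (m n)\<^sup>2 / 4\<close>. For a submartingale \<open>s\<close> the sum has nonnegative mean.
\<close>

lemma doob_pathwise:
  fixes y :: "nat \<Rightarrow> 'v :: real_normed_vector" and k :: nat
  defines "s \<equiv> \<lambda>n. norm (y n) ^ k"
  shows "(peak_power k y n)\<^sup>2 + 4 * (\<Sum>i<n. peak_power k y i * s (Suc i)) \<le> 4 * (s n)\<^sup>2 + 4 * (\<Sum>i<n. peak_power k y i * s i)"
proof -
  let ?m = "peak_power k y"
  have "(\<Sum>i<n. ?m i * s (Suc i)) \<le> (\<Sum>i<n. ?m i * s i) + ?m n * s n - (?m n)\<^sup>2 / 2"
  proof (induction n)
    case 0
    then show ?case by (simp add: s_def power2_eq_square)
  next
    case (Suc n)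
    have "?m n * s (Suc n) - (?m n)\<^sup>2 / 2 \<le> ?m (Suc n) * s (Suc n) - (?m (Suc n))\<^sup>2 / 2"
    proof (cases "s (Suc n) \<le> ?m n")
      case True
      then show ?thesis by (simp add: s_def max_def)
    next
      case False
      then have "?m (Suc n) = s (Suc n)" by (simp add: s_def max_def)
      moreover have "0 \<le> (s (Suc n) - ?m n)\<^sup>2" by simp
      ultimately show ?thesis by (simp add: power2_eq_square algebra_simps)
    qed
    then show ?case using Suc.IH by simp
  qed
  moreover have "0 \<le> (?m n - 2 * s n)\<^sup>2" by simp
  ultimately show ?thesis by (simp add: power2_eq_square algebra_simps)
qed

lemma peak_power_ge: "norm (y n) ^ k \<le> peak_power k y n"
  by (cases n) auto

lemma peak_power_nonneg: "0 \<le> peak_power k y n"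
  using peak_power_ge[of y n k] by (meson norm_ge_zero order_trans zero_le_power)

lemma peak_power_mono: "m \<le> n \<Longrightarrow> peak_power k y m \<le> peak_power k y n"
  by (induction n rule: dec_induct) auto

lemma peak_power_square_le_sum: "(peak_power k y n)\<^sup>2 \<le> (\<Sum>i\<le>n. norm (y i) ^ (2 * k))"
proof (induction n)
  case 0
  then show ?case by (simp add: power_mult mult.commute flip: power_mult)
next
  case (Suc n)
  have "(peak_power k y (Suc n))\<^sup>2 \<le> (peak_power k y n)\<^sup>2 + (norm (y (Suc n)) ^ k)\<^sup>2"
    by (auto simp: max_def)
  also have "(norm (y (Suc n)) ^ k)\<^sup>2 = norm (y (Suc n)) ^ (2 * k)" by (simp add: mult.commute flip: power_mult)
  finally show ?case using Suc.IH by simp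
qed

text \<open>
  Restricted to acute wedges, as \<open>1 \<le> k < \<pi> / (2 * \<alpha>)\<close> forces \<open>\<alpha> < \<pi> / 2\<close>.
\<close>

locale wedge_walk = law: isotropic_law \<mu> + prob_space M
  for \<mu> :: "(real \<times> real) measure" and M :: "'w measure" +
  fixes Y :: "nat \<Rightarrow> 'w \<Rightarrow> real \<times> real" and R :: "(real \<times> real) set" and \<alpha> :: real
  assumes indep_steps: "indep_vars (\<lambda>_. borel) Y {1..}"
    and distr_step: "\<And>i. 1 \<le> i \<Longrightarrow> distr M borel (Y i) = \<mu>"
    and lattice: "planar_lattice R"
    and walk_in_lattice: "AE \<omega> in M. \<forall>n. walk Y n \<omega> \<in> R"
    and \<alpha>_pos: "0 < \<alpha>" and \<alpha>_less: "\<alpha> < pi / 2"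
    and exit_at_frontier: "\<And>x. x \<in> R \<inter> wedge \<alpha> \<Longrightarrow>
           AE \<omega> in M. exit_time (wedge \<alpha>) Y x \<omega> \<noteq> \<infinity> \<and>
             x + walk Y (the_enat (exit_time (wedge \<alpha>) Y x \<omega>)) \<omega> \<in> frontier (wedge \<alpha>)"
begin

abbreviation "K \<equiv> wedge \<alpha>"

definition pos :: "real \<times> real \<Rightarrow> nat \<Rightarrow> 'w \<Rightarrow> real \<times> real" where
  "pos x n \<omega> = stopped_path K x (\<lambda>i. Y i \<omega>) n"

definition peak :: "nat \<Rightarrow> real \<times> real \<Rightarrow> nat \<Rightarrow> 'w \<Rightarrow> real" where
  "peak k x n \<omega> = peak_power k (\<lambda>i. pos x i \<omega>) n"

lemma measurable_wedge [measurable]: "K \<in> sets borel"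
  using open_wedge[OF \<alpha>_pos \<alpha>_less] by (rule borel_open)

lemma measurable_step [measurable]: "1 \<le> i \<Longrightarrow> Y i \<in> borel_measurable M"
  using indep_steps unfolding indep_vars_def2 by auto

lemma pos_0: "pos x 0 \<omega> = x"
  and pos_Suc: "pos x (Suc n) \<omega> = (if pos x n \<omega> \<in> K then pos x n \<omega> + Y (Suc n) \<omega> else pos x n \<omega>)"
  by (simp_all add: pos_def)

lemma measurable_stopped_path:
  "n \<le> m \<Longrightarrow> (\<lambda>y. stopped_path K x y n) \<in> borel_measurable (PiM {1..m} (\<lambda>_. borel))"
proof (induction n)
  case (Suc n)
  then have [measurable]: "(\<lambda>y. stopped_path K x y n) \<in> borel_measurable (PiM {1..m} (\<lambda>_. borel))"
    "(\<lambda>y. y (Suc n)) \<in> borel_measurable (PiM {1..m} (\<lambda>_. borel :: (real \<times> real) measure))"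
    by (auto intro!: measurable_component_singleton)
  show ?case unfolding stopped_path.simps by measurable
qed simp

lemma measurable_peak_power:
  "n \<le> m \<Longrightarrow> (\<lambda>y. peak_power k (stopped_path K x y) n) \<in> borel_measurable (PiM {1..m} (\<lambda>_. borel))"
proof (induction n)
  case 0
  then show ?case by simp
next
  case (Suc n)
  then have [measurable]: "(\<lambda>y. stopped_path K x y (Suc n)) \<in> borel_measurable (PiM {1..m} (\<lambda>_. borel))"
    "(\<lambda>y. peak_power k (stopped_path K x y) n) \<in> borel_measurable (PiM {1..m} (\<lambda>_. borel))"
    using measurable_stopped_path[of "Suc n" m x] by auto
  show ?case unfolding peak_power.simps by measurable
qed

text \<open>
  The position and the running maximum depend on the first \<open>n\<close> steps only. The step is padded with a zero
  because \<open>indep_var\<close> relates random variables of one type.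
\<close>

lemma state_indep_next_step:
  "indep_var borel (\<lambda>\<omega>. (pos x n \<omega>, peak k x n \<omega>)) borel (\<lambda>\<omega>. (Y (Suc n) \<omega>, 0))"
proof -
  let ?H = "\<lambda>y. (stopped_path K x y n, peak_power k (stopped_path K x y) n)"
  have "?H \<in> borel_measurable (PiM {1..n} (\<lambda>_. borel))"
    using measurable_stopped_path[of n n x] measurable_peak_power[of n n k x] by (intro borel_measurable_Pair) auto
  moreover have "(\<lambda>y. (y (Suc n), 0 :: real)) \<in> borel_measurable (PiM {Suc n} (\<lambda>_. borel :: (real \<times> real) measure))"
    by (intro borel_measurable_Pair measurable_component_singleton) auto
  ultimately have "indep_var borel (?H \<circ> (\<lambda>\<omega>. restrict (\<lambda>i. Y i \<omega>) {1..n}))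
     borel ((\<lambda>y. (y (Suc n), 0)) \<circ> (\<lambda>\<omega>. restrict (\<lambda>i. Y i \<omega>) {Suc n}))"
    by (intro indep_var_compose[OF indep_var_restrict[OF indep_steps]]) auto
  also have "?H \<circ> (\<lambda>\<omega>. restrict (\<lambda>i. Y i \<omega>) {1..n}) = (\<lambda>\<omega>. (pos x n \<omega>, peak k x n \<omega>))"
    by (auto simp: fun_eq_iff pos_def peak_def intro!: stopped_path_cong peak_power_cong)
  also have "(\<lambda>y. (y (Suc n), 0)) \<circ> (\<lambda>\<omega>. restrict (\<lambda>i. Y i \<omega>) {Suc n}) = (\<lambda>\<omega>. (Y (Suc n) \<omega>, 0 :: real))"
    by (auto simp: fun_eq_iff)
  finally show ?thesis .
qed

lemma measurable_pos [measurable]: "pos x n \<in> borel_measurable M"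
  and measurable_peak [measurable]: "peak k x n \<in> borel_measurable M"
proof -
  have m: "(\<lambda>\<omega>. (pos x n \<omega>, peak k x n \<omega>)) \<in> borel_measurable M"
    using indep_var_rv1[OF state_indep_next_step] .
  show "pos x n \<in> borel_measurable M" "peak k x n \<in> borel_measurable M"
    using measurable_compose[OF m, of fst borel] measurable_compose[OF m, of snd borel]
    by (simp_all add: borel_prod[symmetric])
qed

lemma borel_measurable_fst_pair [measurable]:
  "fst \<in> borel_measurable (borel :: ((real \<times> real) \<times> real) measure)"
  unfolding borel_prod[symmetric] by simp

lemma borel_measurable_Pair_zero [measurable]:
  "(\<lambda>z. (z, 0 :: real)) \<in> borel_measurable (borel :: (real \<times> real) measure)"
  by (intro borel_measurable_Pair) auto

lemma borel_measurable_state_pos: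
  "(\<lambda>p. fst (fst p)) \<in> borel_measurable
     ((borel :: ((real \<times> real) \<times> real) measure) \<Otimes>\<^sub>M (borel :: (real \<times> real) measure))"
  by (rule measurable_compose[OF measurable_fst borel_measurable_fst_pair])

lemma state_step_distr:
  "distr M (borel \<Otimes>\<^sub>M borel) (\<lambda>\<omega>. ((pos x n \<omega>, peak k x n \<omega>), (Y (Suc n) \<omega>, 0 :: real))) =
     distr M borel (\<lambda>\<omega>. (pos x n \<omega>, peak k x n \<omega>)) \<Otimes>\<^sub>M distr \<mu> borel (\<lambda>z. (z, 0))"
proof -
  have "distr M borel (\<lambda>\<omega>. (Y (Suc n) \<omega>, 0 :: real)) = distr (distr M borel (Y (Suc n))) borel (\<lambda>z. (z, 0))"
    by (subst distr_distr) (auto simp: o_def)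
  then show ?thesis
    using state_indep_next_step[of x n k] distr_step[of "Suc n"]
    by (simp add: indep_var_distribution_eq)
qed

text \<open>
  The Markov property: the next step can be integrated out with the past held fixed.
\<close>

lemma nn_integral_step:
  assumes g [measurable]: "case_prod g \<in> borel_measurable (borel \<Otimes>\<^sub>M borel)"
  shows "(\<integral>\<^sup>+\<omega>. g (pos x n \<omega>, peak k x n \<omega>) (Y (Suc n) \<omega>) \<partial>M) =
    (\<integral>\<^sup>+\<omega>. (\<integral>\<^sup>+z. g (pos x n \<omega>, peak k x n \<omega>) z \<partial>\<mu>) \<partial>M)"
proof -
  let ?S = "\<lambda>\<omega>. (pos x n \<omega>, peak k x n \<omega>)"
  let ?\<nu> = "distr \<mu> borel (\<lambda>z. (z, 0 :: real))"
  let ?g = "\<lambda>p :: ((real \<times> real) \<times> real) \<times> ((real \<times> real) \<times> real). g (fst p) (fst (snd p))"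
  interpret \<nu>: prob_space ?\<nu> by (rule law.prob_space_distr) simp
  have [measurable]: "?S \<in> borel_measurable M" by (rule indep_var_rv1[OF state_indep_next_step])
  have "(\<lambda>p. (fst p, fst (snd p))) \<in>
      (borel :: ((real \<times> real) \<times> real) measure) \<Otimes>\<^sub>M (borel :: ((real \<times> real) \<times> real) measure) \<rightarrow>\<^sub>M borel \<Otimes>\<^sub>M borel"
    by (intro measurable_Pair measurable_fst measurable_compose[OF measurable_snd borel_measurable_fst_pair])
  from measurable_compose[OF this g] have g0: "?g \<in> borel_measurable (borel \<Otimes>\<^sub>M borel)" by (simp only: prod.case)
  then have g': "?g \<in> borel_measurable (distr M borel ?S \<Otimes>\<^sub>M ?\<nu>)"
    by (simp add: measurable_cong_sets[OF sets_pair_measure_cong[OF sets_distr sets_distr] refl])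
  have inner: "(\<integral>\<^sup>+z. g s (fst z) \<partial>?\<nu>) = (\<integral>\<^sup>+z. g s z \<partial>\<mu>)" for s
    by (subst nn_integral_distr) auto
  have "(\<integral>\<^sup>+\<omega>. g (?S \<omega>) (Y (Suc n) \<omega>) \<partial>M) =
      (\<integral>\<^sup>+p. ?g p \<partial>distr M (borel \<Otimes>\<^sub>M borel) (\<lambda>\<omega>. (?S \<omega>, (Y (Suc n) \<omega>, 0))))"
    by (subst nn_integral_distr) auto
  also have "\<dots> = (\<integral>\<^sup>+s. (\<integral>\<^sup>+z. g s (fst z) \<partial>?\<nu>) \<partial>distr M borel ?S)"
    unfolding state_step_distr by (subst \<nu>.nn_integral_fst[OF g', symmetric]) simp
  also have "\<dots> = (\<integral>\<^sup>+\<omega>. (\<integral>\<^sup>+z. g (?S \<omega>) z \<partial>\<mu>) \<partial>M)"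
    using \<nu>.borel_measurable_nn_integral_fst[OF g'] by (subst nn_integral_distr) (auto simp: inner)
  finally show ?thesis .
qed

lemma integral_step:
  fixes g :: "real \<times> real \<Rightarrow> real \<times> real \<Rightarrow> real"
  assumes g [measurable]: "case_prod g \<in> borel_measurable (borel \<Otimes>\<^sub>M borel)"
    and int: "integrable M (\<lambda>\<omega>. g (pos x n \<omega>) (Y (Suc n) \<omega>))"
  shows "(\<integral>\<omega>. g (pos x n \<omega>) (Y (Suc n) \<omega>) \<partial>M) = (\<integral>\<omega>. (\<integral>z. g (pos x n \<omega>) z \<partial>\<mu>) \<partial>M)"
proof -
  let ?S = "\<lambda>\<omega>. (pos x n \<omega>, peak 0 x n \<omega>)"
  let ?\<nu> = "distr \<mu> borel (\<lambda>z. (z, 0 :: real))"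
  let ?g = "\<lambda>p :: ((real \<times> real) \<times> real) \<times> ((real \<times> real) \<times> real). g (fst (fst p)) (fst (snd p))"
  have [measurable]: "?S \<in> borel_measurable M" by (rule indep_var_rv1[OF state_indep_next_step])
  have "(\<lambda>p. (fst (fst p), fst (snd p))) \<in>
      (borel :: ((real \<times> real) \<times> real) measure) \<Otimes>\<^sub>M (borel :: ((real \<times> real) \<times> real) measure) \<rightarrow>\<^sub>M borel \<Otimes>\<^sub>M borel"
    by (intro measurable_Pair measurable_compose[OF measurable_fst borel_measurable_fst_pair]
        measurable_compose[OF measurable_snd borel_measurable_fst_pair])
  from measurable_compose[OF this g] have g0: "?g \<in> borel_measurable (borel \<Otimes>\<^sub>M borel)" by (simp only: prod.case)
  interpret S: prob_space "distr M borel ?S" by (rule prob_space_distr) simp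
  interpret \<nu>: prob_space ?\<nu> by (rule law.prob_space_distr) simp
  interpret P: pair_sigma_finite "distr M borel ?S" ?\<nu> ..
  have "integrable (distr M (borel \<Otimes>\<^sub>M borel) (\<lambda>\<omega>. (?S \<omega>, (Y (Suc n) \<omega>, 0)))) ?g"
    using int g0 by (subst integrable_distr_eq) auto
  then have int': "integrable (distr M borel ?S \<Otimes>\<^sub>M ?\<nu>) ?g" unfolding state_step_distr .
  have inner: "(\<integral>z. g s (fst z) \<partial>?\<nu>) = (\<integral>z. g s z \<partial>\<mu>)" for s
    by (subst integral_distr) auto
  have "(\<integral>\<omega>. g (pos x n \<omega>) (Y (Suc n) \<omega>) \<partial>M) =
      (\<integral>p. ?g p \<partial>distr M (borel \<Otimes>\<^sub>M borel) (\<lambda>\<omega>. (?S \<omega>, (Y (Suc n) \<omega>, 0))))"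
    using g0 by (subst integral_distr) auto
  also have "\<dots> = (\<integral>s. (\<integral>z. g (fst s) (fst z) \<partial>?\<nu>) \<partial>distr M borel ?S)"
    unfolding state_step_distr using P.integral_fst'[OF int'] by simp
  also have "\<dots> = (\<integral>\<omega>. (\<integral>z. g (pos x n \<omega>) z \<partial>\<mu>) \<partial>M)"
    using P.integrable_fst'[OF int', THEN borel_measurable_integrable]
    by (subst integral_distr) (auto simp: inner)
  finally show ?thesis .
qed

end

section \<open>Moment bounds and optional stopping\<close>

context wedge_walk
begin

lemma wedge_disjoint_frontier: "y \<in> frontier K \<Longrightarrow> y \<notin> K"
  using open_wedge[OF \<alpha>_pos \<alpha>_less] by (simp add: frontier_def interior_open)

lemma closure_wedge: "closure K = K \<union> frontier K"
  using closure_subset[of K] open_wedge[OF \<alpha>_pos \<alpha>_less] by (auto simp: frontier_def interior_open)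

lemma AE_exit_time_finite:
  assumes "x \<in> R \<inter> K"
  shows "AE \<omega> in M. \<exists>t. exit_time K Y x \<omega> = enat t"
  using exit_at_frontier[OF assms] by eventually_elim auto

text \<open>
  The hypothesis on the exit position enters here: the stopped walk never leaves the closed wedge.
\<close>

lemma AE_pos:
  assumes "x \<in> R \<inter> K"
  shows "AE \<omega> in M. \<forall>n. pos x n \<omega> \<in> R \<and> pos x n \<omega> \<in> closure K \<and>
    (pos x n \<omega> \<in> K \<longleftrightarrow> enat n < exit_time K Y x \<omega>)"
  using exit_at_frontier[OF assms] walk_in_lattice
proof eventually_elim
  case (elim \<omega>)
  then obtain t where t: "exit_time K Y x \<omega> = enat t" by auto
  have f: "x + walk Y t \<omega> \<in> frontier K" using elim(1) t by simp
  have w: "x + walk Y n \<omega> \<in> R" for n using elim(2) assms planar_lattice_add[OF lattice] by auto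
  show ?case
  proof
    fix n
    show "pos x n \<omega> \<in> R \<and> pos x n \<omega> \<in> closure K \<and> (pos x n \<omega> \<in> K \<longleftrightarrow> enat n < exit_time K Y x \<omega>)"
    proof (cases "n < t")
      case True
      then show ?thesis using stopped_path_walk(1)[OF _ t, of n] assms w closure_subset[of K]
        by (auto simp: pos_def t)
    next
      case False
      then show ?thesis using stopped_path_walk(2)[OF _ t, of n] assms w f wedge_disjoint_frontier[OF f]
        by (auto simp: pos_def t closure_wedge)
    qed
  qed
qed

lemma AE_law_iff_step:
  assumes "Measurable.pred borel P"
  shows "(AE z in \<mu>. P z) \<longleftrightarrow> (AE \<omega> in M. P (Y 1 \<omega>))"
proof -
  have "(AE z in distr M borel (Y 1). P z) \<longleftrightarrow> (AE \<omega> in M. P (Y 1 \<omega>))"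
    using assms by (intro AE_distr_iff) auto
  then show ?thesis unfolding distr_step[OF order_refl] .
qed

text \<open>
  A single step from \<open>y\<close> either stays in the wedge or makes the walk exit at time 1, on the frontier.
\<close>

lemma AE_step_in_closure:
  assumes "y \<in> R \<inter> K" shows "AE z in \<mu>. y + z \<in> closure K"
proof -
  have [measurable]: "closure K \<in> sets borel" by auto
  have "AE \<omega> in M. pos y 1 \<omega> \<in> closure K" using AE_pos[OF assms] by eventually_elim auto
  then have *: "AE \<omega> in M. y + Y 1 \<omega> \<in> closure K" using assms by (simp add: pos_Suc pos_0)
  have "Measurable.pred borel (\<lambda>z. y + z \<in> closure K)" by measurable
  from AE_law_iff_step[OF this] * show ?thesis by blast
qed

lemma AE_step_in_lattice:
  assumes "y \<in> R" shows "AE z in \<mu>. y + z \<in> R"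
proof -
  have [measurable]: "R \<in> sets borel"
    by (rule sets.countable[OF _ countable_planar_lattice[OF lattice]]) (rule borel_singleton, rule sets.empty_sets)
  have *: "AE \<omega> in M. y + Y 1 \<omega> \<in> R"
    using walk_in_lattice
  proof eventually_elim
    case (elim \<omega>)
    then have "walk Y 1 \<omega> \<in> R" by blast
    then show ?case using assms planar_lattice_add[OF lattice] by (simp add: walk_def)
  qed
  have "Measurable.pred borel (\<lambda>z. y + z \<in> R)" by measurable
  from AE_law_iff_step[OF this] * show ?thesis by blast
qed

lemma nn_integral_supermartingale:
  assumes W: "poly_fun d W" "integrable \<mu> (\<lambda>z. norm z ^ d)"
    and nonneg: "\<And>y. y \<in> closure K \<Longrightarrow> 0 \<le> W y" and super: "\<And>y. (\<integral>z. W (y + z) \<partial>\<mu>) \<le> W y"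
    and x: "x \<in> R \<inter> K"
  shows "(\<integral>\<^sup>+\<omega>. ennreal (W (pos x n \<omega>)) \<partial>M) \<le> ennreal (W x)"
proof (induction n)
  case 0
  then show ?case by (simp add: pos_0 emeasure_space_1)
next
  case (Suc n)
  have [measurable]: "W \<in> borel_measurable borel" by (rule borel_measurable_poly_fun[OF W(1)])
  define g where "g s z = ennreal (W (if fst s \<in> K then fst s + z else fst s))" for s :: "(real \<times> real) \<times> real" and z
  have [measurable]: "case_prod g \<in> borel_measurable (borel \<Otimes>\<^sub>M borel)"
  proof -
    note [measurable] = borel_measurable_state_pos
    show ?thesis unfolding g_def case_prod_beta' by measurable
  qed
  have "(\<integral>\<^sup>+\<omega>. ennreal (W (pos x (Suc n) \<omega>)) \<partial>M) =
      (\<integral>\<^sup>+\<omega>. g (pos x n \<omega>, peak 0 x n \<omega>) (Y (Suc n) \<omega>) \<partial>M)"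
    unfolding g_def fst_conv pos_Suc ..
  also have "\<dots> = (\<integral>\<^sup>+\<omega>. (\<integral>\<^sup>+z. g (pos x n \<omega>, peak 0 x n \<omega>) z \<partial>\<mu>) \<partial>M)"
    by (rule nn_integral_step) fact
  also have "\<dots> \<le> (\<integral>\<^sup>+\<omega>. ennreal (W (pos x n \<omega>)) \<partial>M)"
  proof (rule nn_integral_mono_AE)
    show "AE \<omega> in M. (\<integral>\<^sup>+z. g (pos x n \<omega>, peak 0 x n \<omega>) z \<partial>\<mu>) \<le> ennreal (W (pos x n \<omega>))"
      using AE_pos[OF x]
    proof eventually_elim
      case (elim \<omega>)
      let ?y = "pos x n \<omega>"
      show ?case
      proof (cases "?y \<in> K")
        case True
        then have "?y \<in> R \<inter> K" using elim by blast
        from AE_step_in_closure[OF this] have "AE z in \<mu>. 0 \<le> W (?y + z)"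
          by eventually_elim (rule nonneg)
        then have "(\<integral>\<^sup>+z. ennreal (W (?y + z)) \<partial>\<mu>) = ennreal (\<integral>z. W (?y + z) \<partial>\<mu>)"
          by (intro nn_integral_eq_integral law.integrable_poly_fun_shift[OF W(2,1)])
        then show ?thesis using True super[of ?y] by (simp add: g_def ennreal_leI)
      next
        case False
        then show ?thesis by (simp add: g_def law.emeasure_space_1[simplified])
      qed
    qed
  qed
  finally show ?case using Suc by (rule order_trans)
qed

lemma norm_power_moment_bound:
  assumes "integrable \<mu> (\<lambda>z. norm z ^ (2 * k))" "1 \<le> k" "real k * \<alpha> < pi / 2" "x \<in> R \<inter> K"
  shows "\<exists>B. \<forall>n. (\<integral>\<^sup>+\<omega>. ennreal (norm (pos x n \<omega>) ^ (2 * k)) \<partial>M) \<le> ennreal B"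
proof -
  obtain W c where W: "0 < c" "poly_fun (2 * k) W"
    "\<And>y. y \<in> closure K \<Longrightarrow> c * norm y ^ (2 * k) \<le> W y" "\<And>y. (\<integral>z. W (y + z) \<partial>\<mu>) \<le> W y"
    using law.lyapunov_function[OF assms(1,2) \<alpha>_pos assms(3)] by blast
  have [measurable]: "W \<in> borel_measurable borel" by (rule borel_measurable_poly_fun[OF W(2)])
  have nonneg: "0 \<le> W y" if "y \<in> closure K" for y
    using W(3)[OF that] W(1) by (smt (verit) mult_nonneg_nonneg norm_ge_zero zero_le_power)
  have "(\<integral>\<^sup>+\<omega>. ennreal (norm (pos x n \<omega>) ^ (2 * k)) \<partial>M) \<le> ennreal (1 / c * W x)" for n
  proof -
    have "(\<integral>\<^sup>+\<omega>. ennreal (norm (pos x n \<omega>) ^ (2 * k)) \<partial>M) \<le> (\<integral>\<^sup>+\<omega>. ennreal (1 / c) * ennreal (W (pos x n \<omega>)) \<partial>M)"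
    proof (rule nn_integral_mono_AE)
      show "AE \<omega> in M. ennreal (norm (pos x n \<omega>) ^ (2 * k)) \<le> ennreal (1 / c) * ennreal (W (pos x n \<omega>))"
        using AE_pos[OF assms(4)]
      proof eventually_elim
        case (elim \<omega>)
        then have "norm (pos x n \<omega>) ^ (2 * k) \<le> 1 / c * W (pos x n \<omega>)" "0 \<le> W (pos x n \<omega>)"
          using W(3)[of "pos x n \<omega>"] nonneg W(1) by (auto simp: field_simps)
        then show ?case using W(1) by (subst ennreal_mult[symmetric]) (auto intro: ennreal_leI)
      qed
    qed
    also have "\<dots> = ennreal (1 / c) * (\<integral>\<^sup>+\<omega>. ennreal (W (pos x n \<omega>)) \<partial>M)"
      by (rule nn_integral_cmult) measurable
    also have "\<dots> \<le> ennreal (1 / c) * ennreal (W x)"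
      by (intro mult_left_mono nn_integral_supermartingale[OF W(2) assms(1) nonneg W(4) assms(4)]) auto
    also have "\<dots> = ennreal (1 / c * W x)"
      using W(1) nonneg[of x] assms(4) closure_subset[of K] by (subst ennreal_mult) auto
    finally show ?thesis .
  qed
  then show ?thesis by blast
qed

text \<open>
  The submartingale property tested against the running maximum, as it is needed to average
  \<open>doob_pathwise\<close>.
\<close>

lemma peak_cross_moment_mono:
  assumes "integrable \<mu> (\<lambda>z. norm z ^ (2 * k))"
  shows "(\<integral>\<^sup>+\<omega>. ennreal (peak k x n \<omega> * norm (pos x n \<omega>) ^ k) \<partial>M) \<le>
    (\<integral>\<^sup>+\<omega>. ennreal (peak k x n \<omega> * norm (pos x (Suc n) \<omega>) ^ k) \<partial>M)"
proof -
  define g where "g s z = ennreal (snd s * norm (if fst s \<in> K then fst s + z else fst s) ^ k)"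
    for s :: "(real \<times> real) \<times> real" and z
  have [measurable]: "case_prod g \<in> borel_measurable (borel \<Otimes>\<^sub>M borel)"
  proof -
    note [measurable] = borel_measurable_state_pos
    have "snd \<in> borel_measurable (borel :: ((real \<times> real) \<times> real) measure)"
      unfolding borel_prod[symmetric] by simp
    then have [measurable]: "(\<lambda>p. snd (fst p)) \<in> borel_measurable
        ((borel :: ((real \<times> real) \<times> real) measure) \<Otimes>\<^sub>M (borel :: (real \<times> real) measure))"
      by (rule measurable_compose[OF measurable_fst])
    show ?thesis unfolding g_def case_prod_beta' by measurable
  qed
  have "(\<integral>\<^sup>+\<omega>. ennreal (peak k x n \<omega> * norm (pos x n \<omega>) ^ k) \<partial>M) \<le>
      (\<integral>\<^sup>+\<omega>. (\<integral>\<^sup>+z. g (pos x n \<omega>, peak k x n \<omega>) z \<partial>\<mu>) \<partial>M)"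
  proof (rule nn_integral_mono)
    fix \<omega>
    let ?y = "pos x n \<omega>" and ?m = "peak k x n \<omega>"
    have m: "0 \<le> ?m" by (simp add: peak_def peak_power_nonneg)
    show "ennreal (?m * norm ?y ^ k) \<le> (\<integral>\<^sup>+z. g (?y, ?m) z \<partial>\<mu>)"
    proof (cases "?y \<in> K")
      case True
      note E = law.expectation_norm_power_ge[OF assms, of ?y]
      have "ennreal (?m * norm ?y ^ k) \<le> ennreal (\<integral>z. ?m * norm (?y + z) ^ k \<partial>\<mu>)"
        using E m by (intro ennreal_leI) (simp add: mult_left_mono)
      also have "\<dots> = (\<integral>\<^sup>+z. ennreal (?m * norm (?y + z) ^ k) \<partial>\<mu>)"
        using E m by (intro nn_integral_eq_integral[symmetric]) auto
      finally show ?thesis using True by (simp add: g_def)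
    next
      case False
      then show ?thesis by (simp add: g_def law.emeasure_space_1[simplified])
    qed
  qed
  also have "\<dots> = (\<integral>\<^sup>+\<omega>. g (pos x n \<omega>, peak k x n \<omega>) (Y (Suc n) \<omega>) \<partial>M)"
    by (rule nn_integral_step[symmetric]) fact
  finally show ?thesis unfolding g_def fst_conv snd_conv pos_Suc .
qed

text \<open>
  Averaging \<open>doob_pathwise\<close>. In extended reals the two sums cannot be subtracted, so the sum of the
  cross moments is first bounded, then cancelled from both sides.
\<close>

lemma doob_maximal_bound:
  assumes "integrable \<mu> (\<lambda>z. norm z ^ (2 * k))"
    and B: "\<And>n. (\<integral>\<^sup>+\<omega>. ennreal (norm (pos x n \<omega>) ^ (2 * k)) \<partial>M) \<le> ennreal B"
  shows "(\<integral>\<^sup>+\<omega>. ennreal ((peak k x n \<omega>)\<^sup>2) \<partial>M) \<le> 4 * ennreal B"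
proof -
  let ?m = "\<lambda>i \<omega>. peak k x i \<omega>" and ?s = "\<lambda>i \<omega>. norm (pos x i \<omega>) ^ k"
  have m0: "0 \<le> ?m i \<omega>" for i \<omega> by (simp add: peak_def peak_power_nonneg)
  have fin: "(\<integral>\<^sup>+\<omega>. ennreal (?m i \<omega> * ?s i \<omega>) \<partial>M) < top" for i
  proof -
    have "(\<integral>\<^sup>+\<omega>. ennreal (?m i \<omega> * ?s i \<omega>) \<partial>M) \<le> (\<integral>\<^sup>+\<omega>. (\<Sum>j\<le>i. ennreal (norm (pos x j \<omega>) ^ (2 * k))) \<partial>M)"
    proof (rule nn_integral_mono)
      fix \<omega>
      have "?m i \<omega> * ?s i \<omega> \<le> ?m i \<omega> * ?m i \<omega>"
        using peak_power_ge[of "\<lambda>i. pos x i \<omega>" i k] m0 by (intro mult_left_mono) (auto simp: peak_def)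
      also have "\<dots> \<le> (\<Sum>j\<le>i. norm (pos x j \<omega>) ^ (2 * k))"
        using peak_power_square_le_sum[of k "\<lambda>i. pos x i \<omega>" i] by (simp add: peak_def power2_eq_square)
      finally show "ennreal (?m i \<omega> * ?s i \<omega>) \<le> (\<Sum>j\<le>i. ennreal (norm (pos x j \<omega>) ^ (2 * k)))"
        by (subst sum_ennreal) (auto intro: ennreal_leI)
    qed
    also have "\<dots> = (\<Sum>j\<le>i. (\<integral>\<^sup>+\<omega>. ennreal (norm (pos x j \<omega>) ^ (2 * k)) \<partial>M))"
      by (rule nn_integral_sum) measurable
    also have "\<dots> \<le> (\<Sum>j\<le>i. ennreal B)" by (intro sum_mono B)
    also have "\<dots> < top" by (simp add: ennreal_mult_less_top of_nat_less_top)
    finally show ?thesis .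
  qed
  let ?A = "4 * (\<Sum>i<n. (\<integral>\<^sup>+\<omega>. ennreal (?m i \<omega> * ?s i \<omega>) \<partial>M))"
  have "?A + (\<integral>\<^sup>+\<omega>. ennreal ((?m n \<omega>)\<^sup>2) \<partial>M) \<le>
     4 * (\<Sum>i<n. (\<integral>\<^sup>+\<omega>. ennreal (?m i \<omega> * ?s (Suc i) \<omega>) \<partial>M)) + (\<integral>\<^sup>+\<omega>. ennreal ((?m n \<omega>)\<^sup>2) \<partial>M)"
    by (intro add_right_mono mult_left_mono sum_mono peak_cross_moment_mono assms(1)) auto
  also have "\<dots> = (\<integral>\<^sup>+\<omega>. ennreal ((?m n \<omega>)\<^sup>2 + 4 * (\<Sum>i<n. ?m i \<omega> * ?s (Suc i) \<omega>)) \<partial>M)"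
    using m0
    by (simp add: nn_integral_add nn_integral_sum nn_integral_cmult ennreal_mult sum_nonneg add.commute flip: sum_ennreal)
  also have "\<dots> \<le> (\<integral>\<^sup>+\<omega>. ennreal (4 * (?s n \<omega>)\<^sup>2 + 4 * (\<Sum>i<n. ?m i \<omega> * ?s i \<omega>)) \<partial>M)"
    using doob_pathwise[of k "\<lambda>i. pos x i _" n] by (intro nn_integral_mono ennreal_leI) (simp add: peak_def)
  also have "\<dots> = ?A + 4 * (\<integral>\<^sup>+\<omega>. ennreal (norm (pos x n \<omega>) ^ (2 * k)) \<partial>M)"
    using m0
    by (simp add: nn_integral_add nn_integral_sum nn_integral_cmult ennreal_mult sum_nonneg add.commute
        mult.commute[of 2 k] flip: sum_ennreal power_mult)
  also have "\<dots> \<le> ?A + 4 * ennreal B"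
    by (intro add_left_mono mult_left_mono B) auto
  finally have le: "?A + (\<integral>\<^sup>+\<omega>. ennreal ((?m n \<omega>)\<^sup>2) \<partial>M) \<le> ?A + 4 * ennreal B" .
  have "?A < top" using fin by (simp add: ennreal_mult_less_top)
  then show ?thesis using le by (auto simp: ennreal_add_left_cancel_le less_le)
qed

text \<open>
  Dominated convergence: the running maximum is an integrable majorant by Doob's inequality, and almost
  every path is eventually outside \<open>K\<close>.
\<close>

lemma killed_moment_tendsto_zero:
  assumes int: "integrable \<mu> (\<lambda>z. norm z ^ (2 * k))" and k: "1 \<le> k" "real k * \<alpha> < pi / 2" and x: "x \<in> R \<inter> K"
  shows "(\<lambda>n. \<integral>\<^sup>+\<omega>. ennreal (1 + norm (pos x n \<omega>) ^ (2 * k)) * indicator K (pos x n \<omega>) \<partial>M) \<longlonglongrightarrow> 0"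
proof -
  obtain B where B: "\<And>n. (\<integral>\<^sup>+\<omega>. ennreal (norm (pos x n \<omega>) ^ (2 * k)) \<partial>M) \<le> ennreal B"
    using norm_power_moment_bound[OF int k x] by blast
  let ?p = "\<lambda>n \<omega>. ennreal ((peak k x n \<omega>)\<^sup>2)"
  \<comment> \<open>an integrable majorant that does not depend on \<open>n\<close>\<close>
  define w where "w \<omega> = 1 + (SUP n. ?p n \<omega>)" for \<omega>
  have m0: "0 \<le> peak k x n \<omega>" for n \<omega> by (simp add: peak_def peak_power_nonneg)
  have inc: "incseq ?p"
    using m0 peak_power_mono
    by (intro incseq_SucI le_funI ennreal_leI power_mono) (auto simp: peak_def)
  have [measurable]: "w \<in> borel_measurable M" unfolding w_def by measurable
  have "(\<integral>\<^sup>+\<omega>. w \<omega> \<partial>M) = 1 + (\<integral>\<^sup>+\<omega>. (SUP n. ?p n \<omega>) \<partial>M)"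
    unfolding w_def by (subst nn_integral_add) (auto simp: emeasure_space_1)
  also have "(\<integral>\<^sup>+\<omega>. (SUP n. ?p n \<omega>) \<partial>M) = (SUP n. \<integral>\<^sup>+\<omega>. ?p n \<omega> \<partial>M)"
    by (rule nn_integral_monotone_convergence_SUP[OF inc]) measurable
  also have "1 + \<dots> \<le> 1 + 4 * ennreal B"
    by (intro add_left_mono SUP_least doob_maximal_bound[OF int B])
  also have "\<dots> < \<infinity>" by (simp add: ennreal_mult_less_top)
  finally have fin: "(\<integral>\<^sup>+\<omega>. w \<omega> \<partial>M) < \<infinity>" .
  have "(\<lambda>n. \<integral>\<^sup>+\<omega>. ennreal (1 + norm (pos x n \<omega>) ^ (2 * k)) * indicator K (pos x n \<omega>) \<partial>M)
      \<longlonglongrightarrow> (\<integral>\<^sup>+\<omega>. 0 \<partial>M)"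
  proof (rule nn_integral_dominated_convergence[OF _ _ _ _ fin])
    show "AE \<omega> in M. ennreal (1 + norm (pos x n \<omega>) ^ (2 * k)) * indicator K (pos x n \<omega>) \<le> w \<omega>" for n
    proof (rule AE_I2)
      fix \<omega>
      have "norm (pos x n \<omega>) ^ (2 * k) = (norm (pos x n \<omega>) ^ k)\<^sup>2" by (simp add: mult.commute flip: power_mult)
      also have "\<dots> \<le> (peak k x n \<omega>)\<^sup>2"
        using peak_power_ge[of "\<lambda>i. pos x i \<omega>" n k] by (intro power_mono) (auto simp: peak_def)
      finally have "ennreal (1 + norm (pos x n \<omega>) ^ (2 * k)) \<le> 1 + ?p n \<omega>"
        by (subst ennreal_1[symmetric], subst ennreal_plus[symmetric]) (auto intro!: ennreal_leI)
      also have "\<dots> \<le> w \<omega>" unfolding w_def by (intro add_left_mono SUP_upper) auto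
      finally show "ennreal (1 + norm (pos x n \<omega>) ^ (2 * k)) * indicator K (pos x n \<omega>) \<le> w \<omega>"
        by (auto simp: indicator_def)
    qed
    show "AE \<omega> in M. (\<lambda>n. ennreal (1 + norm (pos x n \<omega>) ^ (2 * k)) * indicator K (pos x n \<omega>)) \<longlonglongrightarrow> 0"
      using AE_pos[OF x] AE_exit_time_finite[OF x]
    proof eventually_elim
      case (elim \<omega>)
      then obtain t where "exit_time K Y x \<omega> = enat t" by blast
      then have "pos x n \<omega> \<notin> K" if "n \<ge> t" for n using elim(1) that by simp
      then have "\<forall>\<^sub>F n in sequentially. ennreal (1 + norm (pos x n \<omega>) ^ (2 * k)) * indicator K (pos x n \<omega>) = 0"
        unfolding eventually_sequentially by (intro exI[of _ t]) auto
      then show ?case by (rule tendsto_eventually)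
    qed
  qed measurable
  then show ?thesis by simp
qed

lemma integrable_pos:
  assumes int: "integrable \<mu> (\<lambda>z. norm z ^ (2 * k))" and k: "1 \<le> k" "real k * \<alpha> < pi / 2" and x: "x \<in> R \<inter> K"
    and f: "poly_fun (2 * k) f"
  shows "integrable M (\<lambda>\<omega>. f (pos x n \<omega>))"
proof -
  obtain B where "(\<integral>\<^sup>+\<omega>. ennreal (norm (pos x n \<omega>) ^ (2 * k)) \<partial>M) \<le> ennreal B"
    using norm_power_moment_bound[OF int k x] by blast
  then have "integrable M (\<lambda>\<omega>. norm (pos x n \<omega>) ^ (2 * k))"
    by (intro integrableI_bounded) (auto simp: norm_power intro: le_less_trans)
  moreover obtain C where C: "0 \<le> C" "\<And>y. \<bar>f y\<bar> \<le> C * (1 + norm y ^ (2 * k))" using poly_fun_growth[OF f] by blast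
  ultimately have int': "integrable M (\<lambda>\<omega>. C * (1 + norm (pos x n \<omega>) ^ (2 * k)))" by simp
  have [measurable]: "f \<in> borel_measurable borel" by (rule borel_measurable_poly_fun[OF f])
  show ?thesis
    by (rule Bochner_Integration.integrable_bound[OF int'])
       (measurable, use C in \<open>auto intro!: AE_I2 intro: order_trans\<close>)
qed

lemma integrable_pos_killed:
  assumes int: "integrable \<mu> (\<lambda>z. norm z ^ (2 * k))" and k: "1 \<le> k" "real k * \<alpha> < pi / 2" and x: "x \<in> R \<inter> K"
    and f: "poly_fun (2 * k) f"
  shows "integrable M (\<lambda>\<omega>. indicator K (pos x n \<omega>) * f (pos x n \<omega>))"
proof -
  have [measurable]: "f \<in> borel_measurable borel" by (rule borel_measurable_poly_fun[OF f])
  show ?thesis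
    by (rule Bochner_Integration.integrable_bound[OF integrable_pos[OF assms, of n]])
       (measurable, auto simp: indicator_def)
qed

lemma killed_expectation_tendsto_zero:
  assumes int: "integrable \<mu> (\<lambda>z. norm z ^ (2 * k))" and k: "1 \<le> k" "real k * \<alpha> < pi / 2" and x: "x \<in> R \<inter> K"
    and f: "poly_fun (2 * k) f"
  shows "(\<lambda>n. \<integral>\<omega>. indicator K (pos x n \<omega>) * f (pos x n \<omega>) \<partial>M) \<longlonglongrightarrow> 0"
proof (rule tendsto_rabs_zero_cancel)
  have [measurable]: "f \<in> borel_measurable borel" by (rule borel_measurable_poly_fun[OF f])
  obtain C where C: "0 \<le> C" "\<And>y. \<bar>f y\<bar> \<le> C * (1 + norm y ^ (2 * k))" using poly_fun_growth[OF f] by blast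
  let ?I = "\<lambda>n. \<integral>\<^sup>+\<omega>. ennreal (1 + norm (pos x n \<omega>) ^ (2 * k)) * indicator K (pos x n \<omega>) \<partial>M"
  have "(\<lambda>n. ennreal C * ?I n) \<longlonglongrightarrow> ennreal C * 0"
    by (intro ennreal_tendsto_cmult killed_moment_tendsto_zero int k x) auto
  then have lim: "(\<lambda>n. ennreal C * ?I n) \<longlonglongrightarrow> 0" by simp
  have "ennreal \<bar>\<integral>\<omega>. indicator K (pos x n \<omega>) * f (pos x n \<omega>) \<partial>M\<bar> \<le> ennreal C * ?I n" for n
  proof -
    have "ennreal \<bar>\<integral>\<omega>. indicator K (pos x n \<omega>) * f (pos x n \<omega>) \<partial>M\<bar> \<le>
        (\<integral>\<^sup>+\<omega>. ennreal (norm (indicator K (pos x n \<omega>) * f (pos x n \<omega>))) \<partial>M)"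
      using integral_norm_bound_ennreal[OF integrable_pos_killed[OF assms]] by simp
    also have "\<dots> \<le> (\<integral>\<^sup>+\<omega>. ennreal C * (ennreal (1 + norm (pos x n \<omega>) ^ (2 * k)) * indicator K (pos x n \<omega>)) \<partial>M)"
    proof (rule nn_integral_mono)
      fix \<omega>
      let ?y = "pos x n \<omega>"
      have "ennreal \<bar>f ?y\<bar> \<le> ennreal C * ennreal (1 + norm ?y ^ (2 * k))"
        using C by (subst ennreal_mult[symmetric]) (auto intro: ennreal_leI)
      then show "ennreal (norm (indicator K ?y * f ?y)) \<le> ennreal C * (ennreal (1 + norm ?y ^ (2 * k)) * indicator K ?y)"
        by (cases "?y \<in> K") auto
    qed
    also have "\<dots> = ennreal C * ?I n" by (rule nn_integral_cmult) measurable
    finally show ?thesis .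
  qed
  then have "(\<lambda>n. ennreal \<bar>\<integral>\<omega>. indicator K (pos x n \<omega>) * f (pos x n \<omega>) \<partial>M\<bar>) \<longlonglongrightarrow> 0"
    by (intro tendsto_sandwich[OF _ _ tendsto_const lim]) auto
  then show "(\<lambda>n. \<bar>\<integral>\<omega>. indicator K (pos x n \<omega>) * f (pos x n \<omega>) \<partial>M\<bar>) \<longlonglongrightarrow> 0"
    by (subst (asm) ennreal_0[symmetric], subst (asm) tendsto_ennreal_iff) auto
qed

text \<open>
  The killed expectations \<open>E[u(M\<^sub>n); M\<^sub>n \<in> K]\<close> telescope. When the walk is stopped at time \<open>n + 1\<close>, it sits on
  the frontier, where \<open>u\<close> vanishes; so killing at that time costs nothing and one step of the killed walk
  replaces \<open>u\<close> by its one-step average.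
\<close>

lemma optional_stopping:
  assumes int: "integrable \<mu> (\<lambda>z. norm z ^ (2 * k))" and k: "1 \<le> k" "real k * \<alpha> < pi / 2" and x: "x \<in> R \<inter> K"
    and u: "poly_fun (2 * k) u" and frontier: "\<And>y. y \<in> frontier K \<Longrightarrow> u y = 0"
  shows "(\<lambda>n. \<integral>\<omega>. indicator K (pos x n \<omega>) * (u (pos x n \<omega>) - (\<integral>z. u (pos x n \<omega> + z) \<partial>\<mu>)) \<partial>M) sums u x"
proof -
  have [measurable]: "u \<in> borel_measurable borel" by (rule borel_measurable_poly_fun[OF u])
  let ?e = "\<lambda>n. \<integral>\<omega>. indicator K (pos x n \<omega>) * u (pos x n \<omega>) \<partial>M"
  let ?Q = "\<lambda>y. \<integral>z. u (y + z) \<partial>\<mu>"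
  have Q: "poly_fun (2 * k) ?Q" by (rule law.poly_fun_expectation[OF int u])
  have [measurable]: "?Q \<in> borel_measurable borel" by (rule borel_measurable_poly_fun[OF Q])
  have killed: "integrable M (\<lambda>\<omega>. indicator K (pos x n \<omega>) * f (pos x n \<omega>))" if "poly_fun (2 * k) f" for f n
    by (rule integrable_pos_killed[OF int k x that])
  have "?e n - ?e (Suc n) = (\<integral>\<omega>. indicator K (pos x n \<omega>) * (u (pos x n \<omega>) - ?Q (pos x n \<omega>)) \<partial>M)" for n
  proof -
    let ?g = "\<lambda>y z. indicator K y * u (y + z)"
    \<comment> \<open>the indicator may be evaluated before the step, since \<open>u\<close> vanishes where the walk exits\<close>
    have ae: "AE \<omega> in M. indicator K (pos x (Suc n) \<omega>) * u (pos x (Suc n) \<omega>) = ?g (pos x n \<omega>) (Y (Suc n) \<omega>)"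
      using AE_pos[OF x]
    proof eventually_elim
      case (elim \<omega>)
      then have "pos x (Suc n) \<omega> \<in> K \<or> u (pos x (Suc n) \<omega>) = 0"
        using frontier closure_wedge by blast
      then show ?case by (auto simp: pos_Suc split: if_splits)
    qed
    have eq: "?e (Suc n) = (\<integral>\<omega>. ?g (pos x n \<omega>) (Y (Suc n) \<omega>) \<partial>M)"
      by (rule integral_cong_AE[OF _ _ ae]) measurable
    also have "\<dots> = (\<integral>\<omega>. (\<integral>z. ?g (pos x n \<omega>) z \<partial>\<mu>) \<partial>M)"
    proof (rule integral_step)
      show "integrable M (\<lambda>\<omega>. ?g (pos x n \<omega>) (Y (Suc n) \<omega>))"
        by (rule integrable_cong_AE_imp[OF killed[OF u, of "Suc n"] _ ae]) measurable
    qed measurable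
    finally show ?thesis
      using killed[OF u, of n] killed[OF Q, of n] by (simp add: right_diff_distrib)
  qed
  moreover have "(\<lambda>n. ?e n - ?e (Suc n)) sums (?e 0 - 0)"
    by (rule telescope_sums') (rule killed_expectation_tendsto_zero[OF int k x u])
  moreover have "?e 0 = u x" using x by (simp add: pos_0 prob_space)
  ultimately show ?thesis by simp
qed

end

section \<open>Exit moments as sums along the stopped walk\<close>

lemma ennreal_suminf_swap:
  fixes f :: "nat \<Rightarrow> nat \<Rightarrow> ennreal"
  shows "(\<Sum>i. \<Sum>n. f i n) = (\<Sum>n. \<Sum>i. f i n)"
proof -
  have "(\<Sum>i. \<Sum>n. f i n) = (\<integral>\<^sup>+i. (\<Sum>n. f i n) \<partial>count_space UNIV)"
    by (simp add: nn_integral_count_space_nat)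
  also have "\<dots> = (\<Sum>n. \<integral>\<^sup>+i. f i n \<partial>count_space UNIV)"
    by (rule nn_integral_suminf) simp
  finally show ?thesis by (simp add: nn_integral_count_space_nat)
qed

lemma ennreal_suminf_shift:
  fixes f :: "nat \<Rightarrow> ennreal"
  assumes "\<And>i. i < m \<Longrightarrow> f i = 0"
  shows "(\<Sum>n. f (n + m)) = suminf f"
proof -
  have "sum f {..<n + m} = (\<Sum>i<n. f (i + m))" for n
    using assms by (induction n) auto
  then have "(\<lambda>n. \<Sum>i<n. f (i + m)) \<longlonglongrightarrow> suminf f"
    using LIMSEQ_ignore_initial_segment[OF summable_LIMSEQ[of f], of m] by simp
  moreover have "(\<lambda>n. \<Sum>i<n. f (i + m)) \<longlonglongrightarrow> (\<Sum>n. f (n + m))"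
    by (rule summable_LIMSEQ) simp
  ultimately show ?thesis using LIMSEQ_unique by blast
qed

text \<open>
  The weight of \<open>P(\<tau> > n)\<close> in \<open>E[\<tau> ^ k]\<close>.
\<close>

definition power_increment :: "nat \<Rightarrow> nat \<Rightarrow> nat" where
  "power_increment k n = Suc n ^ k - n ^ k"

lemma sum_power_increment: "1 \<le> k \<Longrightarrow> (\<Sum>n<t. power_increment k n) = t ^ k"
proof (induction t)
  case (Suc t)
  then show ?case using power_mono[of t "Suc t" k] by (simp add: power_increment_def)
qed simp

lemma power_increment_eq: "power_increment k n = (\<Sum>j<k. (k choose j) * n ^ j)"
proof -
  have "Suc n ^ k = (\<Sum>j\<le>k. (k choose j) * n ^ j)"
    using binomial_ring[of n 1 k] by simp
  also have "\<dots> = (\<Sum>j<k. (k choose j) * n ^ j) + n ^ k"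
    by (simp add: lessThan_Suc_atMost[symmetric])
  finally show ?thesis by (simp add: power_increment_def)
qed

text \<open>
  With \<open>S n = P(\<tau> > n)\<close>, the inner sum on the left is \<open>E[(\<tau> - i - 1) ^ j; \<tau> > i + 1]\<close>. Collecting the terms
  with the same survival probability makes the weights telescope to a power of \<open>n\<close>.
\<close>

lemma suminf_power_increment_convolution:
  fixes S :: "nat \<Rightarrow> ennreal"
  assumes "1 \<le> j"
  shows "(\<Sum>i. \<Sum>n. of_nat (power_increment j n) * S (Suc n + i)) = (\<Sum>n. of_nat (n ^ j) * S n)"
proof -
  let ?f = "\<lambda>i n. if i < n then of_nat (power_increment j (n - Suc i)) * S n else 0"
  have "(\<Sum>n. of_nat (power_increment j n) * S (Suc n + i)) = suminf (?f i)" for i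
  proof -
    have "(\<Sum>n. ?f i (n + Suc i)) = suminf (?f i)" by (rule ennreal_suminf_shift) auto
    then show ?thesis by (simp add: add.commute)
  qed
  then have "(\<Sum>i. \<Sum>n. of_nat (power_increment j n) * S (Suc n + i)) = (\<Sum>n. \<Sum>i. ?f i n)"
    by (simp add: ennreal_suminf_swap[of ?f])
  moreover have "(\<Sum>i. ?f i n) = of_nat (n ^ j) * S n" for n
  proof -
    have "(\<Sum>i. ?f i n) = (\<Sum>i<n. of_nat (power_increment j (n - Suc i)) * S n)"
      by (subst suminf_finite[of "{..<n}"]) auto
    also have "\<dots> = (\<Sum>i<n. of_nat (power_increment j i) * S n)"
      by (rule sum.nat_diff_reindex)
    also have "\<dots> = of_nat (\<Sum>i<n. power_increment j i) * S n"
      by (simp add: sum_distrib_right)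
    finally show ?thesis using sum_power_increment[OF assms] by simp
  qed
  ultimately show ?thesis by presburger
qed

context wedge_walk
begin

text \<open>
  The probability that the walk started at \<open>y\<close> has not left the wedge by time \<open>n\<close>, for \<open>y\<close> in the wedge.
  Decomposing at the first step defines it for all \<open>y\<close> as a measurable function, without reference to
  the walk.
\<close>

primrec survival :: "nat \<Rightarrow> real \<times> real \<Rightarrow> ennreal" where
  "survival 0 y = 1"
| "survival (Suc n) y = (\<integral>\<^sup>+z. survival n (y + z) * indicator K (y + z) \<partial>\<mu>)"

lemma measurable_killed_step:
  assumes [measurable]: "\<phi> \<in> borel_measurable borel"
  shows "(\<lambda>y. \<integral>\<^sup>+z. \<phi> (y + z) * indicator K (y + z) \<partial>\<mu>) \<in> borel_measurable borel"
proof -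
  have "(\<lambda>(y, z). \<phi> (y + z) * indicator K (y + z)) \<in> borel_measurable (borel \<Otimes>\<^sub>M \<mu>)"
    by measurable
  then show ?thesis by (rule law.borel_measurable_nn_integral)
qed

lemma measurable_survival [measurable]: "survival n \<in> borel_measurable borel"
proof (induction n)
  case (Suc n)
  then show ?case using measurable_killed_step[OF Suc] by simp
qed simp

lemma nn_integral_killed_step:
  assumes [measurable]: "\<phi> \<in> borel_measurable borel"
  shows "(\<integral>\<^sup>+\<omega>. (\<integral>\<^sup>+z. \<phi> (pos x i \<omega> + z) * indicator K (pos x i \<omega> + z) \<partial>\<mu>) * indicator K (pos x i \<omega>) \<partial>M)
    = (\<integral>\<^sup>+\<omega>. \<phi> (pos x (Suc i) \<omega>) * indicator K (pos x (Suc i) \<omega>) \<partial>M)"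
proof -
  define g where "g s z = indicator K (fst s) * (\<phi> (fst s + z) * indicator K (fst s + z))"
    for s :: "(real \<times> real) \<times> real" and z
  have [measurable]: "case_prod g \<in> borel_measurable (borel \<Otimes>\<^sub>M borel)"
  proof -
    note [measurable] = borel_measurable_state_pos
    show ?thesis unfolding g_def case_prod_beta' by measurable
  qed
  have "(\<integral>\<^sup>+z. \<phi> (y + z) * indicator K (y + z) \<partial>\<mu>) * indicator K y = (\<integral>\<^sup>+z. g (y, m) z \<partial>\<mu>)" for y m
    unfolding g_def fst_conv by (subst nn_integral_cmult) (auto simp: mult.commute)
  then have "(\<integral>\<^sup>+\<omega>. (\<integral>\<^sup>+z. \<phi> (pos x i \<omega> + z) * indicator K (pos x i \<omega> + z) \<partial>\<mu>) * indicator K (pos x i \<omega>) \<partial>M)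
    = (\<integral>\<^sup>+\<omega>. (\<integral>\<^sup>+z. g (pos x i \<omega>, peak 0 x i \<omega>) z \<partial>\<mu>) \<partial>M)" by simp
  also have "\<dots> = (\<integral>\<^sup>+\<omega>. g (pos x i \<omega>, peak 0 x i \<omega>) (Y (Suc i) \<omega>) \<partial>M)"
    by (rule nn_integral_step[symmetric]) fact
  also have "\<dots> = (\<integral>\<^sup>+\<omega>. \<phi> (pos x (Suc i) \<omega>) * indicator K (pos x (Suc i) \<omega>) \<partial>M)"
    by (intro nn_integral_cong) (auto simp: g_def pos_Suc indicator_def)
  finally show ?thesis .
qed

text \<open>
  The first-step recursion of \<open>survival\<close> is traded for the last-step evolution of the stopped walk: \<open>i\<close> steps
  of the walk followed by survival for \<open>n\<close> more steps.
\<close>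

lemma nn_integral_survival_pos:
  "(\<integral>\<^sup>+\<omega>. survival n (pos x i \<omega>) * indicator K (pos x i \<omega>) \<partial>M) = (\<integral>\<^sup>+\<omega>. indicator K (pos x (n + i) \<omega>) \<partial>M)"
proof (induction n arbitrary: i)
  case (Suc n)
  then show ?case using nn_integral_killed_step[OF measurable_survival[of n], of x i] by simp
qed simp

lemma survival_eq:
  assumes "x \<in> K" shows "survival n x = (\<integral>\<^sup>+\<omega>. indicator K (pos x n \<omega>) \<partial>M)"
  using nn_integral_survival_pos[of n x 0] assms by (simp add: pos_0 emeasure_space_1)

text \<open>
  A measurable substitute for the exit moment, with which it agrees at lattice points in the wedge.
\<close>

definition moment_series :: "nat \<Rightarrow> real \<times> real \<Rightarrow> ennreal" where
  "moment_series k y = (\<Sum>n. of_nat (power_increment k n) * survival n y)"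

lemma measurable_moment_series [measurable]: "moment_series k \<in> borel_measurable borel"
  unfolding moment_series_def[abs_def] by measurable

lemma exit_moment_eq_series:
  assumes "x \<in> R \<inter> K" "1 \<le> k"
  shows "exit_moment M K Y k x = moment_series k x"
proof -
  have "exit_moment M K Y k x = (\<integral>\<^sup>+\<omega>. (\<Sum>n. of_nat (power_increment k n) * indicator K (pos x n \<omega>)) \<partial>M)"
    unfolding exit_moment_def
  proof (rule nn_integral_cong_AE)
    show "AE \<omega> in M. ennreal_of_enat (exit_time K Y x \<omega>) ^ k = (\<Sum>n. of_nat (power_increment k n) * indicator K (pos x n \<omega>))"
      using AE_pos[OF assms(1)] AE_exit_time_finite[OF assms(1)]
    proof eventually_elim
      case (elim \<omega>)
      then obtain t where t: "exit_time K Y x \<omega> = enat t" by blast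
      have "(\<Sum>n. of_nat (power_increment k n) * indicator K (pos x n \<omega>)) =
          (\<Sum>n<t. of_nat (power_increment k n) * indicator K (pos x n \<omega>) :: ennreal)"
        using elim(1) t by (intro suminf_finite) auto
      also have "\<dots> = (\<Sum>n<t. of_nat (power_increment k n))"
        using elim(1) t by (intro sum.cong) auto
      also have "\<dots> = of_nat (t ^ k)" using sum_power_increment[OF assms(2), of t] by (simp flip: of_nat_sum)
      finally show ?case by (simp add: t)
    qed
  qed
  also have "\<dots> = (\<Sum>n. (\<integral>\<^sup>+\<omega>. of_nat (power_increment k n) * indicator K (pos x n \<omega>) \<partial>M))"
    by (rule nn_integral_suminf) measurable
  also have "\<dots> = moment_series k x"
    unfolding moment_series_def using assms(1)
    by (intro suminf_cong) (subst nn_integral_cmult, auto simp: survival_eq)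
  finally show ?thesis .
qed

lemma killed_step_moment_series:
  "(\<integral>\<^sup>+z. moment_series j (y + z) * indicator K (y + z) \<partial>\<mu>) =
     (\<Sum>n. of_nat (power_increment j n) * survival (Suc n) y)"
proof -
  have "(\<integral>\<^sup>+z. moment_series j (y + z) * indicator K (y + z) \<partial>\<mu>) =
      (\<integral>\<^sup>+z. (\<Sum>n. of_nat (power_increment j n) * (survival n (y + z) * indicator K (y + z))) \<partial>\<mu>)"
    unfolding moment_series_def by (simp add: mult.assoc flip: ennreal_suminf_multc)
  also have "\<dots> = (\<Sum>n. (\<integral>\<^sup>+z. of_nat (power_increment j n) * (survival n (y + z) * indicator K (y + z)) \<partial>\<mu>))"
    by (rule nn_integral_suminf) measurable
  also have "\<dots> = (\<Sum>n. of_nat (power_increment j n) * survival (Suc n) y)"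
    by (intro suminf_cong) (subst nn_integral_cmult, auto)
  finally show ?thesis .
qed

text \<open>
  In probabilistic terms, the sum over \<open>i\<close> of \<open>E[(\<tau> - i - 1) ^ j; \<tau> > i + 1]\<close> is the sum over \<open>n\<close> of
  \<open>n ^ j * P(\<tau> > n)\<close>.
\<close>

lemma suminf_killed_step_moment_series:
  assumes "1 \<le> j" "x \<in> K"
  shows "(\<Sum>i. \<integral>\<^sup>+\<omega>. (\<integral>\<^sup>+z. moment_series j (pos x i \<omega> + z) * indicator K (pos x i \<omega> + z) \<partial>\<mu>) * indicator K (pos x i \<omega>) \<partial>M)
     = (\<Sum>n. of_nat (n ^ j) * survival n x)"
proof -
  have "(\<integral>\<^sup>+\<omega>. (\<integral>\<^sup>+z. moment_series j (pos x i \<omega> + z) * indicator K (pos x i \<omega> + z) \<partial>\<mu>) * indicator K (pos x i \<omega>) \<partial>M)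
      = (\<Sum>n. of_nat (power_increment j n) * survival (Suc n + i) x)" for i
  proof -
    have "(\<integral>\<^sup>+\<omega>. (\<integral>\<^sup>+z. moment_series j (pos x i \<omega> + z) * indicator K (pos x i \<omega> + z) \<partial>\<mu>) * indicator K (pos x i \<omega>) \<partial>M)
       = (\<integral>\<^sup>+\<omega>. (\<Sum>n. of_nat (power_increment j n) * (survival (Suc n) (pos x i \<omega>) * indicator K (pos x i \<omega>))) \<partial>M)"
      unfolding killed_step_moment_series by (simp del: survival.simps add: mult.assoc flip: ennreal_suminf_multc)
    also have "\<dots> = (\<Sum>n. (\<integral>\<^sup>+\<omega>. of_nat (power_increment j n) * (survival (Suc n) (pos x i \<omega>) * indicator K (pos x i \<omega>)) \<partial>M))"
      by (rule nn_integral_suminf) measurable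
    also have "\<dots> = (\<Sum>n. of_nat (power_increment j n) * survival (Suc n + i) x)"
      using assms(2)
      by (intro suminf_cong) (subst nn_integral_cmult, auto simp: nn_integral_survival_pos survival_eq simp del: survival.simps)
    finally show ?thesis .
  qed
  then show ?thesis using suminf_power_increment_convolution[OF assms(1), of "\<lambda>n. survival n x"] by simp
qed

text \<open>
  The zeroth moment is the constant 1, on the frontier too, so the boundary condition starts at \<open>k = 1\<close>.
\<close>

definition is_moment_fun :: "nat \<Rightarrow> (real \<times> real \<Rightarrow> real) \<Rightarrow> bool" where
  "is_moment_fun k u \<longleftrightarrow> poly_fun (2 * k) u \<and> (k \<noteq> 0 \<longrightarrow> (\<forall>y\<in>frontier K. u y = 0)) \<and>
     (\<forall>x\<in>R \<inter> K. 0 \<le> u x \<and> exit_moment M K Y k x = ennreal (u x))"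

text \<open>
  After a step from inside the wedge the walk is either still inside, where \<open>u\<close> is the moment, or on the
  frontier, where \<open>u\<close> is zero.
\<close>

lemma moment_fun_step:
  assumes u: "is_moment_fun j u" "1 \<le> j" and int: "integrable \<mu> (\<lambda>z. norm z ^ (2 * j))" and y: "y \<in> R \<inter> K"
  shows "0 \<le> (\<integral>z. u (y + z) \<partial>\<mu>)"
    and "ennreal (\<integral>z. u (y + z) \<partial>\<mu>) = (\<integral>\<^sup>+z. moment_series j (y + z) * indicator K (y + z) \<partial>\<mu>)"
proof -
  have p: "poly_fun (2 * j) u" using u(1) by (simp add: is_moment_fun_def)
  have ae: "AE z in \<mu>. 0 \<le> u (y + z) \<and> ennreal (u (y + z)) = moment_series j (y + z) * indicator K (y + z)"
    using AE_step_in_closure[OF y] AE_step_in_lattice[OF IntD1[OF y]]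
  proof eventually_elim
    case z: (elim z)
    have *: "(y + z \<in> K \<and> 0 \<le> u (y + z) \<and> moment_series j (y + z) = ennreal (u (y + z))) \<or> (y + z \<notin> K \<and> u (y + z) = 0)"
      using z closure_wedge wedge_disjoint_frontier u exit_moment_eq_series[of "y + z" j]
      by (auto simp: is_moment_fun_def)
    then show ?case by auto
  qed
  show "0 \<le> (\<integral>z. u (y + z) \<partial>\<mu>)"
    using ae by (intro integral_nonneg_AE) auto
  have "ennreal (\<integral>z. u (y + z) \<partial>\<mu>) = (\<integral>\<^sup>+z. ennreal (u (y + z)) \<partial>\<mu>)"
    using ae by (intro nn_integral_eq_integral[symmetric] law.integrable_poly_fun_shift[OF int p]) auto
  also have "\<dots> = (\<integral>\<^sup>+z. moment_series j (y + z) * indicator K (y + z) \<partial>\<mu>)"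
    using ae by (intro nn_integral_cong_AE) auto
  finally show "ennreal (\<integral>z. u (y + z) \<partial>\<mu>) = (\<integral>\<^sup>+z. moment_series j (y + z) * indicator K (y + z) \<partial>\<mu>)" .
qed

lemma is_moment_fun_0: "is_moment_fun 0 (\<lambda>_. 1)"
  by (simp add: is_moment_fun_def poly_fun_const exit_moment_def emeasure_space_1)

text \<open>
  By optional stopping, \<open>v x\<close> is the sum over \<open>i\<close> of \<open>E[G(M\<^sub>i); M\<^sub>i \<in> K]\<close> with \<open>G = v - P v\<close>. By
  the recursion \<open>G\<close> is a combination of one-step averages of lower moments, and summing these along the walk
  gives \<open>(\<Sum>n. (\<Sum>j<k. (k choose j) * n ^ j) * P(\<tau> > n))\<close>, whose weights are \<open>(n + 1) ^ k - n ^ k\<close>.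
\<close>

lemma is_moment_funI:
  assumes int: "integrable \<mu> (\<lambda>z. norm z ^ (2 * k))" and k: "1 \<le> k" "real k * \<alpha> < pi / 2"
    and lower: "\<And>j. j < k \<Longrightarrow> is_moment_fun j (u j)" and u0: "u 0 = (\<lambda>_. 1)"
    and v: "poly_fun (2 * k) v" and frontier: "\<And>y. y \<in> frontier K \<Longrightarrow> v y = 0"
    and rec: "\<And>y. y \<in> R \<inter> K \<Longrightarrow> v y = (\<integral>z. v (y + z) \<partial>\<mu>) + (\<Sum>j<k. real (k choose j) * (\<integral>z. u j (y + z) \<partial>\<mu>))"
  shows "is_moment_fun k v"
proof -
  let ?G = "\<lambda>y. v y - (\<integral>z. v (y + z) \<partial>\<mu>)"
  let ?T = "\<lambda>j y. \<integral>\<^sup>+z. moment_series j (y + z) * indicator K (y + z) \<partial>\<mu>"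
  have [measurable]: "v \<in> borel_measurable borel" "(\<lambda>y. \<integral>z. v (y + z) \<partial>\<mu>) \<in> borel_measurable borel"
    using borel_measurable_poly_fun[OF v] borel_measurable_poly_fun[OF law.poly_fun_expectation[OF int v]] by auto
  have [measurable]: "?T j \<in> borel_measurable borel" for j by (rule measurable_killed_step) measurable
  have int': "integrable \<mu> (\<lambda>z. norm z ^ (2 * j))" if "j < k" for j
    using that by (intro law.integrable_norm_power[OF int]) auto
  have G: "0 \<le> ?G y" "ennreal (?G y) = 1 + (\<Sum>j\<in>{1..<k}. of_nat (k choose j) * ?T j y)" if y: "y \<in> R \<inter> K" for y
  proof -
    have set: "{..<k} = insert 0 {1..<k}" using k(1) by auto
    have Geq: "?G y = 1 + (\<Sum>j\<in>{1..<k}. real (k choose j) * (\<integral>z. u j (y + z) \<partial>\<mu>))"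
      using rec[OF y] by (simp add: set u0)
    have E: "0 \<le> (\<integral>z. u j (y + z) \<partial>\<mu>)" "ennreal (\<integral>z. u j (y + z) \<partial>\<mu>) = ?T j y" if "j \<in> {1..<k}" for j
      using moment_fun_step[OF lower _ int' y, of j] that by auto
    have nn: "0 \<le> (\<Sum>j\<in>{1..<k}. real (k choose j) * (\<integral>z. u j (y + z) \<partial>\<mu>))"
      using E(1) by (intro sum_nonneg mult_nonneg_nonneg) auto
    then show "0 \<le> ?G y" using Geq by linarith
    have "ennreal (?G y) = 1 + (\<Sum>j\<in>{1..<k}. ennreal (real (k choose j) * (\<integral>z. u j (y + z) \<partial>\<mu>)))"
    proof -
      have "(\<Sum>j\<in>{1..<k}. ennreal (real (k choose j) * (\<integral>z. u j (y + z) \<partial>\<mu>))) =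
          ennreal (\<Sum>j\<in>{1..<k}. real (k choose j) * (\<integral>z. u j (y + z) \<partial>\<mu>))"
        using E(1) by (intro sum_ennreal mult_nonneg_nonneg) auto
      then show ?thesis unfolding Geq using nn by simp
    qed
    also have "\<dots> = 1 + (\<Sum>j\<in>{1..<k}. of_nat (k choose j) * ?T j y)"
      by (intro arg_cong2[where f="(+)"] refl sum.cong)
         (use E in \<open>auto simp: ennreal_mult ennreal_of_nat_eq_real_of_nat\<close>)
    finally show "ennreal (?G y) = 1 + (\<Sum>j\<in>{1..<k}. of_nat (k choose j) * ?T j y)" .
  qed
  have main: "0 \<le> v x \<and> exit_moment M K Y k x = ennreal (v x)" if x: "x \<in> R \<inter> K" for x
  proof -
    let ?t = "\<lambda>n. \<integral>\<omega>. indicator K (pos x n \<omega>) * ?G (pos x n \<omega>) \<partial>M"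
    have sums: "?t sums v x" by (rule optional_stopping[OF int k x v frontier])
    have ae: "AE \<omega> in M. 0 \<le> indicator K (pos x n \<omega>) * ?G (pos x n \<omega>) \<and>
        ennreal (indicator K (pos x n \<omega>) * ?G (pos x n \<omega>)) =
          indicator K (pos x n \<omega>) + (\<Sum>j\<in>{1..<k}. of_nat (k choose j) * (?T j (pos x n \<omega>) * indicator K (pos x n \<omega>)))" for n
      using AE_pos[OF x]
    proof eventually_elim
      case (elim \<omega>)
      show ?case
      proof (cases "pos x n \<omega> \<in> K")
        case True
        then have "pos x n \<omega> \<in> R \<inter> K" using elim by blast
        from G[OF this] show ?thesis using True by simp
      qed simp
    qed
    have t_nn: "0 \<le> ?t n" for n using ae[of n] by (intro integral_nonneg_AE) auto
    have vx: "0 \<le> v x" by (rule sums_le[OF t_nn sums_zero sums])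
    have t_eq: "ennreal (?t n) = (\<integral>\<^sup>+\<omega>. indicator K (pos x n \<omega>) \<partial>M) +
        (\<Sum>j\<in>{1..<k}. of_nat (k choose j) * (\<integral>\<^sup>+\<omega>. ?T j (pos x n \<omega>) * indicator K (pos x n \<omega>) \<partial>M))" for n
    proof -
      have "ennreal (?t n) = (\<integral>\<^sup>+\<omega>. ennreal (indicator K (pos x n \<omega>) * ?G (pos x n \<omega>)) \<partial>M)"
        using ae[of n]
        by (intro nn_integral_eq_integral[symmetric] integrable_pos_killed[OF int k x]
            poly_fun_diff v law.poly_fun_expectation[OF int v]) auto
      also have "\<dots> = (\<integral>\<^sup>+\<omega>. indicator K (pos x n \<omega>) + (\<Sum>j\<in>{1..<k}. of_nat (k choose j) * (?T j (pos x n \<omega>) * indicator K (pos x n \<omega>))) \<partial>M)"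
        using ae[of n] by (intro nn_integral_cong_AE) auto
      also have "\<dots> = (\<integral>\<^sup>+\<omega>. indicator K (pos x n \<omega>) \<partial>M) +
          (\<integral>\<^sup>+\<omega>. (\<Sum>j\<in>{1..<k}. of_nat (k choose j) * (?T j (pos x n \<omega>) * indicator K (pos x n \<omega>))) \<partial>M)"
        by (rule nn_integral_add) measurable
      also have "(\<integral>\<^sup>+\<omega>. (\<Sum>j\<in>{1..<k}. of_nat (k choose j) * (?T j (pos x n \<omega>) * indicator K (pos x n \<omega>))) \<partial>M) =
          (\<Sum>j\<in>{1..<k}. (\<integral>\<^sup>+\<omega>. of_nat (k choose j) * (?T j (pos x n \<omega>) * indicator K (pos x n \<omega>)) \<partial>M))"
        by (rule nn_integral_sum) measurable
      also have "\<dots> = (\<Sum>j\<in>{1..<k}. of_nat (k choose j) * (\<integral>\<^sup>+\<omega>. ?T j (pos x n \<omega>) * indicator K (pos x n \<omega>) \<partial>M))"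
        by (intro sum.cong refl nn_integral_cmult) measurable
      finally show ?thesis .
    qed
    have "ennreal (v x) = (\<Sum>n. ennreal (?t n))"
      using sums t_nn by (simp add: suminf_ennreal2 sums_iff)
    also have "\<dots> = (\<Sum>n. survival n x) + (\<Sum>n. \<Sum>j\<in>{1..<k}. of_nat (k choose j) * (\<integral>\<^sup>+\<omega>. ?T j (pos x n \<omega>) * indicator K (pos x n \<omega>) \<partial>M))"
      unfolding t_eq using x by (subst suminf_add[symmetric]) (auto simp: survival_eq)
    also have "(\<Sum>n. \<Sum>j\<in>{1..<k}. of_nat (k choose j) * (\<integral>\<^sup>+\<omega>. ?T j (pos x n \<omega>) * indicator K (pos x n \<omega>) \<partial>M)) =
        (\<Sum>j\<in>{1..<k}. of_nat (k choose j) * (\<Sum>n. \<integral>\<^sup>+\<omega>. ?T j (pos x n \<omega>) * indicator K (pos x n \<omega>) \<partial>M))"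
      by (subst suminf_sum) (auto intro!: sum.cong ennreal_suminf_cmult)
    also have "\<dots> = (\<Sum>j\<in>{1..<k}. of_nat (k choose j) * (\<Sum>n. of_nat (n ^ j) * survival n x))"
      using x by (intro sum.cong refl) (auto simp: suminf_killed_step_moment_series)
    also have "\<dots> = (\<Sum>n. \<Sum>j\<in>{1..<k}. of_nat (k choose j) * (of_nat (n ^ j) * survival n x))"
      by (subst suminf_sum) (auto intro!: sum.cong ennreal_suminf_cmult[symmetric])
    also have "(\<Sum>n. survival n x) + \<dots> = (\<Sum>n. survival n x + (\<Sum>j\<in>{1..<k}. of_nat (k choose j) * (of_nat (n ^ j) * survival n x)))"
      by (subst suminf_add) auto
    also have "\<dots> = moment_series k x"
      unfolding moment_series_def
    proof (rule suminf_cong)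
      fix n
      have set: "{..<k} = insert 0 {1..<k}" using k(1) by auto
      have "power_increment k n = 1 + (\<Sum>j\<in>{1..<k}. (k choose j) * n ^ j)"
        by (simp add: power_increment_eq set)
      then have "(of_nat (power_increment k n) :: ennreal) = 1 + (\<Sum>j\<in>{1..<k}. of_nat (k choose j) * of_nat (n ^ j))"
        by simp
      then show "survival n x + (\<Sum>j\<in>{1..<k}. of_nat (k choose j) * (of_nat (n ^ j) * survival n x)) =
          of_nat (power_increment k n) * survival n x"
        by (simp add: distrib_right sum_distrib_right mult.assoc)
    qed
    also have "\<dots> = exit_moment M K Y k x" using exit_moment_eq_series[OF x k(1)] by simp
    finally show ?thesis using vx by simp
  qed
  show ?thesis unfolding is_moment_fun_def using v frontier main by auto
qed

end

section \<open>Solving the moment problem\<close>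

text \<open>
  Gaussian elimination, one equation at a time.
\<close>

lemma underdetermined_system:
  fixes A :: "'i \<Rightarrow> 'j \<Rightarrow> real"
  assumes "finite I" "finite J" "card I < card J"
  shows "\<exists>c. (\<exists>j\<in>J. c j \<noteq> 0) \<and> (\<forall>i\<in>I. (\<Sum>j\<in>J. A i j * c j) = 0)"
  using assms
proof (induction I arbitrary: J A rule: finite_induct)
  case empty
  then obtain j where "j \<in> J" by fastforce
  then show ?case by (intro exI[of _ "\<lambda>_. 1"]) auto
next
  case (insert i I)
  show ?case
  proof (cases "\<forall>j\<in>J. A i j = 0")
    case True
    have "card I < card J" using insert by simp
    then obtain c where "\<exists>j\<in>J. c j \<noteq> 0" "\<forall>i\<in>I. (\<Sum>j\<in>J. A i j * c j) = 0"
      using insert.IH[OF insert.prems(1), of A] by blast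
    then show ?thesis using True by (intro exI[of _ c]) auto
  next
    case False
    then obtain j0 where j0: "j0 \<in> J" "A i j0 \<noteq> 0" by blast
    define J' where "J' = J - {j0}"
    have J': "finite J'" "J = insert j0 J'" "j0 \<notin> J'" using insert.prems j0 by (auto simp: J'_def)
    then have "card I < card J'" using insert.prems insert.hyps by simp
    then obtain c where c: "\<exists>j\<in>J'. c j \<noteq> 0"
      "\<And>i'. i' \<in> I \<Longrightarrow> (\<Sum>j\<in>J'. (A i' j - A i' j0 * (A i j / A i j0)) * c j) = 0"
      using insert.IH[OF J'(1), of "\<lambda>i' j. A i' j - A i' j0 * (A i j / A i j0)"] by blast
    \<comment> \<open>back substitution for the eliminated unknown \<open>j0\<close>\<close>
    define s where "s = (\<Sum>j\<in>J'. A i j * c j) / A i j0"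
    let ?c = "c(j0 := - s)"
    have sum_J: "(\<Sum>j\<in>J. A i' j * ?c j) = (\<Sum>j\<in>J'. A i' j * c j) - A i' j0 * s" for i'
    proof -
      have "(\<Sum>j\<in>J'. A i' j * ?c j) = (\<Sum>j\<in>J'. A i' j * c j)"
        using J'(3) by (intro sum.cong) auto
      then show ?thesis unfolding J'(2) using J'(1,3) by simp
    qed
    have "(\<Sum>j\<in>J. A i' j * ?c j) = 0" if "i' \<in> insert i I" for i'
    proof (cases "i' = i")
      case True
      then show ?thesis unfolding sum_J using j0 by (simp add: s_def)
    next
      case False
      then have "(\<Sum>j\<in>J'. A i' j * c j) - A i' j0 * s = (\<Sum>j\<in>J'. (A i' j - A i' j0 * (A i j / A i j0)) * c j)"
        by (simp add: s_def left_diff_distrib sum_subtractf sum_distrib_left sum_divide_distrib mult.assoc)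
      then show ?thesis unfolding sum_J using c(2)[of i'] that False by simp
    qed
    moreover have "\<exists>j\<in>J. ?c j \<noteq> 0" using c(1) J' by auto
    ultimately show ?thesis by blast
  qed
qed

text \<open>
  Adding the right-hand side as an extra unknown makes the system underdetermined. In a nontrivial
  solution the extra unknown is nonzero by injectivity, so it can be scaled to 1.
\<close>

lemma square_system_solvable:
  fixes A :: "'i \<Rightarrow> 'i \<Rightarrow> real"
  assumes I: "finite I"
    and inj: "\<And>c. (\<And>i. i \<in> I \<Longrightarrow> (\<Sum>j\<in>I. A i j * c j) = 0) \<Longrightarrow> (\<And>j. j \<in> I \<Longrightarrow> c j = 0)"
  shows "\<exists>c. \<forall>i\<in>I. (\<Sum>j\<in>I. A i j * c j) = r i"
proof -
  let ?J = "insert None (Some ` I)"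
  define B where "B i j = (case j of None \<Rightarrow> - r i | Some j \<Rightarrow> A i j)" for i j
  have "card I < card ?J" using I by (simp add: card_image)
  then obtain c where c: "\<exists>j\<in>?J. c j \<noteq> 0" "\<And>i. i \<in> I \<Longrightarrow> (\<Sum>j\<in>?J. B i j * c j) = 0"
    using underdetermined_system[OF I, of ?J B] I by blast
  have sum_J: "(\<Sum>j\<in>?J. B i j * c j) = - r i * c None + (\<Sum>j\<in>I. A i j * c (Some j))" for i
    using I by (simp add: sum.reindex B_def)
  have "c None \<noteq> 0"
  proof
    assume 0: "c None = 0"
    then have "c (Some j) = 0" if "j \<in> I" for j
      using inj[of "\<lambda>j. c (Some j)"] c(2) sum_J that by simp
    then show False using c(1) 0 by auto
  qed
  moreover have "(\<Sum>j\<in>I. A i j * c (Some j)) = r i * c None" if "i \<in> I" for i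
    using c(2)[OF that] sum_J[of i] by simp
  ultimately have "\<forall>i\<in>I. (\<Sum>j\<in>I. A i j * (c (Some j) / c None)) = r i"
    by (simp add: sum_divide_distrib[symmetric])
  then show ?thesis by (rule exI[of _ "\<lambda>j. c (Some j) / c None"])
qed

definition exponents :: "nat \<Rightarrow> (nat \<times> nat) set" where
  "exponents d = {(i, j). i + j \<le> d}"

definition monomial_fun :: "nat \<times> nat \<Rightarrow> real \<times> real \<Rightarrow> real" where
  "monomial_fun e y = fst y ^ fst e * snd y ^ snd e"

lemma finite_exponents: "finite (exponents d)"
  by (rule finite_subset[of _ "{..d} \<times> {..d}"]) (auto simp: exponents_def)

lemma poly_fun_monomial_fun: "e \<in> exponents d \<Longrightarrow> poly_fun d (monomial_fun e)"
  using poly_fun.monomial[of "fst e" "snd e" d 1]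
  by (auto simp: exponents_def monomial_fun_def[abs_def])

lemma poly_fun_coefficients:
  assumes "poly_fun d f"
  shows "\<exists>c. \<forall>y. f y = (\<Sum>e\<in>exponents d. c e * monomial_fun e y)"
  using assms
proof (induction rule: poly_fun.induct)
  case (monomial i j d c)
  then have "(i, j) \<in> exponents d" by (simp add: exponents_def)
  then have "c * fst y ^ i * snd y ^ j = (\<Sum>e\<in>exponents d. (if e = (i, j) then c else 0) * monomial_fun e y)" for y
    using finite_exponents[of d]
    by (simp add: if_distrib[of "\<lambda>t. t * _"] monomial_fun_def cong: if_cong)
  then show ?case by (intro exI[of _ "\<lambda>e. if e = (i, j) then c else 0"] allI)
next
  case (add d f g)
  then obtain a b where "\<forall>y. f y = (\<Sum>e\<in>exponents d. a e * monomial_fun e y)"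
    "\<forall>y. g y = (\<Sum>e\<in>exponents d. b e * monomial_fun e y)" by blast
  then show ?case by (intro exI[of _ "\<lambda>e. a e + b e"]) (simp add: distrib_right sum.distrib)
qed

lemma monomials_independent:
  assumes "\<And>y. (\<Sum>e\<in>exponents d. c e * monomial_fun e y) = 0" "e \<in> exponents d"
  shows "c e = 0"
proof -
  define p where "p = (\<Sum>e\<in>exponents d. monom (monom (c e) (fst e)) (snd e))"
  have "poly2 p y = 0" for y
    using assms(1)[of y]
    by (simp add: p_def poly2_def poly_sum poly_monom monomial_fun_def mult.assoc)
  then have "p = 0" by (rule poly2_vanishes)
  moreover have "coeff (coeff p (snd e)) (fst e) = c e"
  proof -
    have "coeff (coeff p (snd e)) (fst e) = (\<Sum>e'\<in>exponents d. if e' = e then c e else 0)"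
      unfolding p_def coeff_sum by (intro sum.cong refl) (auto simp: prod_eq_iff)
    then show ?thesis using assms(2) finite_exponents by simp
  qed
  ultimately show ?thesis by simp
qed

lemma poly2_inject: "(\<And>y. poly2 p y = poly2 q y) \<Longrightarrow> p = q"
  using poly2_vanishes[of "p - q"] by (simp add: poly2_diff)

context isotropic_law
begin

lemma affine_fun_harmonic:
  assumes "poly_fun d f" "d \<le> 1" shows "(\<integral>z. f (y + z) \<partial>\<mu>) = f y"
proof -
  have int: "integrable \<mu> (\<lambda>z. norm z ^ d)" using assms(2)
    by (intro integrable_norm_power[OF integrable_norm_square]) auto
  show ?thesis using assms int
  proof (induction rule: poly_fun.induct)
    case (monomial i j d c)
    then consider "i = 0" "j = 0" | "i = 1" "j = 0" | "i = 0" "j = 1" by linarith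
    then show ?case
      using integrable_fst integrable_snd mean_fst mean_snd by cases auto
  next
    case (add d f g)
    then show ?case using integrable_poly_fun_shift[of d f y] integrable_poly_fun_shift[of d g y] by simp
  qed
qed

end

context wedge_walk
begin

lemma wedge_fun_pos: "y \<in> K \<Longrightarrow> 0 < snd y * ray_gap \<alpha> y"
  using wedge_eq[OF \<alpha>_pos \<alpha>_less] by simp

lemma poly_fun_wedge_fun: "poly_fun 2 (\<lambda>y. snd y * ray_gap \<alpha> y)"
proof -
  have "poly_fun (1 + 1) (\<lambda>y. snd y * ray_gap \<alpha> y)"
    unfolding ray_gap_def
    using poly_fun_cmult[OF poly_fun_fst[of 1], of "sin \<alpha>"] poly_fun_cmult[OF poly_fun_snd[of 1], of "cos \<alpha>"]
    by (intro poly_fun_mult poly_fun_snd poly_fun_diff) (auto simp: mult.commute)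
  then show ?thesis by (simp add: numeral_2_eq_2)
qed

lemma poly_fun_eqI:
  assumes "poly_fun d f" "poly_fun e g" "\<And>x. x \<in> R \<inter> K \<Longrightarrow> f x = g x"
  shows "f y = g y"
proof -
  have "poly_fun (max d e) (\<lambda>y. f y - g y)"
    using assms(1,2) by (intro poly_fun_diff) (auto intro: poly_fun_mono)
  then have "f y - g y = 0"
    by (rule poly_fun_vanishes_if_zero_on_lattice_wedge[OF lattice \<alpha>_pos \<alpha>_less]) (simp add: assms(3))
  then show ?thesis by simp
qed

text \<open>
  Optional stopping leaves a series of zeros.
\<close>

lemma harmonic_fun_vanishes:
  assumes int: "integrable \<mu> (\<lambda>z. norm z ^ (2 * k))" and k: "1 \<le> k" "real k * \<alpha> < pi / 2"
    and u: "poly_fun (2 * k) u" and frontier: "\<And>y. y \<in> frontier K \<Longrightarrow> u y = 0"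
    and harmonic: "\<And>x. x \<in> R \<inter> K \<Longrightarrow> (\<integral>z. u (x + z) \<partial>\<mu>) = u x"
  shows "u y = 0"
proof (rule poly_fun_eqI[OF u poly_fun_const])
  fix x assume x: "x \<in> R \<inter> K"
  have "(\<integral>\<omega>. indicator K (pos x n \<omega>) * (u (pos x n \<omega>) - (\<integral>z. u (pos x n \<omega> + z) \<partial>\<mu>)) \<partial>M) = 0" for n
  proof (rule integral_eq_zero_AE)
    show "AE \<omega> in M. indicator K (pos x n \<omega>) * (u (pos x n \<omega>) - (\<integral>z. u (pos x n \<omega> + z) \<partial>\<mu>)) = 0"
      using AE_pos[OF x]
    proof eventually_elim
      case (elim \<omega>)
      show ?case
      proof (cases "pos x n \<omega> \<in> K")
        case True
        then have "pos x n \<omega> \<in> R \<inter> K" using elim by blast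
        from harmonic[OF this] show ?thesis by simp
      qed simp
    qed
  qed
  then have "(\<lambda>n. 0) sums u x" using optional_stopping[OF int k x u frontier] by simp
  then show "u x = 0" using sums_unique2[OF _ sums_zero] by blast
qed

text \<open>
  Look for \<open>v\<close> as the product of \<open>g\<close>, of degree at most \<open>2k - 2\<close>, with the quadratic form that vanishes on the
  two rays. The boundary condition is then automatic, and the equation becomes a square linear system
  for the coefficients of \<open>g\<close>. A solution of the homogeneous system gives a harmonic \<open>v\<close>, which is zero.
\<close>

lemma poisson_equation_solvable:
  assumes int: "integrable \<mu> (\<lambda>z. norm z ^ (2 * k))" and k: "1 \<le> k" "real k * \<alpha> < pi / 2"
    and H: "poly_fun (2 * k - 2) H"
  shows "\<exists>v. poly_fun (2 * k) v \<and> (\<forall>y\<in>frontier K. v y = 0) \<and> (\<forall>y. v y - (\<integral>z. v (y + z) \<partial>\<mu>) = H y)"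
proof -
  let ?d = "2 * k - 2"
  let ?I = "exponents ?d"
  \<comment> \<open>\<open>?w e\<close> satisfies the boundary condition; \<open>A\<close> is the matrix of \<open>?w e \<mapsto> ?w e - P (?w e)\<close>\<close>
  let ?w = "\<lambda>e y. snd y * ray_gap \<alpha> y * monomial_fun e y"
  let ?T = "\<lambda>e y. ?w e y - (\<integral>z. ?w e (y + z) \<partial>\<mu>)"
  have w: "poly_fun (2 * k) (?w e)" if "e \<in> ?I" for e
  proof -
    have "2 + ?d = 2 * k" using k(1) by simp
    then show ?thesis using poly_fun_mult[OF poly_fun_wedge_fun poly_fun_monomial_fun[OF that]] by metis
  qed
  have T: "poly_fun ?d (?T e)" if "e \<in> ?I" for e
    using poly_fun_cmult[OF law.poly_fun_increment[OF int w[OF that]], of "-1"] by simp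
  then have "\<forall>e\<in>?I. \<exists>c. \<forall>y. ?T e y = (\<Sum>a\<in>?I. c a * monomial_fun a y)"
    by (intro ballI poly_fun_coefficients)
  from bchoice[OF this] obtain A where
    "\<forall>e\<in>?I. \<forall>y. ?T e y = (\<Sum>a\<in>?I. A e a * monomial_fun a y)" ..
  then have A: "?T e y = (\<Sum>a\<in>?I. A e a * monomial_fun a y)" if "e \<in> ?I" for e y
    using that by (elim ballE allE) (assumption, erule notE, assumption)
  define v where "v c y = (\<Sum>e\<in>?I. c e * ?w e y)" for c and y
  have v: "poly_fun (2 * k) (v c)" for c
    unfolding v_def using w by (intro poly_fun_sum poly_fun_cmult)
  have v_frontier: "v c y = 0" if "y \<in> frontier K" for c y
    unfolding v_def frontier_wedgeD[OF \<alpha>_pos \<alpha>_less that] by simp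
  have v_eq: "v c y - (\<integral>z. v c (y + z) \<partial>\<mu>) = (\<Sum>a\<in>?I. (\<Sum>e\<in>?I. A e a * c e) * monomial_fun a y)" for c y
  proof -
    have "(\<integral>z. v c (y + z) \<partial>\<mu>) = (\<Sum>e\<in>?I. c e * (\<integral>z. ?w e (y + z) \<partial>\<mu>))"
      unfolding v_def using law.integrable_poly_fun_shift[OF int w]
      by (subst Bochner_Integration.integral_sum) auto
    then have "v c y - (\<integral>z. v c (y + z) \<partial>\<mu>) = (\<Sum>e\<in>?I. c e * ?T e y)"
      by (simp add: v_def right_diff_distrib sum_subtractf)
    also have "\<dots> = (\<Sum>e\<in>?I. \<Sum>a\<in>?I. A e a * c e * monomial_fun a y)"
      using A by (intro sum.cong refl) (simp add: sum_distrib_left mult_ac)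
    also have "\<dots> = (\<Sum>a\<in>?I. (\<Sum>e\<in>?I. A e a * c e) * monomial_fun a y)"
      by (subst sum.swap) (simp add: sum_distrib_right)
    finally show ?thesis .
  qed
  obtain r where r: "\<And>y. H y = (\<Sum>a\<in>?I. r a * monomial_fun a y)"
    using poly_fun_coefficients[OF H] by blast
  have "\<exists>c. \<forall>a\<in>?I. (\<Sum>e\<in>?I. A e a * c e) = r a"
  proof (rule square_system_solvable[OF finite_exponents, of ?d "\<lambda>a e. A e a"])
    fix c e assume 0: "\<And>a. a \<in> ?I \<Longrightarrow> (\<Sum>e\<in>?I. A e a * c e) = 0" and e: "e \<in> ?I"
    have v0: "v c y = 0" for y
    proof (rule harmonic_fun_vanishes[OF int k v v_frontier])
      fix x
      have "v c x - (\<integral>z. v c (x + z) \<partial>\<mu>) = 0"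
        unfolding v_eq by (intro sum.neutral ballI) (simp add: 0)
      then show "(\<integral>z. v c (x + z) \<partial>\<mu>) = v c x" by linarith
    qed
    have "(\<Sum>e\<in>?I. c e * monomial_fun e y) = 0" for y
    proof (rule poly_fun_eqI[OF _ poly_fun_const])
      show "poly_fun ?d (\<lambda>y. \<Sum>e\<in>?I. c e * monomial_fun e y)"
        by (intro poly_fun_sum poly_fun_cmult poly_fun_monomial_fun)
      fix x assume x: "x \<in> R \<inter> K"
      have "snd x * ray_gap \<alpha> x * (\<Sum>e\<in>?I. c e * monomial_fun e x) = v c x"
        by (simp add: v_def sum_distrib_left mult_ac)
      then show "(\<Sum>e\<in>?I. c e * monomial_fun e x) = 0"
        using wedge_fun_pos[of x] x v0[of x] by auto
    qed
    then show "c e = 0" using e by (rule monomials_independent)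
  qed
  then obtain c where "\<forall>a\<in>?I. (\<Sum>e\<in>?I. A e a * c e) = r a" by blast
  then have "\<forall>y. v c y - (\<integral>z. v c (y + z) \<partial>\<mu>) = H y" by (simp add: v_eq r)
  then show ?thesis using v v_frontier by blast
qed

text \<open>
  The first-step decomposition, required on the whole plane so that degrees can be compared.
\<close>

definition moment_recursion :: "nat \<Rightarrow> (nat \<Rightarrow> real \<times> real \<Rightarrow> real) \<Rightarrow> bool" where
  "moment_recursion k u \<longleftrightarrow> (\<forall>y. u k y = (\<integral>z. u k (y + z) \<partial>\<mu>) + (\<Sum>j<k. real (k choose j) * (\<integral>z. u j (y + z) \<partial>\<mu>)))"

lemma poly_fun_lower_moments:
  assumes int: "integrable \<mu> (\<lambda>z. norm z ^ (2 * k))"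
    and u: "\<And>j. j < k \<Longrightarrow> is_moment_fun j (u j)"
  shows "poly_fun (2 * k - 2) (\<lambda>y. \<Sum>j<k. real (k choose j) * (\<integral>z. u j (y + z) \<partial>\<mu>))"
proof (intro poly_fun_sum poly_fun_cmult)
  fix j assume "j \<in> {..<k}"
  then have "poly_fun (2 * j) (u j)" "integrable \<mu> (\<lambda>z. norm z ^ (2 * j))" "2 * j \<le> 2 * k - 2"
    using u[of j] by (auto simp: is_moment_fun_def intro!: law.integrable_norm_power[OF int])
  then show "poly_fun (2 * k - 2) (\<lambda>y. \<integral>z. u j (y + z) \<partial>\<mu>)"
    using law.poly_fun_expectation poly_fun_mono by blast
qed

lemma moment_funs_exist:
  assumes int: "integrable \<mu> (\<lambda>z. norm z ^ (2 * k))" and k: "real k * \<alpha> < pi / 2"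
  shows "\<exists>u. u 0 = (\<lambda>_. 1) \<and> (\<forall>j\<le>k. is_moment_fun j (u j)) \<and> (\<forall>j\<in>{1..k}. moment_recursion j u)"
  using assms
proof (induction k)
  case 0
  then show ?case using is_moment_fun_0 by (intro exI[of _ "\<lambda>_ _. 1"]) simp
next
  case (Suc k)
  have "integrable \<mu> (\<lambda>z. norm z ^ (2 * k))" by (rule law.integrable_norm_power[OF Suc.prems(1)]) simp
  moreover have "real k * \<alpha> \<le> real (Suc k) * \<alpha>" using \<alpha>_pos by (intro mult_right_mono) auto
  ultimately obtain u where u: "u 0 = (\<lambda>_. 1)" "\<And>j. j < Suc k \<Longrightarrow> is_moment_fun j (u j)"
    "\<And>j. j \<in> {1..k} \<Longrightarrow> moment_recursion j u"
    using Suc.IH Suc.prems(2) by (auto simp: less_Suc_eq_le)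
  let ?H = "\<lambda>y. \<Sum>j<Suc k. real (Suc k choose j) * (\<integral>z. u j (y + z) \<partial>\<mu>)"
  obtain v where v: "poly_fun (2 * Suc k) v" "\<And>y. y \<in> frontier K \<Longrightarrow> v y = 0"
    "\<And>y. v y - (\<integral>z. v (y + z) \<partial>\<mu>) = ?H y"
    using poisson_equation_solvable[OF Suc.prems(1) _ Suc.prems(2) poly_fun_lower_moments[OF Suc.prems(1) u(2)]]
    by auto
  have rec: "v y = (\<integral>z. v (y + z) \<partial>\<mu>) + ?H y" for y using v(3)[of y] by linarith
  have vm: "is_moment_fun (Suc k) v"
    by (rule is_moment_funI[OF Suc.prems(1) _ Suc.prems(2) u(2) u(1) v(1,2) rec]) auto
  let ?u = "u(Suc k := v)"
  have rec_u: "moment_recursion j ?u" if "j \<in> {1..Suc k}" for j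
  proof (cases "j = Suc k")
    case True
    have same: "(\<Sum>j<Suc k. real (Suc k choose j) * (\<integral>z. ?u j (y + z) \<partial>\<mu>)) = ?H y" for y
      by (rule sum.cong) auto
    show ?thesis unfolding True moment_recursion_def fun_upd_same same by (intro allI rec)
  next
    case False
    then have j: "j \<in> {1..k}" using that by auto
    have "(\<Sum>i<j. real (j choose i) * (\<integral>z. ?u i (y + z) \<partial>\<mu>)) = (\<Sum>i<j. real (j choose i) * (\<integral>z. u i (y + z) \<partial>\<mu>))" for y
      using j by (intro sum.cong) auto
    then show ?thesis using u(3)[OF j] False unfolding moment_recursion_def by simp
  qed
  show ?case
  proof (intro exI[of _ ?u] conjI allI impI ballI rec_u)
    show "?u 0 = (\<lambda>_. 1)" using u(1) by simp
    show "is_moment_fun j (?u j)" if "j \<le> Suc k" for j using that vm u(2)[of j] by (cases "j = Suc k") auto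
  qed
qed

text \<open>
  If \<open>u (m + 2)\<close> had degree at most \<open>2m + 3\<close>, then the right-hand side \<open>(m + 2) * P (u (m + 1)) + \<dots>\<close> of its
  recursion would have degree at most \<open>2m + 1\<close>. The omitted terms have degree at most \<open>2m\<close>, and so has
  \<open>P (u (m + 1)) - u (m + 1)\<close>. Hence \<open>u (m + 1)\<close> would have degree at most \<open>2m + 1\<close>. For \<open>u 1\<close>, an affine
  function is harmonic, whereas the drift of \<open>u 1\<close> is \<open>- 1\<close>.
\<close>

lemma moment_fun_degree_ge:
  assumes int: "integrable \<mu> (\<lambda>z. norm z ^ (2 * k))"
    and u: "u 0 = (\<lambda>_. 1)" "\<And>j. j \<le> k \<Longrightarrow> is_moment_fun j (u j)" "\<And>j. j \<in> {1..k} \<Longrightarrow> moment_recursion j u"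
  shows "Suc m \<le> k \<Longrightarrow> \<not> poly_fun (2 * m + 1) (u (Suc m))"
proof (induction m)
  case 0
  show ?case
  proof
    assume "poly_fun (2 * 0 + 1) (u (Suc 0))"
    then have "(\<integral>z. u (Suc 0) (0 + z) \<partial>\<mu>) = u (Suc 0) 0" by (intro law.affine_fun_harmonic) auto
    moreover have "moment_recursion (Suc 0) u" using u(3)[of "Suc 0"] 0 by simp
    then have "u (Suc 0) 0 = (\<integral>z. u (Suc 0) (0 + z) \<partial>\<mu>) + (\<Sum>j<Suc 0. real (Suc 0 choose j) * (\<integral>z. u j (0 + z) \<partial>\<mu>))"
      unfolding moment_recursion_def by (rule spec)
    then have "u (Suc 0) 0 = (\<integral>z. u (Suc 0) (0 + z) \<partial>\<mu>) + 1" by (simp add: u(1))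
    ultimately show False by linarith
  qed
next
  case (Suc m)
  let ?n = "Suc m"
  have int': "integrable \<mu> (\<lambda>z. norm z ^ d)" if "d \<le> 2 * k" for d
    using law.integrable_norm_power[OF int that] .
  show ?case
  proof
    assume p: "poly_fun (2 * Suc m + 1) (u (Suc (Suc m)))"
    let ?G = "\<lambda>y. \<Sum>j<Suc ?n. real (Suc ?n choose j) * (\<integral>z. u j (y + z) \<partial>\<mu>)"
    let ?L = "\<lambda>y. \<Sum>j<?n. real (Suc ?n choose j) * (\<integral>z. u j (y + z) \<partial>\<mu>)"
    let ?Q = "\<lambda>y. \<integral>z. u ?n (y + z) \<partial>\<mu>"
    have un: "poly_fun (2 * ?n) (u ?n)" using u(2)[of ?n] Suc.prems by (simp add: is_moment_fun_def)
    have inc: "poly_fun (2 * m + 1) (\<lambda>y. (\<integral>z. u (Suc ?n) (y + z) \<partial>\<mu>) - u (Suc ?n) y)"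
      using law.poly_fun_increment[OF int' p] Suc.prems by simp
    have G: "?G y = - ((\<integral>z. u (Suc ?n) (y + z) \<partial>\<mu>) - u (Suc ?n) y)" for y
    proof -
      have "moment_recursion (Suc ?n) u" using Suc.prems by (intro u(3)) simp
      then have "u (Suc ?n) y = (\<integral>z. u (Suc ?n) (y + z) \<partial>\<mu>) + ?G y"
        unfolding moment_recursion_def by (rule spec)
      then show ?thesis by linarith
    qed
    have L: "poly_fun (2 * m + 1) ?L"
    proof (intro poly_fun_sum poly_fun_cmult)
      fix j assume "j \<in> {..<?n}"
      then have "poly_fun (2 * j) (u j)" "2 * j \<le> 2 * k" "2 * j \<le> 2 * m + 1"
        using u(2)[of j] Suc.prems by (auto simp: is_moment_fun_def)
      then show "poly_fun (2 * m + 1) (\<lambda>y. \<integral>z. u j (y + z) \<partial>\<mu>)"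
        using law.poly_fun_expectation[OF int'] poly_fun_mono by blast
    qed
    have incn: "poly_fun (2 * m + 1) (\<lambda>y. ?Q y - u ?n y)"
      using law.poly_fun_increment[OF int' un] Suc.prems by (rule_tac poly_fun_mono) auto
    \<comment> \<open>the recursion solved for its term of highest degree\<close>
    have un_eq: "u ?n = (\<lambda>y. (1 / real (Suc ?n)) *
        ((- 1) * ((\<integral>z. u (Suc ?n) (y + z) \<partial>\<mu>) - u (Suc ?n) y) - ?L y) - (?Q y - u ?n y))"
    proof
      fix y
      have "real (Suc ?n) * ?Q y = ?G y - ?L y" by simp
      then show "u ?n y = (1 / real (Suc ?n)) *
          ((- 1) * ((\<integral>z. u (Suc ?n) (y + z) \<partial>\<mu>) - u (Suc ?n) y) - ?L y) - (?Q y - u ?n y)"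
        using G[of y] by (simp add: field_simps)
    qed
    have "poly_fun (2 * m + 1) (u ?n)"
      by (subst un_eq) (intro poly_fun_diff poly_fun_cmult inc L incn)
    then show False using Suc by simp
  qed
qed

text \<open>
  A multiple of the product of the equations of the two rays; the \<open>- (snd z)\<^sup>2\<close> in the expansion at \<open>y + z\<close> gives the
  drift \<open>- 1\<close>.
\<close>

lemma first_moment_fun: "is_moment_fun 1 (\<lambda>y. snd y * (fst y * tan \<alpha> - snd y))"
proof (rule is_moment_funI[where u = "\<lambda>_ _. 1"])
  let ?f = "\<lambda>y. snd y * (fst y * tan \<alpha> - snd y)"
  have c: "0 < cos \<alpha>" using \<alpha>_pos \<alpha>_less by (intro cos_gt_zero) auto
  have f_eq: "?f y = 1 / cos \<alpha> * (snd y * ray_gap \<alpha> y)" for y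
    using c by (simp add: ray_gap_def tan_def field_simps)
  show p: "poly_fun (2 * 1) ?f"
    unfolding f_eq mult_1_right by (rule poly_fun_cmult[OF poly_fun_wedge_fun])
  show "?f y = 0" if "y \<in> frontier K" for y
    unfolding f_eq using frontier_wedgeD[OF \<alpha>_pos \<alpha>_less that] by simp
  show "?f y = (\<integral>z. ?f (y + z) \<partial>\<mu>) + (\<Sum>j<1. real (1 choose j) * (\<integral>z. 1 \<partial>\<mu>))" for y
  proof -
    have "?f (y + z) = ?f y + (tan \<alpha> * snd y) * fst z + (fst y * tan \<alpha> - 2 * snd y) * snd z
        + tan \<alpha> * (fst z * snd z) - snd z * snd z" for z
      by (simp add: algebra_simps)
    then have "(\<integral>z. ?f (y + z) \<partial>\<mu>) = ?f y - 1"
      using law.integrable_fst law.integrable_snd law.integrable_fst_snd law.integrable_snd2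
        law.mean_fst law.mean_snd law.cov law.var_snd
      by simp
    then show ?thesis by simp
  qed
qed (use law.integrable_norm_square \<alpha>_less is_moment_fun_0 in auto)

lemma exit_moment_ge_1:
  assumes "x \<in> R \<inter> K" shows "1 \<le> exit_moment M K Y k x"
proof (cases "k = 0")
  case True
  then show ?thesis by (simp add: exit_moment_def emeasure_space_1)
next
  case False
  have "(\<Sum>n\<in>{0}. of_nat (power_increment k n) * survival n x) \<le> moment_series k x"
    unfolding moment_series_def by (rule sum_le_suminf) auto
  then show ?thesis using False assms by (simp add: exit_moment_eq_series power_increment_def power_0_left)
qed

text \<open>
  Exit moments are at least 1, so the truncation of negative reals in \<open>ennreal\<close> cannot hide a difference
  between the two polynomials at a lattice point.
\<close>

lemma represents_moment_unique:
  assumes "represents_moment M K Y R k p" "is_moment_fun k u"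
  shows "poly2 p = u"
proof
  fix y
  show "poly2 p y = u y"
  proof (rule poly_fun_eqI)
    show "poly_fun (total_degree p) (poly2 p)" by (rule poly_fun_poly2) (simp add: total_degree_le_iff[symmetric])
    show "poly_fun (2 * k) u" using assms(2) by (simp add: is_moment_fun_def)
    fix x assume x: "x \<in> R \<inter> K"
    then have "ennreal (poly2 p x) = ennreal (u x)" "0 \<le> u x" "1 \<le> ennreal (poly2 p x)"
      using assms exit_moment_ge_1[OF x, of k] by (auto simp: represents_moment_def is_moment_fun_def)
    moreover from this have "0 \<le> poly2 p x" by (metis ennreal_neg linorder_le_cases not_one_le_zero)
    ultimately show "poly2 p x = u x" by simp
  qed
qed

lemma polynomial_moment:
  assumes int: "integrable \<mu> (\<lambda>z. norm z ^ (2 * k))" and k: "1 \<le> k" "real k * \<alpha> < pi / 2"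
  shows "\<exists>p. total_degree p = 2 * k \<and> represents_moment M K Y R k p"
proof -
  obtain u where u: "u 0 = (\<lambda>_. 1)" "\<And>j. j \<le> k \<Longrightarrow> is_moment_fun j (u j)" "\<And>j. j \<in> {1..k} \<Longrightarrow> moment_recursion j u"
    using moment_funs_exist[OF int k(2)] by blast
  obtain p where p: "degree_le (2 * k) p" "poly2 p = u k"
    using u(2)[of k] poly_fun_imp_poly2[of "2 * k" "u k"] unfolding is_moment_fun_def by blast
  have "\<not> total_degree p \<le> 2 * (k - 1) + 1"
    using moment_fun_degree_ge[OF int u, of "k - 1"] k(1) p(2) poly_fun_poly2[of "2 * (k - 1) + 1" p]
    by (auto simp: total_degree_le_iff)
  moreover have "total_degree p \<le> 2 * k" using p(1) by (simp add: total_degree_le_iff)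
  ultimately have "total_degree p = 2 * k" using k(1) by linarith
  moreover have "represents_moment M K Y R k p"
    using u(2)[of k] by (simp add: represents_moment_def is_moment_fun_def p(2))
  ultimately show ?thesis by blast
qed

text \<open>
  The difference of two solutions vanishes on the frontier and is harmonic on the lattice points of the
  wedge, hence it is zero.
\<close>

lemma moment_problem_iff:
  assumes int: "integrable \<mu> (\<lambda>z. norm z ^ (2 * k))" and k: "1 \<le> k" "real k * \<alpha> < pi / 2"
    and p: "\<And>j. j \<le> k \<Longrightarrow> represents_moment M K Y R j (p j)"
  shows "(total_degree q \<le> 2 * k \<and> (\<forall>y\<in>frontier K. poly2 q y = 0) \<and>
     (\<forall>x\<in>R \<inter> K. poly2 q x = (\<integral>z. poly2 q (x + z) \<partial>\<mu>) +
        (\<Sum>j<k. real (k choose j) * (\<integral>z. poly2 (p j) (x + z) \<partial>\<mu>)))) \<longleftrightarrow> q = p k"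
    (is "?solves q \<longleftrightarrow> _")
proof -
  obtain u where u: "\<And>j. j \<le> k \<Longrightarrow> is_moment_fun j (u j)" "\<And>j. j \<in> {1..k} \<Longrightarrow> moment_recursion j u"
    using moment_funs_exist[OF int k(2)] by blast
  have pu: "poly2 (p j) = u j" if "j \<le> k" for j
    using represents_moment_unique[OF p u(1)] that by blast
  have uk: "poly_fun (2 * k) (u k)" and frontier: "\<And>y. y \<in> frontier K \<Longrightarrow> u k y = 0"
    using u(1)[of k] k(1) by (auto simp: is_moment_fun_def)
  let ?H = "\<lambda>x. \<Sum>j<k. real (k choose j) * (\<integral>z. poly2 (p j) (x + z) \<partial>\<mu>)"
  have rec: "u k x = (\<integral>z. u k (x + z) \<partial>\<mu>) + ?H x" for x
  proof -
    have "?H x = (\<Sum>j<k. real (k choose j) * (\<integral>z. u j (x + z) \<partial>\<mu>))"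
      by (intro sum.cong refl) (simp add: pu)
    moreover have "moment_recursion k u" using k(1) by (intro u(2)) simp
    then have "u k x = (\<integral>z. u k (x + z) \<partial>\<mu>) + (\<Sum>j<k. real (k choose j) * (\<integral>z. u j (x + z) \<partial>\<mu>))"
      unfolding moment_recursion_def by (rule spec)
    ultimately show ?thesis by linarith
  qed
  show ?thesis
  proof
    assume q: "?solves q"
    then have "degree_le (2 * k) q" by (simp add: total_degree_le_iff)
    then have qf: "poly_fun (2 * k) (poly2 q)" by (rule poly_fun_poly2)
    have "poly2 q y - u k y = 0" for y
    proof (rule harmonic_fun_vanishes[OF int k poly_fun_diff[OF qf uk]])
      show "poly2 q y - u k y = 0" if "y \<in> frontier K" for y using q frontier that by simp
      fix x assume x: "x \<in> R \<inter> K"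
      have "(\<integral>z. poly2 q (x + z) - u k (x + z) \<partial>\<mu>) = (\<integral>z. poly2 q (x + z) \<partial>\<mu>) - (\<integral>z. u k (x + z) \<partial>\<mu>)"
        by (intro Bochner_Integration.integral_diff law.integrable_poly_fun_shift[OF int] qf uk)
      moreover have "poly2 q x = (\<integral>z. poly2 q (x + z) \<partial>\<mu>) + ?H x" using q x by blast
      ultimately show "(\<integral>z. poly2 q (x + z) - u k (x + z) \<partial>\<mu>) = poly2 q x - u k x"
        using rec[of x] by linarith
    qed
    then show "q = p k" by (intro poly2_inject) (simp add: pu)
  next
    assume q: "q = p k"
    obtain p' where p': "degree_le (2 * k) p'" "poly2 p' = u k" using poly_fun_imp_poly2[OF uk] by blast
    have "p k = p'" by (rule poly2_inject) (simp add: pu p')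
    show "?solves q"
    proof (intro conjI ballI)
      show "total_degree q \<le> 2 * k" using p'(1) \<open>p k = p'\<close> by (simp add: q total_degree_le_iff)
      show "poly2 q y = 0" if "y \<in> frontier K" for y using frontier[OF that] by (simp add: q pu)
      show "poly2 q x = (\<integral>z. poly2 q (x + z) \<partial>\<mu>) + ?H x" for x
        unfolding q pu[OF order_refl] by (rule rec)
    qed
  qed
qed

end

theorem theorem4:
  fixes M :: "'w measure"
    and X :: "'w \<Rightarrow> real \<times> real"
    and Y :: "nat \<Rightarrow> 'w \<Rightarrow> real \<times> real"
    and R :: "(real \<times> real) set"
    and \<alpha> :: real
  assumes "prob_space M"
    and "X \<in> borel_measurable M"
    and "integrable M (\<lambda>\<omega>. norm (X \<omega>) ^ 2)"
    and "(\<integral>\<omega>. fst (X \<omega>) \<partial>M) = 0" and "(\<integral>\<omega>. snd (X \<omega>) \<partial>M) = 0"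
    and "(\<integral>\<omega>. fst (X \<omega>) * fst (X \<omega>) \<partial>M) = 1"
    and "(\<integral>\<omega>. snd (X \<omega>) * snd (X \<omega>) \<partial>M) = 1"
    and "(\<integral>\<omega>. fst (X \<omega>) * snd (X \<omega>) \<partial>M) = 0"
    and "prob_space.indep_vars M (\<lambda>_. borel) Y {1..}"
    and "\<And>i. i \<ge> 1 \<Longrightarrow> distr M borel (Y i) = distr M borel X"
    and "planar_lattice R"
    and "AE \<omega> in M. \<forall>n. walk Y n \<omega> \<in> R"
    and "0 < \<alpha>" and "\<alpha> \<le> pi"
    and "\<And>x. x \<in> R \<inter> wedge \<alpha> \<Longrightarrow>
           AE \<omega> in M. exit_time (wedge \<alpha>) Y x \<omega> \<noteq> \<infinity> \<and>
             x + walk Y (the_enat (exit_time (wedge \<alpha>) Y x \<omega>)) \<omega> \<in> frontier (wedge \<alpha>)"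
  shows "(\<forall>k::nat. k \<ge> 1 \<and> real k < pi / (2 * \<alpha>) \<and> integrable M (\<lambda>\<omega>. norm (X \<omega>) ^ (2 * k)) \<longrightarrow>
            (\<exists>p. total_degree p = 2 * k \<and> represents_moment M (wedge \<alpha>) Y R k p))
       \<and> (1 < pi / (2 * \<alpha>) \<longrightarrow>
            (\<forall>x \<in> R \<inter> wedge \<alpha>.
               exit_moment M (wedge \<alpha>) Y 1 x = ennreal (snd x * (fst x * tan \<alpha> - snd x))))
       \<and> (\<forall>k::nat. k \<ge> 1 \<and> real k < pi / (2 * \<alpha>) \<and> integrable M (\<lambda>\<omega>. norm (X \<omega>) ^ (2 * k)) \<longrightarrow>
            (\<forall>p. (\<forall>j\<le>k. represents_moment M (wedge \<alpha>) Y R j (p j)) \<longrightarrow>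
               (\<forall>q. solves_moment_problem M X (wedge \<alpha>) R k p q \<longleftrightarrow> q = p k)))"
proof -
  note [measurable] = assms(2)
  define \<mu> where "\<mu> = distr M borel X"
  have fst_snd [measurable]: "fst \<in> borel_measurable (borel :: (real \<times> real) measure)"
    "snd \<in> borel_measurable (borel :: (real \<times> real) measure)"
    by (auto intro!: borel_measurable_continuous_onI continuous_intros)
  interpret M: prob_space M by fact
  have ww: "wedge_walk \<mu> M Y R \<alpha>" if "\<alpha> < pi / 2"
  proof (intro wedge_walk.intro isotropic_law.intro isotropic_law_axioms.intro wedge_walk_axioms.intro assms that)
    show "prob_space \<mu>" unfolding \<mu>_def by (rule M.prob_space_distr) measurable
    show "sets \<mu> = sets borel" by (simp add: \<mu>_def)
    show "integrable \<mu> (\<lambda>z. norm z ^ 2)" using assms(3) by (simp add: \<mu>_def integrable_distr_eq)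
    show "distr M borel (Y i) = \<mu>" if "1 \<le> i" for i using assms(10)[OF that] by (simp add: \<mu>_def)
  qed (use assms(4-8) in \<open>simp_all add: \<mu>_def integral_distr\<close>)
  have angle: "\<alpha> < pi / 2 \<and> real k * \<alpha> < pi / 2" if "1 \<le> k" "real k < pi / (2 * \<alpha>)" for k :: nat
  proof -
    have *: "real k * \<alpha> < pi / 2" using that(2) assms(13) by (simp add: field_simps)
    have "1 * \<alpha> \<le> real k * \<alpha>" using that(1) assms(13) by (intro mult_right_mono) auto
    then show ?thesis using * by simp
  qed
  have moment: "integrable \<mu> (\<lambda>z. norm z ^ (2 * k))" if "integrable M (\<lambda>\<omega>. norm (X \<omega>) ^ (2 * k))" for k
    using that by (simp add: \<mu>_def integrable_distr_eq)
  have law_integral: "(\<integral>\<omega>. poly2 q (x + X \<omega>) \<partial>M) = (\<integral>z. poly2 q (x + z) \<partial>\<mu>)" for q x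
  proof -
    have "poly_fun (total_degree q) (poly2 q)" by (rule poly_fun_poly2) (simp add: total_degree_le_iff[symmetric])
    then have [measurable]: "poly2 q \<in> borel_measurable borel" by (rule borel_measurable_poly_fun)
    show ?thesis unfolding \<mu>_def by (subst integral_distr) auto
  qed
  show ?thesis
  proof (intro conjI allI impI)
    fix k :: nat
    assume k: "1 \<le> k \<and> real k < pi / (2 * \<alpha>) \<and> integrable M (\<lambda>\<omega>. norm (X \<omega>) ^ (2 * k))"
    interpret wedge_walk \<mu> M Y R \<alpha> using angle[of k] k by (intro ww) blast
    show "\<exists>p. total_degree p = 2 * k \<and> represents_moment M (wedge \<alpha>) Y R k p"
      using polynomial_moment[OF moment, of k] angle[of k] k by blast
  next
    assume "1 < pi / (2 * \<alpha>)"
    then interpret wedge_walk \<mu> M Y R \<alpha> using angle[of 1] by (intro ww) simp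
    show "\<forall>x\<in>R \<inter> wedge \<alpha>. exit_moment M (wedge \<alpha>) Y 1 x = ennreal (snd x * (fst x * tan \<alpha> - snd x))"
      using first_moment_fun unfolding is_moment_fun_def by blast
  next
    fix k :: nat and p q
    assume k: "1 \<le> k \<and> real k < pi / (2 * \<alpha>) \<and> integrable M (\<lambda>\<omega>. norm (X \<omega>) ^ (2 * k))"
      and p: "\<forall>j\<le>k. represents_moment M (wedge \<alpha>) Y R j (p j)"
    interpret wedge_walk \<mu> M Y R \<alpha> using angle[of k] k by (intro ww) blast
    show "solves_moment_problem M X (wedge \<alpha>) R k p q \<longleftrightarrow> q = p k"
      unfolding solves_moment_problem_def law_integral
      using moment_problem_iff[OF moment, of k p q] angle[of k] k p by blast
  qed
qed

end
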